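(* Let $n\ge 3$ and $a\in[0,1]$. Let $\psi\in C(\mathbb{R};\mathcal{H}^a_x(\mathbb{R}^n))$ be a global solution of $$i\partial_t\psi-H_0\psi=N(x,t,|\psi|)\psi,\qquad \psi(x,0)=\psi_0\in\mathcal{H}^a_x(\mathbb{R}^n),$$ satisfying the uniform bound $\sup_{t\in\mathbb{R}}\|\psi(t)\|_{\mathcal{H}^a_x}<\infty$ (the bound depending on $\|\psi_0\|_{\mathcal{H}^a_x}$). Write $V(x,t):=N(x,t,|\psi(x,t)|)$ and assume $V\in L^\infty_t\mathcal{H}^a_x(\mathbb{R}^n\times\mathbb{R})$. Then for every $\alpha\in(0,1-2/n)$ the limit $$\Omega_\alpha^*\psi(0):=\lim_{t\to\infty} e^{itH_0}F_c\Big(\frac{|x-2tP|}{t^\alpha}\le 1\Big)\psi(t)$$ exists in the norm of $\mathcal{H}^a_x(\mathbb{R}^n)$, and $$\text{w-}\lim_{t\to\infty} e^{itH_0}\bar F_c\Big(\frac{|x-2tP|}{t^\alpha}> 1\Big)\psi(t)=0\quad\text{weakly in }\mathcal{H}^a_x(\mathbb{R}^n).$$ Consequently, with $\psi_w(t):=\bar F_c\big(\frac{|x-2tP|}{t^\alpha}>1\big)\psi(t)$, $$\lim_{t\to\infty}\|\psi(t)-e^{-itH_0}\Omega_\alpha^*\psi(0)-\psi_w(t)\|_{\mathcal{H}^a_x}=0.$$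
   Context: $H_0=-\Delta_x$ on $\mathbb{R}^n$, $P=-i\nabla_x$, and $\mathcal{H}^a_x(\mathbb{R}^n)$ is the Sobolev space with norm $\|\langle P\rangle^a f\|_{L^2}$, $\langle P\rangle=(1+|P|^2)^{1/2}$. The nonlinearity $N$ may be complex-valued and time-dependent. Fix a smooth $\chi_c:\mathbb{R}\to[0,1]$ with $\chi_c=1$ on $[1,\infty)$ and $\chi_c=0$ on $(-\infty,1/2]$. For a (possibly operator-valued) quantity $A$ and $\lambda>0$ set $F_c(A/\lambda\le 1):=1-\chi_c(A/\lambda)$ and $\bar F_c(A/\lambda>1):=\chi_c(A/\lambda)=1-F_c(A/\lambda\le1)$. Functions of $x$ act by multiplication, and for any such function $F$ the operator $F(|x-2tP|/t^\alpha)$ is defined by $F(|x-2tP|/t^\alpha):=e^{-itH_0}F(|x|/t^\alpha)e^{itH_0}$ (the components of $x-2tP$ commute). *)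

theory Defs
  imports "HOL-Analysis.Analysis"
begin

text \<open>Functions on R^n are modelled as maps real^'n => complex.
  Fourier transform convention: FT f xi = integral of exp(-i x.xi) f(x) dx,
  so that H_0 = -Laplacian has symbol |xi|^2.\<close>

abbreviation L2 :: "((real^'n::finite) \<Rightarrow> complex) \<Rightarrow> bool" where
  "L2 f \<equiv> f \<in> borel_measurable lebesgue \<and> integrable lebesgue (\<lambda>x. (cmod (f x))\<^sup>2)"

definition FT1 :: "((real^'n::finite) \<Rightarrow> complex) \<Rightarrow> real^'n \<Rightarrow> complex" where
  "FT1 f \<xi> = (LINT x|lebesgue. cis (- (x \<bullet> \<xi>)) * f x)"

definition L2FT :: "((real^'n::finite) \<Rightarrow> complex) \<Rightarrow> (real^'n \<Rightarrow> complex) \<Rightarrow> bool" where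
  "L2FT f g \<longleftrightarrow> L2 g \<and>
     ((\<lambda>R. LINT \<xi>|lebesgue. (cmod (FT1 (\<lambda>x. if x \<in> ball 0 R then f x else 0) \<xi> - g \<xi>))\<^sup>2)
        \<longlongrightarrow> 0) at_top"

definition fourier :: "((real^'n::finite) \<Rightarrow> complex) \<Rightarrow> real^'n \<Rightarrow> complex" where
  "fourier f = (SOME g. L2FT f g)"

text \<open>Sobolev space H^a with norm || <P>^a f ||_{L^2} (computed on the Fourier side
  by Plancherel, with the factor (2 pi)^(-n)).\<close>
definition in_Ha :: "real \<Rightarrow> ((real^'n::finite) \<Rightarrow> complex) \<Rightarrow> bool" where
  "in_Ha a f \<longleftrightarrow> L2 f \<and>
     integrable lebesgue (\<lambda>\<xi>::real^'n. (1 + (norm \<xi>)\<^sup>2) powr a * (cmod (fourier f \<xi>))\<^sup>2)"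

definition Ha_norm :: "real \<Rightarrow> ((real^'n::finite) \<Rightarrow> complex) \<Rightarrow> real" where
  "Ha_norm a f = sqrt ((2 * pi) powr (- real CARD('n)) *
     (LINT \<xi>|lebesgue. (1 + (norm (\<xi>::real^'n))\<^sup>2) powr a * (cmod (fourier f \<xi>))\<^sup>2))"

definition Ha_inner :: "real \<Rightarrow> ((real^'n::finite) \<Rightarrow> complex) \<Rightarrow> (real^'n \<Rightarrow> complex) \<Rightarrow> complex" where
  "Ha_inner a f g = complex_of_real ((2 * pi) powr (- real CARD('n))) *
     (LINT \<xi>|lebesgue. complex_of_real ((1 + (norm (\<xi>::real^'n))\<^sup>2) powr a)
                         * cnj (fourier g \<xi>) * fourier f \<xi>)"

definition free_evol :: "real \<Rightarrow> ((real^'n::finite) \<Rightarrow> complex) \<Rightarrow> real^'n \<Rightarrow> complex" where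
  "free_evol s f = (SOME h. L2 h \<and> L2FT h (\<lambda>\<xi>. cis (- s * (norm \<xi>)\<^sup>2) * fourier f \<xi>))"

text \<open>F(|x - 2tP| / t^alpha) := e^{-itH_0} F(|x|/t^alpha) e^{itH_0}.\<close>
definition phase_op :: "(real \<Rightarrow> real) \<Rightarrow> real \<Rightarrow> real \<Rightarrow> ((real^'n::finite) \<Rightarrow> complex) \<Rightarrow> real^'n \<Rightarrow> complex" where
  "phase_op F \<alpha> t f = free_evol t (\<lambda>x. complex_of_real (F (norm x / t powr \<alpha>)) * free_evol (- t) f x)"

definition smooth_real :: "(real \<Rightarrow> real) \<Rightarrow> bool" where
  "smooth_real f \<longleftrightarrow> (\<forall>k x. ((deriv ^^ k) f) differentiable (at x))"

text \<open>Mild (Duhamel) solution of  i d_t psi - H_0 psi = V psi  with V(x,t) given,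
  stated on the Fourier side for almost every frequency.\<close>
definition duhamel_solution ::
  "((real^'n::finite) \<Rightarrow> real \<Rightarrow> complex) \<Rightarrow> (real \<Rightarrow> real^'n \<Rightarrow> complex) \<Rightarrow> bool" where
  "duhamel_solution V \<psi> \<longleftrightarrow> (\<forall>t. AE \<xi> in lebesgue.
      interval_lebesgue_integrable lborel (ereal 0) (ereal t)
        (\<lambda>s. cis (- (t - s) * (norm \<xi>)\<^sup>2) * FT1 (\<lambda>x. V x s * \<psi> s x) \<xi>) \<and>
      fourier (\<psi> t) \<xi> = cis (- t * (norm \<xi>)\<^sup>2) * fourier (\<psi> 0) \<xi>
        - \<i> * interval_lebesgue_integral lborel (ereal 0) (ereal t)
              (\<lambda>s. cis (- (t - s) * (norm \<xi>)\<^sup>2) * FT1 (\<lambda>x. V x s * \<psi> s x) \<xi>))"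

end

theory Submission
  imports Defs "HOL-Probability.Probability"
begin

text \<open>In the interaction picture phi(t) = e^{itH0} psi(t) the operator F(|x - 2tP|/t^alpha) becomes
  multiplication by F(|x|/t^alpha), and phi(s) - phi(t) is the integral over [t, s] of e^{iuH0} (V psi)(u).
  Since V psi is bounded in L^1, the dispersive decay u^{-n/2} gives |phi(s) - phi(t)| = O(t^{1-n/2}) pointwise,
  so phi(t) converges pointwise along t = 2^j to some Omega. On the ball of radius t^alpha the L^2 norm of
  Omega - phi(t) is O(t^{1 - n/2 + alpha n/2}), which tends to 0 exactly because alpha < 1 - 2/n.
  The same argument applied to dyadic difference quotients, whose Leibniz rule on V psi only uses the H^a norms
  of V and psi, upgrades this to H^a; the differences of the cutoff itself cost t^{-alpha}.\<close>

section \<open>Square-integrable functions\<close>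

text \<open>Duhamel's formula is available only at almost every frequency, so the dispersive
  estimate enters in dual form: increments of \<open>\<phi>\<close> are paired with test functions
  that are both integrable and square integrable, and a factor exp(-\<epsilon> |\<xi>|^2) makes the
  time and frequency integrals interchangeable before \<epsilon> tends to 0. Sup bounds and L^2
  bounds on balls are then read off by choosing the test function. For a > 0 the obstacle is the sum
  over scales. Estimating each difference quotient separately would require the suprema over time of
  the squared L^1 norms to be summable in the scale, whereas the Leibniz rule controls their sum
  only at each fixed time. Hence the whole finite family of quotients is paired at once, with
  Cauchy-Schwarz over the family inside the time integral; all bounds are uniform in the number of
  scales. The part of \<open>\<phi>\<close> outside the ball need not become small. For the strong
  limit only the tail of the fixed limit profile has to vanish; for the weak limit the outer cutoff
  is moved onto the test function.\<close>

definition l2 :: "('a::euclidean_space \<Rightarrow> complex) \<Rightarrow> bool" where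
  "l2 f \<longleftrightarrow> f \<in> borel_measurable borel \<and> integrable lborel (\<lambda>x. (cmod (f x))\<^sup>2)"

text \<open>The squared norm keeps quadratic identities and Plancherel free of roots; the price is a
  factor 2 in each use of the triangle inequality.\<close>

definition sqn :: "('a::euclidean_space \<Rightarrow> complex) \<Rightarrow> real" where
  "sqn f = (LINT x|lborel. (cmod (f x))\<^sup>2)"

definition ip :: "('a::euclidean_space \<Rightarrow> complex) \<Rightarrow> ('a \<Rightarrow> complex) \<Rightarrow> complex" where
  "ip f g = (LINT x|lborel. f x * cnj (g x))"

definition ft1 :: "('a::euclidean_space \<Rightarrow> complex) \<Rightarrow> 'a \<Rightarrow> complex" where
  "ft1 f \<xi> = (LINT x|lborel. cis (- (x \<bullet> \<xi>)) * f x)"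

lemma borel_measurable_cis [measurable]:
  "f \<in> borel_measurable M \<Longrightarrow> (\<lambda>x. cis (f x)) \<in> borel_measurable M"
  unfolding cis_conv_exp by measurable

lemma borel_measurable_cnj [measurable]:
  "f \<in> borel_measurable M \<Longrightarrow> (\<lambda>x. cnj (f x)) \<in> borel_measurable M"
  by (rule borel_measurable_continuous_on[where f=cnj]) (auto intro!: continuous_intros)

lemma l2_measurable [measurable_dest]: "l2 f \<Longrightarrow> f \<in> borel_measurable borel"
  and l2_integrable: "l2 f \<Longrightarrow> integrable lborel (\<lambda>x. (cmod (f x))\<^sup>2)"
  by (auto simp: l2_def)

lemma sqn_nonneg [simp]: "0 \<le> sqn f"
  unfolding sqn_def by (intro integral_nonneg_AE) auto

lemma sqn_cong_AE:
  assumes "f \<in> borel_measurable borel" "g \<in> borel_measurable borel" "AE x in lborel. f x = g x"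
  shows "sqn f = sqn g"
  unfolding sqn_def using assms by (intro integral_cong_AE) auto

lemma l2_cong_AE:
  assumes "f \<in> borel_measurable borel" "l2 g" "AE x in lborel. f x = g x"
  shows "l2 f"
proof -
  have "integrable lborel (\<lambda>x. (cmod (f x))\<^sup>2) = integrable lborel (\<lambda>x. (cmod (g x))\<^sup>2)"
    using assms by (intro integrable_cong_AE) auto
  then show ?thesis using assms by (auto simp: l2_def)
qed

lemma norm_add_sq_le: "(norm (a + b))\<^sup>2 \<le> 2 * (norm a)\<^sup>2 + 2 * (norm b)\<^sup>2"
proof -
  have "(norm (a + b))\<^sup>2 \<le> (norm a + norm b)\<^sup>2" by (intro power_mono norm_triangle_ineq) auto
  also have "\<dots> \<le> 2 * (norm a)\<^sup>2 + 2 * (norm b)\<^sup>2"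
    using sum_squares_bound[of "norm a" "norm b"] by (simp add: power2_sum)
  finally show ?thesis .
qed

lemma norm_diff_sq_le: "(norm (a - b))\<^sup>2 \<le> 2 * (norm a)\<^sup>2 + 2 * (norm b)\<^sup>2"
  using norm_add_sq_le[of a "- b"] by simp

lemma l2_bounded_mult:
  assumes f: "l2 f" and m[measurable]: "m \<in> borel_measurable borel" and b: "\<And>x. cmod (m x) \<le> C"
  shows "l2 (\<lambda>x. m x * f x)" "sqn (\<lambda>x. m x * f x) \<le> C\<^sup>2 * sqn f"
proof -
  note [measurable] = l2_measurable[OF f]
  have le: "(cmod (m x * f x))\<^sup>2 \<le> C\<^sup>2 * (cmod (f x))\<^sup>2" for x
    unfolding norm_mult power_mult_distrib
    by (intro mult_right_mono power_mono b) auto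
  have i: "integrable lborel (\<lambda>x. (cmod (m x * f x))\<^sup>2)"
    by (rule Bochner_Integration.integrable_bound[where f="\<lambda>x. C\<^sup>2 * (cmod (f x))\<^sup>2"])
       (use l2_integrable[OF f] le in auto)
  show "l2 (\<lambda>x. m x * f x)" using i by (auto simp: l2_def)
  show "sqn (\<lambda>x. m x * f x) \<le> C\<^sup>2 * sqn f"
    unfolding sqn_def integral_mult_right_zero[symmetric]
    by (rule integral_mono[OF i]) (use l2_integrable[OF f] le in auto)
qed

lemma l2_bounded_mult1:
  assumes "l2 f" "m \<in> borel_measurable borel" "\<And>x. cmod (m x) \<le> 1"
  shows "l2 (\<lambda>x. m x * f x)" "sqn (\<lambda>x. m x * f x) \<le> sqn f"
  using l2_bounded_mult[OF assms(1,2), of 1] assms(3) by auto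

lemma sqn_unimodular:
  assumes "\<And>x. cmod (m x) = 1"
  shows "sqn (\<lambda>x. m x * f x) = sqn f"
  by (simp add: sqn_def norm_mult assms)

lemma l2_cmult: "l2 f \<Longrightarrow> l2 (\<lambda>x. c * f x)"
  and sqn_cmult: "sqn (\<lambda>x. c * f x) = (cmod c)\<^sup>2 * sqn f"
  by (auto simp: l2_def sqn_def norm_mult power_mult_distrib)

lemma l2_cnj: "l2 f \<Longrightarrow> l2 (\<lambda>x. cnj (f x))"
  and sqn_cnj: "sqn (\<lambda>x. cnj (f x)) = sqn f"
  by (auto simp: l2_def sqn_def)

lemma l2_add:
  assumes f: "l2 f" and g: "l2 g"
  shows "l2 (\<lambda>x. f x + g x)" "sqn (\<lambda>x. f x + g x) \<le> 2 * sqn f + 2 * sqn g"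
proof -
  note [measurable] = l2_measurable[OF f] l2_measurable[OF g]
  have i0: "integrable lborel (\<lambda>x. 2 * (cmod (f x))\<^sup>2 + 2 * (cmod (g x))\<^sup>2)"
    using l2_integrable[OF f] l2_integrable[OF g] by auto
  have i: "integrable lborel (\<lambda>x. (cmod (f x + g x))\<^sup>2)"
    by (rule Bochner_Integration.integrable_bound[OF i0]) (auto intro!: norm_add_sq_le)
  show "l2 (\<lambda>x. f x + g x)" using i by (auto simp: l2_def)
  have "sqn (\<lambda>x. f x + g x) \<le> (LINT x|lborel. 2 * (cmod (f x))\<^sup>2 + 2 * (cmod (g x))\<^sup>2)"
    unfolding sqn_def by (rule integral_mono[OF i i0]) (rule norm_add_sq_le)
  also have "\<dots> = 2 * sqn f + 2 * sqn g"
    unfolding sqn_def using l2_integrable[OF f] l2_integrable[OF g] by simp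
  finally show "sqn (\<lambda>x. f x + g x) \<le> 2 * sqn f + 2 * sqn g" .
qed

lemma l2_diff:
  assumes f: "l2 f" and g: "l2 g"
  shows "l2 (\<lambda>x. f x - g x)" "sqn (\<lambda>x. f x - g x) \<le> 2 * sqn f + 2 * sqn g"
  using l2_add[OF f l2_cmult[OF g, of "-1"]] sqn_cmult[of "-1" g] by auto

lemma sqn_minus_commute: "sqn (\<lambda>x. f x - g x) = sqn (\<lambda>x. g x - f x)"
  by (simp add: sqn_def norm_minus_commute)

lemma sqn_triangle:
  assumes "l2 f" "l2 g" "l2 h"
  shows "sqn (\<lambda>x. f x - h x) \<le> 2 * sqn (\<lambda>x. f x - g x) + 2 * sqn (\<lambda>x. g x - h x)"
  using l2_add(2)[OF l2_diff(1)[OF assms(1,2)] l2_diff(1)[OF assms(2,3)]] by simp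

lemma sqn_eq_0_AE:
  assumes "l2 f" "sqn f = 0" shows "AE x in lborel. f x = 0"
  using integral_nonneg_eq_0_iff_AE[OF l2_integrable[OF assms(1)]] assms(2)
  by (auto simp: sqn_def)

lemma l2_zero [simp]: "l2 (\<lambda>x. 0)" by (simp add: l2_def)
lemma sqn_zero [simp]: "sqn (\<lambda>x. 0) = 0" by (simp add: sqn_def)

lemma l2_mult_integrable:
  assumes f: "l2 f" and g: "l2 g"
  shows "integrable lborel (\<lambda>x. f x * g x)"
proof -
  note [measurable] = l2_measurable[OF f] l2_measurable[OF g]
  have i0: "integrable lborel (\<lambda>x. (cmod (f x))\<^sup>2 + (cmod (g x))\<^sup>2)"
    using l2_integrable[OF f] l2_integrable[OF g] by auto
  show ?thesis
  proof (rule Bochner_Integration.integrable_bound[OF i0])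
    show "AE x in lborel. norm (f x * g x) \<le> norm ((cmod (f x))\<^sup>2 + (cmod (g x))\<^sup>2)"
    proof (rule AE_I2)
      fix x
      have "norm (f x * g x) \<le> 2 * cmod (f x) * cmod (g x)" by (simp add: norm_mult)
      also have "\<dots> \<le> (cmod (f x))\<^sup>2 + (cmod (g x))\<^sup>2" by (rule sum_squares_bound)
      finally show "norm (f x * g x) \<le> norm ((cmod (f x))\<^sup>2 + (cmod (g x))\<^sup>2)" by simp
    qed
  qed auto
qed

lemma l2_norm_mult_sq:
  assumes f: "l2 f" and g: "l2 g"
  shows "(LINT x|lborel. cmod (f x) * cmod (g x))\<^sup>2 \<le> sqn f * sqn g"
proof -
  note [measurable] = l2_measurable[OF f] l2_measurable[OF g]
  let ?B = "LINT x|lborel. cmod (f x) * cmod (g x)"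
  have iB: "integrable lborel (\<lambda>x. cmod (f x) * cmod (g x))"
    using integrable_norm[OF l2_mult_integrable[OF f g]] by (simp add: norm_mult)
  note iA = l2_integrable[OF f] and iC = l2_integrable[OF g]
  have q: "0 \<le> sqn f - 2 * t * ?B + t\<^sup>2 * sqn g" for t
  proof -
    have "0 \<le> (LINT x|lborel. (cmod (f x) - t * cmod (g x))\<^sup>2)"
      by (intro integral_nonneg_AE) auto
    also have "\<dots> = (LINT x|lborel. (cmod (f x))\<^sup>2 - 2 * t * (cmod (f x) * cmod (g x)) + t\<^sup>2 * (cmod (g x))\<^sup>2)"
      by (intro Bochner_Integration.integral_cong) (auto simp: power2_eq_square algebra_simps)
    also have "\<dots> = sqn f - 2 * t * ?B + t\<^sup>2 * sqn g"
      unfolding sqn_def using iA iB iC by simp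
    finally show ?thesis .
  qed
  show ?thesis
  proof (cases "sqn g = 0")
    case True
    then have "AE x in lborel. cmod (f x) * cmod (g x) = 0"
      using sqn_eq_0_AE[OF g] by auto
    then have "?B = 0" by (rule integral_eq_zero_AE)
    then show ?thesis using True by simp
  next
    case False
    then have "sqn g > 0" by (simp add: order_less_le)
    \<comment> \<open>The nonnegative quadratic in t is evaluated at its minimiser, where
      nonnegativity is Cauchy-Schwarz.\<close>
    then show ?thesis using q[of "?B / sqn g"] by (simp add: field_simps power2_eq_square)
  qed
qed

lemma ip_bound:
  assumes f: "l2 f" and g: "l2 g"
  shows "(cmod (ip f g))\<^sup>2 \<le> sqn f * sqn g"
proof -
  have "cmod (ip f g) \<le> (LINT x|lborel. cmod (f x) * cmod (g x))"
    unfolding ip_def using integral_norm_bound[of lborel "\<lambda>x. f x * cnj (g x)"] by (simp add: norm_mult)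
  then have "(cmod (ip f g))\<^sup>2 \<le> (LINT x|lborel. cmod (f x) * cmod (g x))\<^sup>2"
    by (intro power_mono) auto
  with l2_norm_mult_sq[OF f g] show ?thesis by linarith
qed

lemma ip_self: "ip f f = complex_of_real (sqn f)"
  unfolding ip_def sqn_def integral_complex_of_real[symmetric]
  by (intro Bochner_Integration.integral_cong refl) (metis complex_norm_square)

lemma ip_integrable: "l2 f \<Longrightarrow> l2 g \<Longrightarrow> integrable lborel (\<lambda>x. f x * cnj (g x))"
  by (intro l2_mult_integrable l2_cnj)

lemma ip_diff_left: "l2 f \<Longrightarrow> l2 g \<Longrightarrow> l2 h \<Longrightarrow> ip (\<lambda>x. f x - g x) h = ip f h - ip g h"
  by (simp add: ip_def left_diff_distrib ip_integrable)

lemma sqn_diff_expand: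
  assumes f: "l2 f" and g: "l2 g"
  shows "sqn (\<lambda>x. f x - g x) = sqn f - 2 * Re (ip f g) + sqn g"
proof -
  have "sqn (\<lambda>x. f x - g x) = (LINT x|lborel. (cmod (f x))\<^sup>2 - 2 * Re (f x * cnj (g x)) + (cmod (g x))\<^sup>2)"
    unfolding sqn_def by (intro Bochner_Integration.integral_cong refl)
      (unfold cmod_power2, simp add: power2_eq_square algebra_simps)
  also have "\<dots> = sqn f - 2 * (LINT x|lborel. Re (f x * cnj (g x))) + sqn g"
    unfolding sqn_def using l2_integrable[OF f] l2_integrable[OF g] ip_integrable[OF f g]
    by (auto simp del: times_complex.sel)
  also have "(LINT x|lborel. Re (f x * cnj (g x))) = Re (ip f g)"
    unfolding ip_def using integral_Re[OF ip_integrable[OF f g]] .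
  finally show ?thesis .
qed

section \<open>Translations and Fatou's lemma for Lebesgue measure\<close>

lemma lborel_shift: "distr lborel borel (\<lambda>x. x + h) = (lborel :: 'a::euclidean_space measure)"
proof -
  have "(\<lambda>x. x + h) = (+) h" by (auto simp: add.commute)
  then show ?thesis using lborel_distr_plus[of h] by simp
qed

lemma integrable_shift:
  fixes f :: "'a::euclidean_space \<Rightarrow> 'b::{banach, second_countable_topology}"
  assumes [measurable]: "f \<in> borel_measurable borel"
  shows "integrable lborel (\<lambda>x. f (x + h)) \<longleftrightarrow> integrable lborel f"
  using integrable_distr_eq[of "\<lambda>x. x + h" lborel borel f] by (simp add: lborel_shift)

lemma integral_shift:
  fixes f :: "'a::euclidean_space \<Rightarrow> 'b::{banach, second_countable_topology}"
  assumes [measurable]: "f \<in> borel_measurable borel"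
  shows "(LINT x|lborel. f (x + h)) = (LINT x|lborel. f x)"
  using integral_distr[of "\<lambda>x. x + h" lborel borel f] by (simp add: lborel_shift)

lemma AE_shift:
  fixes h :: "'a::euclidean_space"
  assumes "AE x in lborel. P x" shows "AE x in lborel. P (x + h)"
proof -
  have "AE x in distr lborel borel (\<lambda>x. x + h). P x" using assms unfolding lborel_shift .
  then show ?thesis by (rule AE_distrD[rotated]) measurable
qed

lemma l2_shift: "l2 f \<Longrightarrow> l2 (\<lambda>x. f (x + h))"
  and sqn_shift: "f \<in> borel_measurable borel \<Longrightarrow> sqn (\<lambda>x. f (x + h)) = sqn f"
  unfolding l2_def sqn_def
  using integrable_shift[of "\<lambda>x. (cmod (f x))\<^sup>2" h] integral_shift[of "\<lambda>x. (cmod (f x))\<^sup>2" h]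
  by auto

text \<open>Limits are repeatedly known only pointwise almost everywhere. This turns uniform
  integral bounds on the approximants into integrability of the limit, with the same bound.\<close>

lemma Fatou_real:
  fixes F :: "nat \<Rightarrow> 'a::euclidean_space \<Rightarrow> real"
  assumes i: "\<And>j. integrable lborel (F j)" and nn: "\<And>j x. 0 \<le> F j x"
    and b: "\<And>j. (LINT x|lborel. F j x) \<le> B"
    and m[measurable]: "f \<in> borel_measurable borel"
    and lim: "AE x in lborel. (\<lambda>j. F j x) \<longlonglongrightarrow> f x"
  shows "integrable lborel f" "(LINT x|lborel. f x) \<le> B"
proof -
  have [measurable]: "F j \<in> borel_measurable borel" for j using i[of j] by auto
  have nnf: "AE x in lborel. 0 \<le> f x"
    using lim by eventually_elim (auto intro: LIMSEQ_le_const nn)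
  have B: "0 \<le> B" using b[of 0] integral_nonneg_AE[where M=lborel and f="F 0"] nn by (meson AE_I2 order_trans)
  have "(\<integral>\<^sup>+x. ennreal (f x) \<partial>lborel) = (\<integral>\<^sup>+x. liminf (\<lambda>j. ennreal (F j x)) \<partial>lborel)"
    using lim by (intro nn_integral_cong_AE, eventually_elim)
      (auto intro!: lim_imp_Liminf[symmetric] tendsto_ennrealI)
  also have "\<dots> \<le> liminf (\<lambda>j. \<integral>\<^sup>+x. ennreal (F j x) \<partial>lborel)"
    by (intro nn_integral_liminf) auto
  also have "\<dots> \<le> liminf (\<lambda>j::nat. ennreal B)"
    using b i nn by (intro Liminf_mono) (auto simp: nn_integral_eq_integral intro!: ennreal_leI always_eventually)
  also have "\<dots> = ennreal B" by (simp add: Liminf_const)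
  finally have le: "(\<integral>\<^sup>+x. ennreal (f x) \<partial>lborel) \<le> ennreal B" .
  show I: "integrable lborel f"
    using nnf le by (intro integrableI_nonneg) (auto simp: order_le_less_trans ennreal_less_top)
  show "(LINT x|lborel. f x) \<le> B"
    using le B by (simp add: nn_integral_eq_integral[OF I nnf])
qed

lemma Fatou_sqn:
  assumes F: "\<And>j. l2 (F j)" and b: "\<And>j. sqn (F j) \<le> B"
    and m[measurable]: "f \<in> borel_measurable borel"
    and lim: "AE x in lborel. (\<lambda>j. F j x) \<longlonglongrightarrow> f x"
  shows "l2 f" "sqn f \<le> B"
proof -
  have l: "AE x in lborel. (\<lambda>j. (cmod (F j x))\<^sup>2) \<longlonglongrightarrow> (cmod (f x))\<^sup>2"
    using lim by eventually_elim (intro tendsto_intros)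
  note * = Fatou_real[OF l2_integrable[OF F] _ b[unfolded sqn_def] _ l]
  show "l2 f" "sqn f \<le> B" using * by (auto simp: l2_def sqn_def)
qed

section \<open>Gaussians and the dispersive estimate\<close>

lemma
  fixes f :: "'a::euclidean_space \<Rightarrow> real \<Rightarrow> complex"
  assumes f: "\<And>b. b \<in> Basis \<Longrightarrow> integrable lborel (f b)"
  shows integrable_lborel_prod: "integrable lborel (\<lambda>x::'a. \<Prod>b\<in>Basis. f b (x \<bullet> b))"
    and integral_lborel_prod: "(LINT x::'a|lborel. (\<Prod>b\<in>Basis. f b (x \<bullet> b))) = (\<Prod>b\<in>Basis. LINT y|lborel. f b y)"
proof -
  interpret product_sigma_finite "\<lambda>_::'a. lborel :: real measure" ..
  have [measurable]: "b \<in> Basis \<Longrightarrow> f b \<in> borel_measurable borel" for b using f[of b] by auto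
  have eq: "(\<Prod>b\<in>Basis. f b ((\<Sum>b\<in>Basis. x b *\<^sub>R b) \<bullet> b)) = (\<Prod>b\<in>Basis. f b (x b))" for x :: "'a \<Rightarrow> real"
    by (intro prod.cong refl) (simp add: inner_sum_left inner_Basis if_distrib cong: if_cong)
  show "integrable lborel (\<lambda>x::'a. \<Prod>b\<in>Basis. f b (x \<bullet> b))"
    by (subst lborel_eq, subst integrable_distr_eq)
       (auto simp: eq intro!: product_integrable_prod f)
  show "(LINT x::'a|lborel. (\<Prod>b\<in>Basis. f b (x \<bullet> b))) = (\<Prod>b\<in>Basis. LINT y|lborel. f b y)"
    by (subst lborel_eq, subst integral_distr)
       (auto simp: eq intro!: product_integral_prod f)
qed

text \<open>The characteristic function of the standard normal law is the Fourier transform of a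
  Gaussian up to scaling, which replaces a contour integral.\<close>

lemma gauss_real:
  fixes s v :: real
  assumes s: "0 < s"
  shows "integrable lborel (\<lambda>x. complex_of_real (exp (- s * x\<^sup>2)) * cis (x * v))"
    and "(LINT x|lborel. complex_of_real (exp (- s * x\<^sup>2)) * cis (x * v))
      = complex_of_real (sqrt (pi / s) * exp (- v\<^sup>2 / (4 * s)))"
proof -
  \<comment> \<open>Under x -> c x the exponent -x^2/2 of the normal density becomes -s x^2, and the
    frequency v/c becomes v.\<close>
  define c where "c = sqrt (2 * s)"
  have c: "c > 0" "c\<^sup>2 = 2 * s" using s by (auto simp: c_def)
  define F where "F x = std_normal_density x *\<^sub>R iexp (v / c * x)" for x
  have iF: "integrable lborel F"
    unfolding F_def by (rule Bochner_Integration.integrable_bound[OF integrable_std_normal_moment[of 0]])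
      (auto simp: norm_mult)
  have "char std_normal_distribution (v / c) = (LINT x|lborel. F x)"
    unfolding char_def F_def by (subst integral_density) auto
  then have e: "(LINT x|lborel. F x) = complex_of_real (exp (- ((v / c)\<^sup>2) / 2))"
    by (simp add: char_std_normal_distribution)
  have F: "F (0 + c * x) = complex_of_real (1 / sqrt (2 * pi)) * (complex_of_real (exp (- s * x\<^sup>2)) * cis (x * v))" for x
    using c by (simp add: F_def std_normal_density_def cis_conv_exp power_mult_distrib mult_ac scaleR_conv_of_real)
  have i2: "integrable lborel (\<lambda>x. F (0 + c * x))"
    using lborel_integrable_real_affine[OF iF, of c 0] c by simp
  have *: "integrable lborel (\<lambda>x. complex_of_real (sqrt (2 * pi)) * F (0 + c * x))"
    using i2 by (rule integrable_mult_right)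
  have eq: "complex_of_real (sqrt (2 * pi)) * F (0 + c * x) = complex_of_real (exp (- s * x\<^sup>2)) * cis (x * v)" for x
    unfolding F by (simp flip: of_real_mult)
  show "integrable lborel (\<lambda>x. complex_of_real (exp (- s * x\<^sup>2)) * cis (x * v))"
    using * unfolding eq .
  have "(LINT x|lborel. F x) = c *\<^sub>R (LINT x|lborel. F (0 + c * x))"
    using lborel_integral_real_affine[of c F 0] c by simp
  then have "(LINT x|lborel. F (0 + c * x)) = complex_of_real (exp (- ((v / c)\<^sup>2) / 2) / c)"
    using c by (simp add: e scaleR_conv_of_real field_simps)
  moreover have "(LINT x|lborel. complex_of_real (exp (- s * x\<^sup>2)) * cis (x * v))
      = complex_of_real (sqrt (2 * pi)) * (LINT x|lborel. F (0 + c * x))"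
    unfolding eq[symmetric] by simp
  moreover have "sqrt (2 * pi) * (exp (- ((v / c)\<^sup>2) / 2) / c) = sqrt (pi / s) * exp (- v\<^sup>2 / (4 * s))"
  proof -
    have "sqrt (2 * pi) / c = sqrt (pi / s)" unfolding c_def using s
      by (simp add: real_sqrt_divide real_sqrt_mult)
    moreover have "(v / c)\<^sup>2 / 2 = v\<^sup>2 / (4 * s)" by (simp add: power_divide c)
    ultimately show ?thesis by (metis minus_divide_left times_divide_eq_left times_divide_eq_right)
  qed
  ultimately show "(LINT x|lborel. complex_of_real (exp (- s * x\<^sup>2)) * cis (x * v))
      = complex_of_real (sqrt (pi / s) * exp (- v\<^sup>2 / (4 * s)))"
    by (simp only: flip: of_real_mult)
qed

lemma norm_sq_Basis: "(norm (x::'a::euclidean_space))\<^sup>2 = (\<Sum>b\<in>Basis. (x \<bullet> b)\<^sup>2)"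
  unfolding power2_norm_eq_inner by (subst euclidean_inner) (simp add: power2_eq_square)

lemma
  fixes v :: "'a::euclidean_space"
  assumes s: "0 < s"
  shows integrable_gauss_cis: "integrable lborel (\<lambda>x::'a. complex_of_real (exp (- s * (norm x)\<^sup>2)) * cis (x \<bullet> v))"
    and integral_gauss_cis: "(LINT x::'a|lborel. complex_of_real (exp (- s * (norm x)\<^sup>2)) * cis (x \<bullet> v))
      = complex_of_real (sqrt (pi / s) ^ DIM('a) * exp (- (norm v)\<^sup>2 / (4 * s)))"
proof -
  define f where "f b y = complex_of_real (exp (- s * y\<^sup>2)) * cis (y * (v \<bullet> b))" for b :: 'a and y
  have e: "complex_of_real (exp (- s * (norm x)\<^sup>2)) * cis (x \<bullet> v) = (\<Prod>b\<in>Basis. f b (x \<bullet> b))" for x :: 'a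
    unfolding f_def prod.distrib norm_sq_Basis euclidean_inner[of x v] cis_conv_exp
    by (simp add: sum_distrib_left exp_sum flip: sum_negf)
  have i: "integrable lborel (f b)" for b
    unfolding f_def by (rule gauss_real(1)[OF s])
  show "integrable lborel (\<lambda>x::'a. complex_of_real (exp (- s * (norm x)\<^sup>2)) * cis (x \<bullet> v))"
    unfolding e by (rule integrable_lborel_prod) (rule i)
  have "(LINT x::'a|lborel. complex_of_real (exp (- s * (norm x)\<^sup>2)) * cis (x \<bullet> v))
      = (\<Prod>b\<in>Basis. complex_of_real (sqrt (pi / s) * exp (- (v \<bullet> b)\<^sup>2 / (4 * s))))"
    unfolding e integral_lborel_prod[OF i]
    by (intro prod.cong refl) (unfold f_def, rule gauss_real(2)[OF s])
  also have "\<dots> = complex_of_real (sqrt (pi / s) ^ DIM('a) * exp (- (norm v)\<^sup>2 / (4 * s)))"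
    unfolding of_real_prod[symmetric] prod.distrib norm_sq_Basis
    by (simp add: sum_divide_distrib exp_sum flip: sum_negf)
  finally show "(LINT x::'a|lborel. complex_of_real (exp (- s * (norm x)\<^sup>2)) * cis (x \<bullet> v))
      = complex_of_real (sqrt (pi / s) ^ DIM('a) * exp (- (norm v)\<^sup>2 / (4 * s)))" .
qed

lemma
  assumes s: "0 < s"
  shows integrable_gauss: "integrable lborel (\<lambda>x::'a::euclidean_space. exp (- s * (norm x)\<^sup>2))"
    and integral_gauss: "(LINT x::'a::euclidean_space|lborel. exp (- s * (norm x)\<^sup>2)) = sqrt (pi / s) ^ DIM('a)"
proof -
  have i: "integrable lborel (\<lambda>x::'a. complex_of_real (exp (- s * (norm x)\<^sup>2)))"
    using integrable_gauss_cis[OF s, of "0::'a"] by simp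
  then show "integrable lborel (\<lambda>x::'a. exp (- s * (norm x)\<^sup>2))"
    using integrable_norm[OF i] by simp
  have "complex_of_real (LINT x::'a|lborel. exp (- s * (norm x)\<^sup>2)) = complex_of_real (sqrt (pi / s) ^ DIM('a))"
    using integral_gauss_cis[OF s, of "0::'a"] by (simp flip: integral_complex_of_real)
  then show "(LINT x::'a|lborel. exp (- s * (norm x)\<^sup>2)) = sqrt (pi / s) ^ DIM('a)"
    by (simp only: of_real_eq_iff)
qed

text \<open>Two integrable factors dominate the product once the kernel is bounded, so absolute
  integrability on the product space is automatic. Every interchange involving a phase factor or a
  transform of an integrable function has this shape.\<close>

lemma Fubini_bounded_kernel:
  fixes a :: "'a::euclidean_space \<Rightarrow> complex" and b :: "'b::euclidean_space \<Rightarrow> complex"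
  assumes a: "integrable lborel a" and b: "integrable lborel b"
    and k[measurable]: "case_prod k \<in> borel_measurable (borel \<Otimes>\<^sub>M borel)"
    and bd: "\<And>x y. cmod (k x y) \<le> C"
  shows "(LINT x|lborel. LINT y|lborel. a x * b y * k x y) = (LINT y|lborel. LINT x|lborel. a x * b y * k x y)"
proof -
  have [measurable]: "a \<in> borel_measurable borel" "b \<in> borel_measurable borel" using a b by auto
  have C: "0 \<le> C" using bd norm_ge_zero order_trans by blast
  have le: "cmod (a x * b y * k x y) \<le> C * cmod (a x) * cmod (b y)" for x y
  proof -
    have "cmod (a x * b y * k x y) = (cmod (a x) * cmod (b y)) * cmod (k x y)" by (simp add: norm_mult)
    also have "\<dots> \<le> (cmod (a x) * cmod (b y)) * C" by (intro mult_left_mono bd) auto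
    finally show ?thesis by (simp add: mult_ac)
  qed
  have i: "integrable lborel (\<lambda>y. a x * b y * k x y)" for x
    by (rule Bochner_Integration.integrable_bound[where f="\<lambda>y. C * cmod (a x) * cmod (b y)"])
       (use b le C in auto)
  have "integrable (lborel \<Otimes>\<^sub>M lborel) (\<lambda>(x, y). a x * b y * k x y)"
  proof (rule lborel_pair.Fubini_integrable)
    show "integrable lborel (\<lambda>x. LINT y|lborel. norm (case (x, y) of (x, y) \<Rightarrow> a x * b y * k x y))"
    proof (rule Bochner_Integration.integrable_bound)
      show "integrable lborel (\<lambda>x. C * cmod (a x) * (LINT y|lborel. cmod (b y)))" using a by auto
      show "AE x in lborel. norm (LINT y|lborel. norm (case (x, y) of (x, y) \<Rightarrow> a x * b y * k x y))
         \<le> norm (C * cmod (a x) * (LINT y|lborel. cmod (b y)))"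
      proof (rule AE_I2)
        fix x
        have "(LINT y|lborel. cmod (a x * b y * k x y)) \<le> (LINT y|lborel. C * cmod (a x) * cmod (b y))"
          by (intro integral_mono integrable_norm i le integrable_mult_right b)
        moreover have "0 \<le> (LINT y|lborel. cmod (a x * b y * k x y))"
          by (intro integral_nonneg_AE) auto
        ultimately show "norm (LINT y|lborel. norm (case (x, y) of (x, y) \<Rightarrow> a x * b y * k x y))
         \<le> norm (C * cmod (a x) * (LINT y|lborel. cmod (b y)))" by simp
      qed
    qed auto
  qed (use i in auto)
  from lborel_pair.Fubini_integral[OF this] show ?thesis by simp
qed

section \<open>Fourier integrals of integrable functions\<close>

lemma ft1_measurable [measurable]:
  fixes f :: "'a::euclidean_space \<Rightarrow> complex"
  assumes [measurable]: "f \<in> borel_measurable borel"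
  shows "ft1 f \<in> borel_measurable borel"
  unfolding ft1_def by measurable

lemma ft1_bound: "cmod (ft1 f \<xi>) \<le> (LINT x|lborel. cmod (f x))"
proof -
  have "cmod (ft1 f \<xi>) \<le> (LINT x|lborel. cmod (cis (- (x \<bullet> \<xi>)) * f x))"
    unfolding ft1_def by (rule integral_norm_bound)
  then show ?thesis by (simp add: norm_mult)
qed

lemma cis_mult_integrable:
  assumes f: "integrable lborel f" and [measurable]: "g \<in> borel_measurable borel"
  shows "integrable lborel (\<lambda>x. cis (g x) * f x)"
proof -
  have [measurable]: "f \<in> borel_measurable borel" using f by auto
  show ?thesis
    by (rule Bochner_Integration.integrable_bound[OF f]) (auto simp: norm_mult)
qed

lemma ft1_add: "integrable lborel f \<Longrightarrow> integrable lborel g \<Longrightarrow> ft1 (\<lambda>x. f x + g x) \<xi> = ft1 f \<xi> + ft1 g \<xi>"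
  and ft1_diff: "integrable lborel f \<Longrightarrow> integrable lborel g \<Longrightarrow> ft1 (\<lambda>x. f x - g x) \<xi> = ft1 f \<xi> - ft1 g \<xi>"
  unfolding ft1_def by (simp_all add: distrib_left right_diff_distrib cis_mult_integrable)

lemma ft1_cmult: "ft1 (\<lambda>x. c * f x) \<xi> = c * ft1 f \<xi>"
  unfolding ft1_def by (simp add: mult.left_commute[of _ c])

lemma ft1_shift:
  assumes [measurable]: "f \<in> borel_measurable borel"
  shows "ft1 (\<lambda>x. f (x + h)) \<xi> = cis (h \<bullet> \<xi>) * ft1 f \<xi>"
proof -
  have "ft1 (\<lambda>x. f (x + h)) \<xi> = (LINT x|lborel. cis (h \<bullet> \<xi>) * (cis (- ((x + h) \<bullet> \<xi>)) * f (x + h)))"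
    unfolding ft1_def by (intro Bochner_Integration.integral_cong refl) 
      (simp add: inner_add_left cis_mult flip: mult.assoc)
  also have "\<dots> = cis (h \<bullet> \<xi>) * (LINT x|lborel. cis (- ((x + h) \<bullet> \<xi>)) * f (x + h))" by simp
  also have "(LINT x|lborel. cis (- ((x + h) \<bullet> \<xi>)) * f (x + h)) = ft1 f \<xi>"
    unfolding ft1_def by (rule integral_shift[of "\<lambda>x. cis (- (x \<bullet> \<xi>)) * f x"]) simp
  finally show ?thesis .
qed

text \<open>The integrable weight \<open>w\<close> makes the triple integral absolutely convergent,
  so the frequency integral can be taken first; it leaves the transform of \<open>w\<close> as a
  convolution kernel. A Gaussian weight leads to Plancherel, a Gaussian times the Schroedinger phase
  to the dispersive estimate.\<close>

lemma parseval_kernel: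
  fixes f g w :: "'a::euclidean_space \<Rightarrow> complex"
  assumes f: "integrable lborel f" and g: "integrable lborel g" and w: "integrable lborel w"
  shows "(LINT \<xi>|lborel. w \<xi> * ft1 f \<xi> * cnj (ft1 g \<xi>))
    = (LINT x|lborel. LINT y|lborel. f x * cnj (g y) * (LINT \<xi>|lborel. w \<xi> * cis (- ((x - y) \<bullet> \<xi>))))"
proof -
  have [measurable]: "f \<in> borel_measurable borel" "g \<in> borel_measurable borel" "w \<in> borel_measurable borel"
    using f g w by auto
  have "(LINT \<xi>|lborel. w \<xi> * ft1 f \<xi> * cnj (ft1 g \<xi>))
      = (LINT \<xi>|lborel. LINT x|lborel. w \<xi> * f x * (cis (- (x \<bullet> \<xi>)) * cnj (ft1 g \<xi>)))"
    unfolding ft1_def[of f] 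
    by (intro Bochner_Integration.integral_cong refl) (simp add: mult_ac flip: integral_mult_right_zero integral_mult_left_zero)
  also have "\<dots> = (LINT x|lborel. LINT \<xi>|lborel. w \<xi> * f x * (cis (- (x \<bullet> \<xi>)) * cnj (ft1 g \<xi>)))"
    by (rule Fubini_bounded_kernel[OF w f, where C="LINT x|lborel. cmod (g x)"])
       (auto simp: norm_mult ft1_bound)
  also have "\<dots> = (LINT x|lborel. LINT \<xi>|lborel. LINT y|lborel. w \<xi> * cnj (g y) * (f x * cis (- ((x - y) \<bullet> \<xi>))))"
  proof (intro Bochner_Integration.integral_cong refl)
    fix x \<xi>
    have "cnj (ft1 g \<xi>) = (LINT y|lborel. cnj (cis (- (y \<bullet> \<xi>)) * g y))"
      unfolding ft1_def by (rule Bochner_Integration.integral_cnj[symmetric])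
    then have "w \<xi> * f x * (cis (- (x \<bullet> \<xi>)) * cnj (ft1 g \<xi>)) =
      (LINT y|lborel. w \<xi> * f x * cis (- (x \<bullet> \<xi>)) * cnj (cis (- (y \<bullet> \<xi>)) * g y))" by simp
    also have "\<dots> = (LINT y|lborel. w \<xi> * cnj (g y) * (f x * cis (- ((x - y) \<bullet> \<xi>))))"
    proof (intro Bochner_Integration.integral_cong refl)
      fix y
      have "cis (- ((x - y) \<bullet> \<xi>)) = cis (- (x \<bullet> \<xi>)) * cnj (cis (- (y \<bullet> \<xi>)))"
        by (simp add: cis_cnj cis_mult inner_diff_left)
      then show "w \<xi> * f x * cis (- (x \<bullet> \<xi>)) * cnj (cis (- (y \<bullet> \<xi>)) * g y) = w \<xi> * cnj (g y) * (f x * cis (- ((x - y) \<bullet> \<xi>)))"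
        by (simp add: mult_ac)
    qed
    finally show "w \<xi> * f x * (cis (- (x \<bullet> \<xi>)) * cnj (ft1 g \<xi>)) =
      (LINT y|lborel. w \<xi> * cnj (g y) * (f x * cis (- ((x - y) \<bullet> \<xi>))))" .
  qed
  also have "\<dots> = (LINT x|lborel. LINT y|lborel. LINT \<xi>|lborel. w \<xi> * cnj (g y) * (f x * cis (- ((x - y) \<bullet> \<xi>))))"
    by (intro Bochner_Integration.integral_cong refl Fubini_bounded_kernel[OF w, where C="cmod (f _)"])
       (auto simp: norm_mult g)
  also have "\<dots> = (LINT x|lborel. LINT y|lborel. f x * cnj (g y) * (LINT \<xi>|lborel. w \<xi> * cis (- ((x - y) \<bullet> \<xi>))))"
    by (intro Bochner_Integration.integral_cong refl) (simp add: mult_ac flip: integral_mult_right_zero)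
  finally show ?thesis .
qed

text \<open>Complex Gaussians and their branches of the square root are avoided by squaring: |J|^2
  is the double integral of g(p + y) times the conjugate of g(y). In this product the quadratic
  phases leave a phase linear in y, so the inner integral is a real Gaussian transform, and the
  outer one is bounded by its absolute value.\<close>

lemma schroedinger_kernel_bound:
  fixes v :: "'a::euclidean_space"
  assumes \<epsilon>: "0 < \<epsilon>" and u: "0 < u"
  shows "cmod (LINT \<xi>::'a|lborel. complex_of_real (exp (- \<epsilon> * (norm \<xi>)\<^sup>2)) * cis (u * (norm \<xi>)\<^sup>2) * cis (\<xi> \<bullet> v))
    \<le> sqrt (pi / u) ^ DIM('a)"
proof -
  define g where "g \<xi> = complex_of_real (exp (- \<epsilon> * (norm \<xi>)\<^sup>2)) * cis (u * (norm \<xi>)\<^sup>2) * cis (\<xi> \<bullet> v)" for \<xi> :: 'a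
  define J where "J = (LINT \<xi>|lborel. g \<xi>)"
  have [measurable]: "g \<in> borel_measurable borel" unfolding g_def by measurable
  have ng: "cmod (g \<xi>) = exp (- \<epsilon> * (norm \<xi>)\<^sup>2)" for \<xi> by (simp add: g_def norm_mult)
  have ig: "integrable lborel g"
    by (rule Bochner_Integration.integrable_bound[OF integrable_gauss[OF \<epsilon>]]) (auto simp: ng)
  define c where "c = sqrt (pi / (2 * \<epsilon>)) ^ DIM('a)"
  \<comment> \<open>The decay rate in p: \<epsilon>/2 comes from the moduli of the two factors and
    u^2/(2 \<epsilon>) from the Gaussian transform at frequency 2 u p.\<close>
  define s where "s = (\<epsilon>\<^sup>2 + u\<^sup>2) / (2 * \<epsilon>)"
  have s: "s > 0" using \<epsilon> u by (auto simp: s_def intro!: divide_pos_pos add_pos_pos)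
  \<comment> \<open>Shifting y by -p/2 places the two arguments symmetrically at y + p/2 and y -
    p/2. The mixed terms then cancel in the modulus and survive only in the phase, as 2 u (y .
    p).\<close>
  have g2: "g (p + y + (- (1/2) *\<^sub>R p)) * cnj (g (y + (- (1/2) *\<^sub>R p))) =
     (complex_of_real (exp (- (\<epsilon> / 2) * (norm p)\<^sup>2)) * cis (p \<bullet> v)) *
     (complex_of_real (exp (- (2 * \<epsilon>) * (norm y)\<^sup>2)) * cis (y \<bullet> ((2 * u) *\<^sub>R p)))" for p y
  proof -
    have a: "p + y + (- (1/2) *\<^sub>R p) = y + (1/2) *\<^sub>R p" by (simp add: algebra_simps flip: scaleR_add_left)
    have n1: "(norm (y + (1/2) *\<^sub>R p))\<^sup>2 = (norm y)\<^sup>2 + (y \<bullet> p) + (norm p)\<^sup>2 / 4"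
      unfolding power2_norm_eq_inner by (simp add: inner_simps inner_commute)
    have n2: "(norm (y + (- (1/2) *\<^sub>R p)))\<^sup>2 = (norm y)\<^sup>2 - (y \<bullet> p) + (norm p)\<^sup>2 / 4"
      unfolding power2_norm_eq_inner by (simp add: inner_simps inner_commute)
    have "g (y + (1/2) *\<^sub>R p) * cnj (g (y + (- (1/2) *\<^sub>R p)))
      = complex_of_real (exp (- \<epsilon> * (norm (y + (1/2) *\<^sub>R p))\<^sup>2) * exp (- \<epsilon> * (norm (y + (- (1/2) *\<^sub>R p)))\<^sup>2))
       * (cis (u * (norm (y + (1/2) *\<^sub>R p))\<^sup>2) * cis (- (u * (norm (y + (- (1/2) *\<^sub>R p)))\<^sup>2))
       * (cis ((y + (1/2) *\<^sub>R p) \<bullet> v) * cis (- ((y + (- (1/2) *\<^sub>R p)) \<bullet> v))))"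
      unfolding g_def by (simp add: cis_cnj mult_ac)
    also have "\<dots> = complex_of_real (exp (- (\<epsilon> / 2) * (norm p)\<^sup>2 + (- (2 * \<epsilon>) * (norm y)\<^sup>2)))
       * (cis (y \<bullet> ((2 * u) *\<^sub>R p)) * cis (p \<bullet> v))"
      unfolding n1 n2 cis_mult exp_add[symmetric]
      by (intro arg_cong2[where f="(*)"] arg_cong[where f=cis] arg_cong[where f=complex_of_real] arg_cong[where f=exp])
         (simp_all add: algebra_simps inner_simps)
    finally show ?thesis unfolding a exp_add by (simp add: mult_ac)
  qed
  have inner: "(LINT y|lborel. g (p + y) * cnj (g y)) = complex_of_real (c * exp (- s * (norm p)\<^sup>2)) * cis (p \<bullet> v)" for p
  proof -
    have "(LINT y|lborel. g (p + y) * cnj (g y)) = (LINT y|lborel. g (p + (y + (- (1/2) *\<^sub>R p))) * cnj (g (y + (- (1/2) *\<^sub>R p))))"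
      by (rule integral_shift[symmetric]) simp
    also have "\<dots> = (complex_of_real (exp (- (\<epsilon> / 2) * (norm p)\<^sup>2)) * cis (p \<bullet> v)) *
      (LINT y|lborel. complex_of_real (exp (- (2 * \<epsilon>) * (norm y)\<^sup>2)) * cis (y \<bullet> ((2 * u) *\<^sub>R p)))"
      unfolding add.assoc[symmetric] g2 by (rule integral_mult_right_zero)
    also have "(LINT y|lborel. complex_of_real (exp (- (2 * \<epsilon>) * (norm y)\<^sup>2)) * cis (y \<bullet> ((2 * u) *\<^sub>R p)))
       = complex_of_real (c * exp (- (norm ((2 * u) *\<^sub>R p))\<^sup>2 / (4 * (2 * \<epsilon>))))"
      unfolding c_def by (rule integral_gauss_cis) (use \<epsilon> in simp)
    also have "(complex_of_real (exp (- (\<epsilon> / 2) * (norm p)\<^sup>2)) * cis (p \<bullet> v)) * \<dots>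
      = complex_of_real (c * (exp (- (\<epsilon> / 2) * (norm p)\<^sup>2) * exp (- (norm ((2 * u) *\<^sub>R p))\<^sup>2 / (4 * (2 * \<epsilon>))))) * cis (p \<bullet> v)"
      by (simp add: mult_ac)
    also have "exp (- (\<epsilon> / 2) * (norm p)\<^sup>2) * exp (- (norm ((2 * u) *\<^sub>R p))\<^sup>2 / (4 * (2 * \<epsilon>))) = exp (- s * (norm p)\<^sup>2)"
      unfolding exp_add[symmetric] s_def using \<epsilon> u by (simp add: power_mult_distrib field_simps power2_eq_square)
    finally show ?thesis .
  qed
  have "complex_of_real ((cmod J)\<^sup>2) = cnj J * J" by (metis complex_norm_square mult.commute)
  also have "\<dots> = (LINT y|lborel. cnj (g y) * (LINT p|lborel. g (p + y)))"
    unfolding J_def integral_shift[OF \<open>g \<in> _\<close>]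
    by (simp flip: Bochner_Integration.integral_cnj)
  also have "\<dots> = (LINT y|lborel. LINT p|lborel. g (p + y) * cnj (g y))"
    by (simp add: mult.commute flip: integral_mult_right_zero)
  also have "\<dots> = (LINT p|lborel. LINT y|lborel. g (p + y) * cnj (g y))"
  proof (rule lborel_pair.Fubini_integral[symmetric])
    show "integrable (lborel \<Otimes>\<^sub>M lborel) (\<lambda>(y, p). g (p + y) * cnj (g y))"
    proof (rule lborel_pair.Fubini_integrable)
      have "(LINT p|lborel. cmod (g (p + y))) = (LINT p|lborel. cmod (g p))" for y
        by (rule integral_shift[of "\<lambda>x. cmod (g x)"]) simp
      then show "integrable lborel (\<lambda>x. LINT y|lborel. norm (case (x, y) of (y, p) \<Rightarrow> g (p + y) * cnj (g y)))"
        using ig by (simp add: norm_mult)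
      show "AE x in lborel. integrable lborel (\<lambda>y. case (x, y) of (y, p) \<Rightarrow> g (p + y) * cnj (g y))"
        using ig by (simp add: integrable_shift)
    qed simp
  qed
  also have "\<dots> = (LINT p|lborel. complex_of_real (c * exp (- s * (norm p)\<^sup>2)) * cis (p \<bullet> v))"
    unfolding inner ..
  finally have "complex_of_real ((cmod J)\<^sup>2) = \<dots>" .
  then have "(cmod J)\<^sup>2 = cmod (LINT p|lborel. complex_of_real (c * exp (- s * (norm p)\<^sup>2)) * cis (p \<bullet> v))"
    by (metis abs_of_nonneg norm_of_real zero_le_power2)
  also have "\<dots> \<le> (LINT p|lborel. cmod (complex_of_real (c * exp (- s * (norm p)\<^sup>2)) * cis (p \<bullet> v)))"
    by (rule integral_norm_bound)
  also have "\<dots> = c * (LINT p::'a|lborel. exp (- s * (norm p)\<^sup>2))"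
    using \<epsilon> by (simp add: norm_mult c_def del: of_real_mult)
  also have "\<dots> = (sqrt (pi / (2 * \<epsilon>)) * sqrt (pi / s)) ^ DIM('a)"
    unfolding integral_gauss[OF s] c_def by (simp add: power_mult_distrib)
  \<comment> \<open>The two constants combine to pi^2 / (\<epsilon>^2 + u^2) under the root;
    dropping \<epsilon>^2 makes the bound uniform in the regularisation.\<close>
  also have "\<dots> \<le> (pi / u) ^ DIM('a)"
  proof (rule power_mono)
    have "sqrt (pi / (2 * \<epsilon>)) * sqrt (pi / s) = sqrt (pi\<^sup>2 / (\<epsilon>\<^sup>2 + u\<^sup>2))"
      unfolding real_sqrt_mult[symmetric] s_def using \<epsilon> by (simp add: power2_eq_square)
    also have "\<dots> \<le> sqrt (pi\<^sup>2 / u\<^sup>2)" using u \<epsilon>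
      by (intro real_sqrt_le_mono divide_left_mono) (auto intro!: mult_pos_pos add_pos_pos)
    also have "\<dots> = pi / u" using u by (simp add: real_sqrt_divide)
    finally show "sqrt (pi / (2 * \<epsilon>)) * sqrt (pi / s) \<le> pi / u" .
  qed (use \<epsilon> s in auto)
  also have "\<dots> = (sqrt (pi / u) ^ DIM('a))\<^sup>2"
    using u by (simp flip: power_mult_distrib power_mult add: power2_eq_square mult.commute)
  finally have "(cmod J)\<^sup>2 \<le> (sqrt (pi / u) ^ DIM('a))\<^sup>2" .
  then show ?thesis unfolding J_def g_def using u by (intro power2_le_imp_le[of "cmod _"]) auto
qed

text \<open>The L^1 to L^infinity estimate with decay u^(-n/2), tested against an integrable
  \<open>g\<close>. No pointwise representation of the evolved state occurs, and the bound does not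
  see \<epsilon>.\<close>

lemma dispersive_pairing:
  fixes f g :: "'a::euclidean_space \<Rightarrow> complex"
  assumes f: "integrable lborel f" and g: "integrable lborel g" and \<epsilon>: "0 < \<epsilon>" and u: "0 < u"
  shows "cmod (LINT \<xi>|lborel. complex_of_real (exp (- \<epsilon> * (norm \<xi>)\<^sup>2)) * cis (u * (norm \<xi>)\<^sup>2) * ft1 f \<xi> * cnj (ft1 g \<xi>))
    \<le> sqrt (pi / u) ^ DIM('a) * (LINT x|lborel. cmod (f x)) * (LINT x|lborel. cmod (g x))"
proof -
  let ?w = "\<lambda>\<xi>::'a. complex_of_real (exp (- \<epsilon> * (norm \<xi>)\<^sup>2)) * cis (u * (norm \<xi>)\<^sup>2)"
  have [measurable]: "f \<in> borel_measurable borel" "g \<in> borel_measurable borel" using f g by auto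
  let ?K = "\<lambda>v. LINT \<xi>|lborel. ?w \<xi> * cis (- (v \<bullet> \<xi>))"
  let ?C = "sqrt (pi / u) ^ DIM('a)"
  have w: "integrable lborel ?w"
    by (rule Bochner_Integration.integrable_bound[OF integrable_gauss[OF \<epsilon>]]) (auto simp: norm_mult)
  have K: "cmod (?K v) \<le> ?C" for v
    using schroedinger_kernel_bound[OF \<epsilon> u, of "- v"] by (simp add: inner_commute)
  have C: "0 \<le> ?C" using u by simp
  have b: "cmod (LINT y|lborel. f x * cnj (g y) * ?K (x - y)) \<le> cmod (f x) * (?C * (LINT y|lborel. cmod (g y)))" for x
  proof -
    have "cmod (LINT y|lborel. f x * cnj (g y) * ?K (x - y)) \<le> (LINT y|lborel. cmod (f x) * (?C * cmod (g y)))"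
    proof (rule order_trans[OF integral_norm_bound], rule integral_mono)
      have le: "cmod (f x * cnj (g y) * ?K (x - y)) \<le> cmod (f x) * (?C * cmod (g y))" for y
        using mult_left_mono[OF K[of "x - y"], of "cmod (f x) * cmod (g y)"] by (simp add: norm_mult mult_ac)
      then show "norm (f x * cnj (g y) * ?K (x - y)) \<le> cmod (f x) * (?C * cmod (g y))" for y .
      show "integrable lborel (\<lambda>y. cmod (f x) * (?C * cmod (g y)))" using g by auto
      then show "integrable lborel (\<lambda>y. norm (f x * cnj (g y) * ?K (x - y)))"
        by (rule Bochner_Integration.integrable_bound) (use le C in auto)
    qed
    then show ?thesis by simp
  qed
  have "cmod (LINT \<xi>|lborel. ?w \<xi> * ft1 f \<xi> * cnj (ft1 g \<xi>))
     = cmod (LINT x|lborel. LINT y|lborel. f x * cnj (g y) * ?K (x - y))"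
    unfolding parseval_kernel[OF f g w] ..
  also have "\<dots> \<le> (LINT x|lborel. cmod (f x) * (?C * (LINT y|lborel. cmod (g y))))"
  proof (rule order_trans[OF integral_norm_bound], rule integral_mono)
    show "integrable lborel (\<lambda>x. cmod (f x) * (?C * (LINT y|lborel. cmod (g y))))" using f by auto
    then show "integrable lborel (\<lambda>x. cmod (LINT y|lborel. f x * cnj (g y) * ?K (x - y)))"
    proof (rule Bochner_Integration.integrable_bound)
      show "AE x in lborel. norm (cmod (LINT y|lborel. f x * cnj (g y) * ?K (x - y))) 
         \<le> norm (cmod (f x) * (?C * (LINT y|lborel. cmod (g y))))"
        using b C by (intro AE_I2) (smt (verit) norm_ge_zero real_norm_def)
    qed measurable
  qed (rule b)
  finally show ?thesis by (simp add: mult_ac)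
qed

section \<open>Truncation to balls, approximation in L^2 and continuity of translations\<close>

definition trunc :: "real \<Rightarrow> ('a::euclidean_space \<Rightarrow> complex) \<Rightarrow> 'a \<Rightarrow> complex" where
  "trunc R f x = (if x \<in> ball 0 R then f x else 0)"

lemma trunc_eq: "trunc R f x = indicator (ball 0 R) x * f x"
  by (simp add: trunc_def)

lemma l2_trunc: "l2 f \<Longrightarrow> l2 (trunc R f)"
  unfolding trunc_eq[abs_def] by (intro l2_bounded_mult1) (auto simp: indicator_def)

lemma trunc_measurable [measurable]: "f \<in> borel_measurable borel \<Longrightarrow> trunc R f \<in> borel_measurable borel"
  unfolding trunc_eq[abs_def] by (intro borel_measurable_times borel_measurable_indicator) auto

lemma l2_indicator:
  fixes A :: "'a::euclidean_space set"
  assumes "A \<in> sets borel" "emeasure lborel A < \<infinity>"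
  shows "l2 (indicator A :: 'a \<Rightarrow> complex)" "sqn (indicator A :: 'a \<Rightarrow> complex) = measure lborel A"
proof -
  have "(\<lambda>x. (cmod (indicator A x))\<^sup>2) = (indicator A :: 'a \<Rightarrow> real)"
    by (auto simp: indicator_def)
  then show "l2 (indicator A :: 'a \<Rightarrow> complex)" "sqn (indicator A :: 'a \<Rightarrow> complex) = measure lborel A"
    using assms by (auto simp: l2_def sqn_def)
qed

lemma integrable_trunc:
  assumes "l2 f" shows "integrable lborel (trunc R f)"
  unfolding trunc_eq[abs_def]
  by (intro l2_mult_integrable l2_indicator assms) (auto intro: emeasure_lborel_ball_finite[unfolded infinity_ennreal_def])

lemma sqn_tendsto_0_dominated:
  fixes f :: "nat \<Rightarrow> 'a::euclidean_space \<Rightarrow> complex"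
  assumes m: "\<And>n. f n \<in> borel_measurable borel" and w: "integrable lborel w"
    and le: "\<And>n x. (cmod (f n x))\<^sup>2 \<le> w x" and lim: "AE x in lborel. (\<lambda>n. f n x) \<longlonglongrightarrow> 0"
  shows "(\<lambda>n. sqn (f n)) \<longlonglongrightarrow> 0"
proof -
  note [measurable] = m
  have "(\<lambda>n. LINT x|lborel. (cmod (f n x))\<^sup>2) \<longlonglongrightarrow> (LINT x::'a|lborel. (0::real))"
  proof (rule integral_dominated_convergence[OF _ _ w])
    show "AE x in lborel. (\<lambda>n. (cmod (f n x))\<^sup>2) \<longlonglongrightarrow> 0"
      using lim by eventually_elim (auto intro!: tendsto_eq_intros)
  qed (use w le in auto)
  then show ?thesis by (simp add: sqn_def)
qed

lemma sqn_tail_seq: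
  assumes f: "l2 f" and A[measurable]: "\<And>n::nat. A n \<in> sets borel"
    and ev: "\<And>x. eventually (\<lambda>n. x \<notin> A n) sequentially"
  shows "(\<lambda>n. sqn (\<lambda>x. indicator (A n) x * f x)) \<longlonglongrightarrow> 0"
proof (rule sqn_tendsto_0_dominated[where w="\<lambda>x. (cmod (f x))\<^sup>2"])
  note [measurable] = l2_measurable[OF f]
  show "(\<lambda>x. indicator (A n) x * f x) \<in> borel_measurable borel" for n by measurable
  show "integrable lborel (\<lambda>x. (cmod (f x))\<^sup>2)" by (rule l2_integrable[OF f])
  show "(cmod (indicator (A n) x * f x))\<^sup>2 \<le> (cmod (f x))\<^sup>2" for n x by (simp add: indicator_def)
  show "AE x in lborel. (\<lambda>n. indicator (A n) x * f x) \<longlonglongrightarrow> 0"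
  proof (rule AE_I2)
    fix x
    have "eventually (\<lambda>n. indicator (A n) x * f x = 0) sequentially"
      using ev[of x] by eventually_elim (simp add: indicator_def)
    then show "(\<lambda>n. indicator (A n) x * f x) \<longlonglongrightarrow> 0" by (rule tendsto_eventually)
  qed
qed

lemma integrable_indicator_cball: "integrable lborel (\<lambda>x::'a::euclidean_space. c * indicator (cball 0 r) x :: real)"
  using emeasure_bounded_finite[OF bounded_cball[of "0::'a" r]]
  by (intro integrable_mult_right integrable_real_indicator) (auto simp: less_top)

lemma l2_approx_bounded_support:
  fixes f :: "'a::euclidean_space \<Rightarrow> complex"
  assumes f: "l2 f" and e: "0 < e"
  obtains m :: real and h where "l2 h" "sqn (\<lambda>x. f x - h x) < e" "m > 0" "\<And>x. cmod (h x) \<le> m" "\<And>x. norm x > m \<Longrightarrow> h x = 0"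
proof -
  note [measurable] = l2_measurable[OF f]
  define A where "A n = {x. \<not> (norm x \<le> real n \<and> cmod (f x) \<le> real n)}" for n
  have A: "A n \<in> sets borel" for n unfolding A_def by measurable
  have "(\<lambda>n. sqn (\<lambda>x. indicator (A n) x * f x)) \<longlonglongrightarrow> 0"
  proof (rule sqn_tail_seq[OF f A])
    fix x
    have "eventually (\<lambda>n. real n \<ge> max (norm x) (cmod (f x))) sequentially"
      using eventually_ge_at_top[of "nat \<lceil>max (norm x) (cmod (f x))\<rceil>"]
      by eventually_elim linarith
    then show "eventually (\<lambda>n. x \<notin> A n) sequentially" by eventually_elim (auto simp: A_def)
  qed
  then have "eventually (\<lambda>n. sqn (\<lambda>x. indicator (A n) x * f x) < e) sequentially"
    using e by (auto simp: order_tendsto_iff)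
  with eventually_gt_at_top[of 0] have "eventually (\<lambda>n. n > 0 \<and> sqn (\<lambda>x. indicator (A n) x * f x) < e) sequentially"
    by eventually_elim auto
  then obtain n where n: "n > 0" "sqn (\<lambda>x. indicator (A n) x * f x) < e"
    by (auto simp: eventually_sequentially)
  define h where "h x = indicator (- A n) x * f x" for x
  have "l2 h" unfolding h_def using A by (intro l2_bounded_mult1 f) (auto simp: indicator_def)
  moreover have "(\<lambda>x. f x - h x) = (\<lambda>x. indicator (A n) x * f x)" by (auto simp: h_def indicator_def)
  ultimately show ?thesis
    using n by (intro that[of h "real n"]) (auto simp: h_def A_def indicator_def)
qed

lemma l2_approx_continuous:
  fixes f :: "'a::euclidean_space \<Rightarrow> complex"
  assumes f: "l2 f" and e: "0 < e"
  obtains m :: real and g where "l2 g" "sqn (\<lambda>x. f x - g x) < e" "continuous_on UNIV g"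
     "\<And>x. cmod (g x) \<le> m" "\<And>x. norm x > m \<Longrightarrow> g x = 0"
proof -
  have e4: "0 < e / 4" using e by simp
  obtain m :: real and h where h: "l2 h" "sqn (\<lambda>x. f x - h x) < e / 4" "m > 0"
    "\<And>x. cmod (h x) \<le> m" "\<And>x. norm x > m \<Longrightarrow> h x = 0"
    by (rule l2_approx_bounded_support[OF f e4]) blast
  note [measurable] = l2_measurable[OF h(1)]
  have "h measurable_on UNIV"
    by (intro lebesgue_measurable_imp_measurable_on) (auto intro: measurable_completion)
  then obtain N g where N: "negligible N" and g: "\<And>n. continuous_on UNIV (g n)"
    and gl: "\<And>x. x \<notin> N \<Longrightarrow> (\<lambda>n. g n x) \<longlonglongrightarrow> h x"
    unfolding measurable_on_def by auto
  \<comment> \<open>The continuous functions supplied by \<open>measurable_on\<close> converge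
    almost everywhere but have no common bound or support. Clipping the modulus at m and multiplying
    by a tent equal to 1 on the ball of radius m provides both, and the limit is unchanged because h
    already satisfies them.\<close>
  define k where "k n x = complex_of_real (max 0 (min 1 (m + 1 - norm x))) * (g n x / complex_of_real (max 1 (cmod (g n x) / m)))" for n :: nat and x :: 'a
  have kc: "continuous_on UNIV (k n)" for n
  proof -
    have "max 1 t \<noteq> (0::real)" for t by simp
    then show ?thesis unfolding k_def using h(3)
      by (intro continuous_intros g) (simp_all only: of_real_eq_0_iff simp_thms order_less_irrefl, auto)
  qed
  then have [measurable]: "k n \<in> borel_measurable borel" for n
    by (intro borel_measurable_continuous_onI)
  have k1: "cmod (g n x / complex_of_real (max 1 (cmod (g n x) / m))) \<le> m" for n x
    using h(3) by (auto simp: norm_divide max_def field_simps)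
  have kb: "cmod (k n x) \<le> m" for n x
  proof -
    have "cmod (k n x) \<le> 1 * m"
      unfolding k_def norm_mult by (intro mult_mono k1) (use h(3) in auto)
    then show ?thesis by simp
  qed
  have ks: "k n x = 0" if "norm x > m + 1" for n x
    using that by (simp add: k_def)
  have AEN: "AE x in lborel. x \<notin> N"
  proof -
    have "N \<in> null_sets lebesgue" using N by (simp add: negligible_iff_null_sets)
    then have "AE x in lebesgue. x \<notin> N" by (rule AE_not_in)
    then show ?thesis by (simp only: AE_completion_iff)
  qed
  have "(\<lambda>n. sqn (\<lambda>x. h x - k n x)) \<longlonglongrightarrow> 0"
  proof (rule sqn_tendsto_0_dominated[where w="\<lambda>x. (2 * m)\<^sup>2 * indicator (cball 0 (m + 1)) x"])
    show "integrable lborel (\<lambda>x::'a. (2 * m)\<^sup>2 * indicator (cball 0 (m + 1)) x)"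
      by (rule integrable_indicator_cball)
    fix n x
    have "cmod (h x - k n x) \<le> 2 * m" using norm_triangle_ineq4[of "h x" "k n x"] h(4)[of x] kb[of n x] by linarith
    then have "(cmod (h x - k n x))\<^sup>2 \<le> (2 * m)\<^sup>2" by (intro power_mono) auto
    moreover have "h x - k n x = 0" if "norm x > m + 1" using h(5)[of x] ks[OF that] that by simp
    ultimately show "(cmod (h x - k n x))\<^sup>2 \<le> (2 * m)\<^sup>2 * indicator (cball 0 (m + 1)) x"
      by (auto simp: indicator_def not_le)
  next
    show "AE x in lborel. (\<lambda>n. h x - k n x) \<longlonglongrightarrow> 0"
      using AEN
    proof eventually_elim
      fix x assume "x \<notin> N"
      from gl[OF this] have "(\<lambda>n. h x - k n x) \<longlonglongrightarrow> h x - complex_of_real (max 0 (min 1 (m + 1 - norm x))) * (h x / complex_of_real (max 1 (cmod (h x) / m)))"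
        unfolding k_def using h(3) by (intro tendsto_intros) auto
      also have "h x - complex_of_real (max 0 (min 1 (m + 1 - norm x))) * (h x / complex_of_real (max 1 (cmod (h x) / m))) = 0"
      proof (cases "norm x \<le> m")
        case True
        then show ?thesis using h(3) h(4)[of x] by (simp add: max_def min_def field_simps)
      qed (use h(5) in auto)
      finally show "(\<lambda>n. h x - k n x) \<longlonglongrightarrow> 0" .
    qed
  qed measurable
  then have "eventually (\<lambda>n. sqn (\<lambda>x. h x - k n x) < e / 4) sequentially"
    by (rule order_tendstoD) (use e in simp)
  then obtain n where n: "sqn (\<lambda>x. h x - k n x) < e / 4" by (auto simp: eventually_sequentially)
  have kl: "l2 (k n)"
  proof -
    have "integrable lborel (\<lambda>x. (cmod (k n x))\<^sup>2)"
    proof (rule Bochner_Integration.integrable_bound)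
      show "integrable lborel (\<lambda>x::'a. m\<^sup>2 * indicator (cball 0 (m + 1)) x)"
      by (rule integrable_indicator_cball)
      show "AE x in lborel. norm ((cmod (k n x))\<^sup>2) \<le> norm (m\<^sup>2 * indicator (cball 0 (m + 1)) x)"
        using kb[of n] ks[of _ n] by (intro AE_I2) (auto simp: indicator_def not_le intro!: power_mono)
    qed measurable
    then show ?thesis by (simp add: l2_def)
  qed
  have "sqn (\<lambda>x. f x - k n x) < e"
    using sqn_triangle[OF f h(1) kl] n h(2) by linarith
  then show ?thesis
    using order_trans[OF kb[of n], of "m + 1"] ks[of _ n] kc[of n] kl by (intro that[of "k n" "m + 1"]) auto
qed

lemma l2_translation_continuous:
  fixes f :: "'a::euclidean_space \<Rightarrow> complex"
  assumes f: "l2 f" and z: "z \<longlonglongrightarrow> 0"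
  shows "(\<lambda>n. sqn (\<lambda>x. f (x + z n) - f x)) \<longlonglongrightarrow> 0"
proof (rule LIMSEQ_I)
  fix r :: real assume r: "0 < r"
  \<comment> \<open>Two uses of \<open>sqn_triangle\<close> weight the three errors by 2, 4 and 4,
    so errors below r/12 add up to less than r.\<close>
  have r12: "0 < r / 12" using r by simp
  obtain m :: real and g where g: "l2 g" "sqn (\<lambda>x. f x - g x) < r / 12" and gc: "continuous_on UNIV g"
     and gb: "\<And>x. cmod (g x) \<le> m" and gs: "\<And>x. norm x > m \<Longrightarrow> g x = 0"
    by (rule l2_approx_continuous[OF f r12]) blast
  note [measurable] = l2_measurable[OF f] l2_measurable[OF g(1)]
  have "bounded (range z)" using z by (rule convergent_imp_bounded)
  then obtain B where B: "\<And>n. norm (z n) \<le> B" by (auto simp: bounded_iff)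
  have "(\<lambda>n. sqn (\<lambda>x. g (x + z n) - g x)) \<longlonglongrightarrow> 0"
  proof (rule sqn_tendsto_0_dominated[where w="\<lambda>x. (2 * m)\<^sup>2 * indicator (cball 0 (m + B)) x"])
    show "integrable lborel (\<lambda>x::'a. (2 * m)\<^sup>2 * indicator (cball 0 (m + B)) x)"
      by (rule integrable_indicator_cball)
    fix n x
    have "cmod (g (x + z n) - g x) \<le> 2 * m"
      using norm_triangle_ineq4[of "g (x + z n)" "g x"] gb[of "x + z n"] gb[of x] by linarith
    then have "(cmod (g (x + z n) - g x))\<^sup>2 \<le> (2 * m)\<^sup>2" by (intro power_mono) auto
    moreover have "g (x + z n) - g x = 0" if "norm x > m + B"
    proof -
      have "norm x \<le> norm (x + z n) + norm (z n)" using norm_triangle_ineq4[of "x + z n" "z n"] by simp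
      then have "norm (x + z n) > m" using that B[of n] by linarith
      moreover have "norm x > m" using that B[of n] norm_ge_zero[of "z n"] by linarith
      ultimately show ?thesis by (simp add: gs)
    qed
    ultimately show "(cmod (g (x + z n) - g x))\<^sup>2 \<le> (2 * m)\<^sup>2 * indicator (cball 0 (m + B)) x"
      by (auto simp: indicator_def not_le)
  next
    show "AE x in lborel. (\<lambda>n. g (x + z n) - g x) \<longlonglongrightarrow> 0"
    proof (rule AE_I2)
      fix x
      have "(\<lambda>n. x + z n) \<longlonglongrightarrow> x" using tendsto_add[OF tendsto_const z, of x] by simp
      moreover have "isCont g x" using gc by (simp add: continuous_on_eq_continuous_at)
      ultimately have "(\<lambda>n. g (x + z n)) \<longlonglongrightarrow> g x" by (rule isCont_tendsto_compose[rotated])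
      then show "(\<lambda>n. g (x + z n) - g x) \<longlonglongrightarrow> 0" by (simp add: LIM_zero_iff)
    qed
  qed measurable
  then obtain n0 where n0: "\<And>n. n \<ge> n0 \<Longrightarrow> sqn (\<lambda>x. g (x + z n) - g x) < r / 12"
    using LIMSEQ_D[of _ 0 "r / 12"] r by fastforce
  have "norm (sqn (\<lambda>x. f (x + z n) - f x) - 0) < r" if "n \<ge> n0" for n
  proof -
    have a: "sqn (\<lambda>x. f (x + z n) - g (x + z n)) = sqn (\<lambda>x. f x - g x)"
      by (rule sqn_shift) measurable
    have "sqn (\<lambda>x. f (x + z n) - f x) \<le> 2 * sqn (\<lambda>x. f (x + z n) - g (x + z n)) + 2 * sqn (\<lambda>x. g (x + z n) - f x)"
      by (rule sqn_triangle[OF l2_shift[OF f] l2_shift[OF g(1)] f])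
    also have "sqn (\<lambda>x. g (x + z n) - f x) \<le> 2 * sqn (\<lambda>x. g (x + z n) - g x) + 2 * sqn (\<lambda>x. g x - f x)"
      by (rule sqn_triangle[OF l2_shift[OF g(1)] g(1) f])
    finally show ?thesis
      using a n0[OF that] g(2) r sqn_minus_commute[of g f] by simp
  qed
  then show "\<exists>no. \<forall>n\<ge>no. norm (sqn (\<lambda>x. f (x + z n) - f x) - 0) < r" by blast
qed

section \<open>Plancherel for integrable L^2 functions, by Gaussian regularisation\<close>

lemma integral_lborel_scale:
  fixes f :: "'a::euclidean_space \<Rightarrow> complex"
  assumes [measurable]: "f \<in> borel_measurable borel" and c: "0 < c"
  shows "(LINT x|lborel. f x) = complex_of_real (c ^ DIM('a)) * (LINT x|lborel. f (c *\<^sub>R x))"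
proof -
  have "(LINT x|lborel. f x) = (LINT x|density (distr lborel borel (\<lambda>x. 0 + c *\<^sub>R x)) (\<lambda>_. \<bar>c\<bar>^DIM('a)). f x)"
    by (subst lborel_affine[of c 0]) (use c in auto)
  also have "\<dots> = complex_of_real (c ^ DIM('a)) * (LINT x|lborel. f (c *\<^sub>R x))"
    using c by (subst integral_density) (auto simp: integral_distr scaleR_conv_of_real)
  finally show ?thesis .
qed

lemma ip_shift_tendsto:
  assumes f: "l2 f" and z: "z \<longlonglongrightarrow> 0"
  shows "(\<lambda>n. ip f (\<lambda>x. f (x + z n))) \<longlonglongrightarrow> complex_of_real (sqn f)"
proof -
  have "(\<lambda>n. ip f (\<lambda>x. f (x + z n)) - complex_of_real (sqn f)) \<longlonglongrightarrow> 0"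
  proof (rule Lim_null_comparison)
    show "(\<lambda>n. sqrt (sqn f * sqn (\<lambda>x. f (x + z n) - f x))) \<longlonglongrightarrow> 0"
      using tendsto_real_sqrt[OF tendsto_mult_right_zero[OF l2_translation_continuous[OF f z], of "sqn f"]] by simp
    show "\<forall>\<^sub>F n in sequentially. norm (ip f (\<lambda>x. f (x + z n)) - complex_of_real (sqn f))
       \<le> sqrt (sqn f * sqn (\<lambda>x. f (x + z n) - f x))"
    proof (rule always_eventually, rule allI)
      fix n
      have "ip f (\<lambda>x. f (x + z n)) - complex_of_real (sqn f) = ip f (\<lambda>x. f (x + z n) - f x)"
        unfolding ip_self[symmetric] 
        by (simp add: ip_def right_diff_distrib ip_integrable f l2_shift)
      moreover have "(cmod (ip f (\<lambda>x. f (x + z n) - f x)))\<^sup>2 \<le> sqn f * sqn (\<lambda>x. f (x + z n) - f x)"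
        by (intro ip_bound l2_diff l2_shift f)
      ultimately show "norm (ip f (\<lambda>x. f (x + z n)) - complex_of_real (sqn f))
       \<le> sqrt (sqn f * sqn (\<lambda>x. f (x + z n) - f x))"
        by (simp add: real_le_rsqrt)
    qed
  qed
  then show ?thesis by (simp add: LIM_zero_iff)
qed

text \<open>The substitution y = x + 2 sqrt(\<epsilon>) t turns the heat kernel into a fixed
  Gaussian in t. The parameter \<epsilon> then occurs only in a translation of f, which is what lets
  \<epsilon> tend to 0 under a fixed majorant.\<close>

lemma gauss_weighted_plancherel:
  fixes f :: "'a::euclidean_space \<Rightarrow> complex"
  assumes f: "l2 f" and i: "integrable lborel f" and \<epsilon>: "0 < \<epsilon>"
  shows "(LINT \<xi>|lborel. complex_of_real (exp (- \<epsilon> * (norm \<xi>)\<^sup>2)) * ft1 f \<xi> * cnj (ft1 f \<xi>))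
    = (LINT t::'a|lborel. complex_of_real ((2 * sqrt pi) ^ DIM('a) * exp (- 1 * (norm t)\<^sup>2)) * ip f (\<lambda>x. f (x + (2 * sqrt \<epsilon>) *\<^sub>R t)))"
proof -
  note [measurable] = l2_measurable[OF f]
  define c where "c = 2 * sqrt \<epsilon>"
  have c: "c > 0" "c\<^sup>2 = 4 * \<epsilon>" using \<epsilon> by (auto simp: c_def power_mult_distrib)
  define K where "K v = complex_of_real (sqrt (pi / \<epsilon>) ^ DIM('a) * exp (- (norm v)\<^sup>2 / (4 * \<epsilon>)))" for v :: 'a
  have [measurable]: "K \<in> borel_measurable borel" unfolding K_def by measurable
  have Kv: "(LINT \<xi>|lborel. complex_of_real (exp (- \<epsilon> * (norm \<xi>)\<^sup>2)) * cis (- (v \<bullet> \<xi>))) = K v" for v :: 'a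
    using integral_gauss_cis[OF \<epsilon>, of "- v"] by (simp add: K_def inner_commute)
  have w: "integrable lborel (\<lambda>\<xi>::'a. complex_of_real (exp (- \<epsilon> * (norm \<xi>)\<^sup>2)))"
    using integrable_gauss_cis[OF \<epsilon>, of "0::'a"] by simp
  define G where "G t = complex_of_real ((2 * sqrt pi) ^ DIM('a) * exp (- 1 * (norm t)\<^sup>2))" for t :: 'a
  have [measurable]: "G \<in> borel_measurable borel" unfolding G_def by measurable
  have Kc: "complex_of_real (c ^ DIM('a)) * K (- (c *\<^sub>R t)) = G t" for t :: 'a
  proof -
    have "c * sqrt (pi / \<epsilon>) = 2 * sqrt pi" using \<epsilon> by (simp add: c_def real_sqrt_divide)
    moreover have "(norm (- (c *\<^sub>R t)))\<^sup>2 / (4 * \<epsilon>) = (norm t)\<^sup>2" using c \<epsilon> by (simp add: power_mult_distrib)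
    ultimately have "c ^ DIM('a) * (sqrt (pi / \<epsilon>) ^ DIM('a) * exp (- (norm (- (c *\<^sub>R t)))\<^sup>2 / (4 * \<epsilon>)))
      = (2 * sqrt pi) ^ DIM('a) * exp (- 1 * (norm t)\<^sup>2)"
      unfolding mult.assoc[symmetric] power_mult_distrib[symmetric] minus_divide_left[symmetric]
      by (simp only: mult_minus_left mult_1)
    then show ?thesis unfolding K_def G_def of_real_mult[symmetric] by (simp only:)
  qed
  have inner: "(LINT y|lborel. f x * cnj (f y) * K (x - y)) = (LINT t|lborel. G t * (f x * cnj (f (x + c *\<^sub>R t))))" for x
  proof -
    have "(LINT y|lborel. f x * cnj (f y) * K (x - y)) = (LINT z|lborel. f x * cnj (f (z + x)) * K (x - (z + x)))"
      by (rule integral_shift[symmetric]) measurable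
    also have "\<dots> = (LINT z|lborel. f x * cnj (f (x + z)) * K (- z))" by (simp add: add.commute)
    also have "\<dots> = complex_of_real (c ^ DIM('a)) * (LINT t|lborel. f x * cnj (f (x + c *\<^sub>R t)) * K (- (c *\<^sub>R t)))"
      by (rule integral_lborel_scale[OF _ c(1)]) measurable
    also have "\<dots> = (LINT t|lborel. (complex_of_real (c ^ DIM('a)) * K (- (c *\<^sub>R t))) * (f x * cnj (f (x + c *\<^sub>R t))))"
      by (simp add: mult_ac flip: integral_mult_right_zero)
    finally show ?thesis unfolding Kc .
  qed
  have iG: "integrable lborel (\<lambda>t. cmod (G t))"
    unfolding G_def using integrable_gauss[of 1, where 'a='a] by (simp add: norm_mult del: of_real_mult)
  have ii: "integrable lborel (\<lambda>x. G t * (f x * cnj (f (x + c *\<^sub>R t))))" for t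
    by (intro integrable_mult_right ip_integrable f l2_shift)
  have ib: "(LINT x|lborel. cmod (G t * (f x * cnj (f (x + c *\<^sub>R t))))) \<le> cmod (G t) * sqn f" for t
  proof -
    have "(LINT x|lborel. cmod (f x) * cmod (f (x + c *\<^sub>R t)))\<^sup>2 \<le> sqn f * sqn (\<lambda>x. f (x + c *\<^sub>R t))"
      by (intro l2_norm_mult_sq f l2_shift)
    also have "\<dots> = (sqn f)\<^sup>2" by (simp add: sqn_shift power2_eq_square)
    finally have "(LINT x|lborel. cmod (f x) * cmod (f (x + c *\<^sub>R t))) \<le> sqn f"
      by (rule power2_le_imp_le) simp
    then show ?thesis by (simp add: norm_mult mult_left_mono)
  qed
  have "(LINT \<xi>|lborel. complex_of_real (exp (- \<epsilon> * (norm \<xi>)\<^sup>2)) * ft1 f \<xi> * cnj (ft1 f \<xi>))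
     = (LINT x|lborel. LINT t|lborel. G t * (f x * cnj (f (x + c *\<^sub>R t))))"
    unfolding parseval_kernel[OF i i w] Kv inner ..
  also have "\<dots> = (LINT t|lborel. LINT x|lborel. G t * (f x * cnj (f (x + c *\<^sub>R t))))"
  proof (rule lborel_pair.Fubini_integral)
    show "integrable (lborel \<Otimes>\<^sub>M lborel) (\<lambda>(t, x). G t * (f x * cnj (f (x + c *\<^sub>R t))))"
    proof (rule lborel_pair.Fubini_integrable)
      show "integrable lborel (\<lambda>t. LINT x|lborel. norm (case (t, x) of (t, x) \<Rightarrow> G t * (f x * cnj (f (x + c *\<^sub>R t)))))"
      proof (rule Bochner_Integration.integrable_bound)
        show "integrable lborel (\<lambda>t. cmod (G t) * sqn f)" using iG by auto
        show "AE t in lborel. norm (LINT x|lborel. norm (case (t, x) of (t, x) \<Rightarrow> G t * (f x * cnj (f (x + c *\<^sub>R t)))))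
            \<le> norm (cmod (G t) * sqn f)"
        proof (rule AE_I2)
          fix t
          have "0 \<le> (LINT x|lborel. cmod (G t * (f x * cnj (f (x + c *\<^sub>R t)))))"
            by (intro integral_nonneg_AE) auto
          then show "norm (LINT x|lborel. norm (case (t, x) of (t, x) \<Rightarrow> G t * (f x * cnj (f (x + c *\<^sub>R t)))))
            \<le> norm (cmod (G t) * sqn f)" using ib[of t] by simp
        qed
      qed measurable
    qed (use ii in auto)
  qed
  finally show ?thesis by (simp add: ip_def G_def c_def)
qed

text \<open>Continuity of translations evaluates the regularised identity as \<epsilon> tends to 0.
  The constant is the mass of the Gaussian in \<open>gauss_weighted_plancherel\<close>: (2 sqrt
  pi)^n times (sqrt pi)^n.\<close>

lemma plancherel_l1_l2:
  fixes f :: "'a::euclidean_space \<Rightarrow> complex"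
  assumes f: "l2 f" and i: "integrable lborel f"
  shows "l2 (ft1 f)" "sqn (ft1 f) = (2 * pi) ^ DIM('a) * sqn f"
proof -
  note [measurable] = l2_measurable[OF f]
  define \<epsilon> where "\<epsilon> m = inverse (real (Suc m))" for m
  have \<epsilon>: "\<epsilon> m > 0" for m by (simp add: \<epsilon>_def)
  have \<epsilon>0: "\<epsilon> \<longlonglongrightarrow> 0" unfolding \<epsilon>_def using LIMSEQ_inverse_real_of_nat .
  define G where "G t = (2 * sqrt pi) ^ DIM('a) * exp (- 1 * (norm t)\<^sup>2)" for t :: 'a
  have [measurable]: "G \<in> borel_measurable borel" unfolding G_def by measurable
  have G0: "G t \<ge> 0" for t by (simp add: G_def)
  have iG: "integrable lborel G" unfolding G_def using integrable_gauss[of 1, where 'a='a] by simp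
  have IG: "(LINT t|lborel. G t) = (2 * pi) ^ DIM('a)"
  proof -
    have "(LINT t|lborel. G t) = (2 * sqrt pi) ^ DIM('a) * (LINT t::'a|lborel. exp (- 1 * (norm t)\<^sup>2))"
      unfolding G_def by (rule integral_mult_right_zero)
    also have "\<dots> = (2 * sqrt pi * sqrt (pi / 1)) ^ DIM('a)"
      by (subst integral_gauss) (simp_all only: power_mult_distrib zero_less_one)
    also have "2 * sqrt pi * sqrt (pi / 1) = 2 * pi" by (simp add: mult.assoc)
    finally show ?thesis .
  qed
  define A where "A m t = ip f (\<lambda>x. f (x + (2 * sqrt (\<epsilon> m)) *\<^sub>R t))" for m and t :: 'a
  have [measurable]: "A m \<in> borel_measurable borel" for m unfolding A_def ip_def by measurable
  have Ab: "cmod (A m t) \<le> sqn f" for m t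
  proof -
    have "(cmod (A m t))\<^sup>2 \<le> (sqn f)\<^sup>2"
      unfolding A_def using ip_bound[OF f l2_shift[OF f, of "(2 * sqrt (\<epsilon> m)) *\<^sub>R t"]]
      by (simp add: sqn_shift power2_eq_square)
    then show ?thesis by (rule power2_le_imp_le) simp
  qed
  define F where "F m \<xi> = exp (- \<epsilon> m * (norm \<xi>)\<^sup>2) * (cmod (ft1 f \<xi>))\<^sup>2" for m \<xi>
  have [measurable]: "F m \<in> borel_measurable borel" for m unfolding F_def by measurable
  have iF: "integrable lborel (F m)" for m
  proof (rule Bochner_Integration.integrable_bound)
    show "integrable lborel (\<lambda>\<xi>::'a. exp (- \<epsilon> m * (norm \<xi>)\<^sup>2) * (LINT x|lborel. cmod (f x))\<^sup>2)"
      by (intro integrable_mult_left integrable_gauss \<epsilon>)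
    show "AE \<xi> in lborel. norm (F m \<xi>) \<le> norm (exp (- \<epsilon> m * (norm \<xi>)\<^sup>2) * (LINT x|lborel. cmod (f x))\<^sup>2)"
      unfolding F_def by (intro AE_I2) (auto intro!: mult_left_mono power_mono ft1_bound)
  qed measurable
  have eq: "complex_of_real (LINT \<xi>|lborel. F m \<xi>) = (LINT t|lborel. complex_of_real (G t) * A m t)" for m
  proof -
    have "complex_of_real (LINT \<xi>|lborel. F m \<xi>) = (LINT \<xi>|lborel. complex_of_real (F m \<xi>))" by simp
    also have "\<dots> = (LINT \<xi>|lborel. complex_of_real (exp (- \<epsilon> m * (norm \<xi>)\<^sup>2)) * ft1 f \<xi> * cnj (ft1 f \<xi>))"
      unfolding F_def of_real_mult complex_norm_square mult.assoc ..
    also have "\<dots> = (LINT t|lborel. complex_of_real (G t) * A m t)"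
      unfolding G_def A_def by (rule gauss_weighted_plancherel[OF f i \<epsilon>])
    finally show ?thesis .
  qed
  have iGA: "integrable lborel (\<lambda>t. complex_of_real (G t) * A m t)" for m
  proof (rule Bochner_Integration.integrable_bound)
    show "integrable lborel (\<lambda>t. G t * sqn f)" using iG by auto
    show "AE t in lborel. norm (complex_of_real (G t) * A m t) \<le> norm (G t * sqn f)"
      using Ab G0 by (intro AE_I2) (auto simp: norm_mult intro!: mult_left_mono)
  qed measurable
  have bd: "(LINT \<xi>|lborel. F m \<xi>) \<le> (2 * pi) ^ DIM('a) * sqn f" for m
  proof -
    have "(LINT \<xi>|lborel. F m \<xi>) \<le> cmod (LINT t|lborel. complex_of_real (G t) * A m t)"
      unfolding eq[symmetric] by simp
    also have "\<dots> \<le> (LINT t|lborel. cmod (complex_of_real (G t) * A m t))" by (rule integral_norm_bound)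
    also have "\<dots> \<le> (LINT t|lborel. G t * sqn f)"
      using Ab G0 iG by (intro integral_mono integrable_norm iGA) (auto simp: norm_mult intro!: mult_left_mono)
    also have "\<dots> = (2 * pi) ^ DIM('a) * sqn f" using IG by simp
    finally show ?thesis .
  qed
  have Fl: "(\<lambda>m. F m \<xi>) \<longlonglongrightarrow> (cmod (ft1 f \<xi>))\<^sup>2" for \<xi>
  proof -
    have "(\<lambda>m. F m \<xi>) \<longlonglongrightarrow> exp (- 0 * (norm \<xi>)\<^sup>2) * (cmod (ft1 f \<xi>))\<^sup>2"
      unfolding F_def by (intro tendsto_intros \<epsilon>0)
    then show ?thesis by simp
  qed
  \<comment> \<open>Fatou first shows that |ft1 f|^2 is integrable; only then can it serve as the
    majorant in the limit of the left-hand side.\<close>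
  have i2: "integrable lborel (\<lambda>\<xi>. (cmod (ft1 f \<xi>))\<^sup>2)"
    by (rule Fatou_real(1)[OF iF _ bd _ AE_I2[OF Fl]]) (auto simp: F_def)
  then show "l2 (ft1 f)" by (simp add: l2_def)
  have l1: "(\<lambda>m. LINT \<xi>|lborel. F m \<xi>) \<longlonglongrightarrow> sqn (ft1 f)"
    unfolding sqn_def
  proof (rule integral_dominated_convergence[OF _ _ i2])
    show "AE \<xi> in lborel. norm (F m \<xi>) \<le> (cmod (ft1 f \<xi>))\<^sup>2" for m
      unfolding F_def using \<epsilon>[of m] by (intro AE_I2) (auto simp: mult_le_cancel_right1 intro!: mult_left_le_one_le)
  qed (use Fl in auto)
  have l2: "(\<lambda>m. LINT t|lborel. complex_of_real (G t) * A m t) \<longlonglongrightarrow> (LINT t|lborel. complex_of_real (G t) * complex_of_real (sqn f))"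
  proof (rule integral_dominated_convergence[where w="\<lambda>t. G t * sqn f"])
    show "AE t in lborel. norm (complex_of_real (G t) * A m t) \<le> G t * sqn f" for m
      using Ab G0 by (intro AE_I2) (auto simp: norm_mult intro!: mult_left_mono)
    have "(\<lambda>m. A m t) \<longlonglongrightarrow> complex_of_real (sqn f)" for t
    proof -
      have "(\<lambda>m. (2 * sqrt (\<epsilon> m)) *\<^sub>R t) \<longlonglongrightarrow> (2 * sqrt 0) *\<^sub>R t" by (intro tendsto_intros \<epsilon>0)
      then show ?thesis unfolding A_def by (intro ip_shift_tendsto f) simp
    qed
    then show "AE t in lborel. (\<lambda>m. complex_of_real (G t) * A m t) \<longlonglongrightarrow> complex_of_real (G t) * complex_of_real (sqn f)"
      by (intro AE_I2 tendsto_intros)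
  qed (use iG in auto)
  have "(LINT t|lborel. complex_of_real (G t) * complex_of_real (sqn f)) = complex_of_real ((2 * pi) ^ DIM('a) * sqn f)"
    using IG by (simp flip: of_real_mult)
  with l2 have "(\<lambda>m. LINT \<xi>|lborel. F m \<xi>) \<longlonglongrightarrow> (2 * pi) ^ DIM('a) * sqn f"
    unfolding eq[symmetric] by (simp only: tendsto_of_real_iff)
  with l1 show "sqn (ft1 f) = (2 * pi) ^ DIM('a) * sqn f" by (rule LIMSEQ_unique)
qed

section \<open>The Fourier transform on square-integrable functions\<close>

definition is_ft :: "('a::euclidean_space \<Rightarrow> complex) \<Rightarrow> ('a \<Rightarrow> complex) \<Rightarrow> bool" where
  "is_ft f g \<longleftrightarrow> l2 g \<and> ((\<lambda>R. sqn (\<lambda>\<xi>. ft1 (trunc R f) \<xi> - g \<xi>)) \<longlongrightarrow> 0) at_top"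

definition ft :: "('a::euclidean_space \<Rightarrow> complex) \<Rightarrow> 'a \<Rightarrow> complex" where
  "ft f = (SOME g. is_ft f g)"

lemma sqn_trunc_tendsto:
  assumes f: "l2 f"
  shows "((\<lambda>R. sqn (\<lambda>x. f x - trunc R f x)) \<longlongrightarrow> 0) at_top"
proof (rule tendsto_at_topI_sequentially)
  fix X :: "nat \<Rightarrow> real" assume X: "filterlim X at_top sequentially"
  have "(\<lambda>n. sqn (\<lambda>x. indicator (- ball 0 (X n)) x * f x)) \<longlonglongrightarrow> 0"
  proof (rule sqn_tail_seq[OF f])
    fix x :: 'a
    have "eventually (\<lambda>n. X n > norm x) sequentially" using X by (simp add: filterlim_at_top_dense)
    then show "eventually (\<lambda>n. x \<notin> - ball 0 (X n)) sequentially" by eventually_elim auto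
  qed auto
  moreover have "(\<lambda>x. indicator (- ball 0 R) x * f x) = (\<lambda>x. f x - trunc R f x)" for R
    by (auto simp: trunc_def indicator_def)
  ultimately show "(\<lambda>n. sqn (\<lambda>x. f x - trunc (X n) f x)) \<longlonglongrightarrow> 0" by simp
qed

text \<open>Used for completeness of L^2 and again for the pointwise limit of \<open>\<phi>\<close>
  along the times 2^j.\<close>

lemma geometric_increments_convergent:
  fixes F :: "nat \<Rightarrow> 'b::banach"
  assumes r: "0 \<le> r" "r < 1" and b: "\<And>j. norm (F (Suc j) - F j) \<le> C * r ^ j"
  shows "convergent F"
proof -
  have s: "summable (\<lambda>j. C * r ^ j)" using r by (intro summable_mult summable_geometric) auto
  have "summable (\<lambda>j. F (Suc j) - F j)" by (rule summable_comparison_test'[OF s]) (rule b)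
  then have "(\<lambda>n. \<Sum>j<n. F (Suc j) - F j) \<longlonglongrightarrow> (\<Sum>j. F (Suc j) - F j)" by (rule summable_LIMSEQ)
  then have "(\<lambda>n. F n - F 0) \<longlonglongrightarrow> (\<Sum>j. F (Suc j) - F j)" by (simp add: sum_lessThan_telescope)
  from tendsto_add[OF this tendsto_const[of "F 0"]] show ?thesis by (auto simp: convergent_def)
qed

text \<open>The core of Riesz-Fischer. Weighting the squared increments by 2^j still leaves a
  convergent sum of integrals, so almost everywhere the weighted sum is finite, and the increments
  decay like 2^(-j/2).\<close>

lemma l2_rapid_limit:
  fixes F :: "nat \<Rightarrow> 'a::euclidean_space \<Rightarrow> complex"
  assumes F: "\<And>j. l2 (F j)" and b: "\<And>j. sqn (\<lambda>x. F (Suc j) x - F j x) \<le> (1/4) ^ j"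
  obtains g where "g \<in> borel_measurable borel" "AE x in lborel. (\<lambda>j. F j x) \<longlonglongrightarrow> g x"
proof -
  note [measurable] = l2_measurable[OF F]
  define D where "D j x = (cmod (F (Suc j) x - F j x))\<^sup>2" for j x
  have iD: "integrable lborel (D j)" for j
    unfolding D_def by (intro l2_integrable l2_diff F)
  have [measurable]: "D j \<in> borel_measurable borel" for j unfolding D_def by measurable
  have "(\<integral>\<^sup>+x. (\<Sum>j. ennreal (2 ^ j * D j x)) \<partial>lborel) = (\<Sum>j. \<integral>\<^sup>+x. ennreal (2 ^ j * D j x) \<partial>lborel)"
    by (intro nn_integral_suminf) measurable
  also have "\<dots> \<le> (\<Sum>j. ennreal ((1/2) ^ j))"
  proof (intro suminf_le)
    fix j
    have "(\<integral>\<^sup>+x. ennreal (2 ^ j * D j x) \<partial>lborel) = ennreal (LINT x|lborel. 2 ^ j * D j x)"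
      by (intro nn_integral_eq_integral integrable_mult_right iD) (auto simp: D_def)
    also have "\<dots> \<le> ennreal ((1/2) ^ j)"
    proof (rule ennreal_leI)
      have "(LINT x|lborel. 2 ^ j * D j x) \<le> 2 ^ j * (1/4) ^ j"
        using b[of j] by (simp add: D_def sqn_def)
      also have "\<dots> = (1/2) ^ j" by (simp flip: power_mult_distrib)
      finally show "(LINT x|lborel. 2 ^ j * D j x) \<le> (1/2) ^ j" .
    qed
    finally show "(\<integral>\<^sup>+x. ennreal (2 ^ j * D j x) \<partial>lborel) \<le> ennreal ((1/2) ^ j)" .
  qed auto
  also have "\<dots> < \<infinity>"
    using summable_geometric[of "1/2::real"] by (subst suminf_ennreal2) auto
  finally have "(\<integral>\<^sup>+x. (\<Sum>j. ennreal (2 ^ j * D j x)) \<partial>lborel) \<noteq> \<infinity>" by simp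
  then have "AE x in lborel. (\<Sum>j. ennreal (2 ^ j * D j x)) \<noteq> \<infinity>"
    by (intro nn_integral_PInf_AE) auto
  then have conv: "AE x in lborel. convergent (\<lambda>j. F j x)"
  proof eventually_elim
    fix x assume fin: "(\<Sum>j. ennreal (2 ^ j * D j x)) \<noteq> \<infinity>"
    then obtain c where c: "(\<Sum>j. ennreal (2 ^ j * D j x)) = ennreal c" "c \<ge> 0"
      by (cases "\<Sum>j. ennreal (2 ^ j * D j x)") auto
    have "cmod (F (Suc j) x - F j x) \<le> sqrt c * (sqrt (1/2)) ^ j" for j
    proof -
      have "ennreal (2 ^ j * D j x) \<le> ennreal c"
        unfolding c(1)[symmetric] using sum_le_suminf[of "\<lambda>j. ennreal (2 ^ j * D j x)" "{j}"] by simp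
      then have "2 ^ j * D j x \<le> c" using c(2) by simp
      then have "D j x \<le> c * (1/2) ^ j" by (simp add: field_simps power_one_over)
      then have "sqrt (D j x) \<le> sqrt (c * (1/2) ^ j)" by (rule real_sqrt_le_mono)
      then show ?thesis by (simp add: D_def real_sqrt_mult real_sqrt_power)
    qed
    then show "convergent (\<lambda>j. F j x)"
      by (intro geometric_increments_convergent[of "sqrt (1/2)"]) auto
  qed
  show ?thesis
  proof
    show "(\<lambda>x. lim (\<lambda>j. F j x)) \<in> borel_measurable borel" by measurable
    show "AE x in lborel. (\<lambda>j. F j x) \<longlonglongrightarrow> lim (\<lambda>j. F j x)"
      using conv by eventually_elim (simp add: convergent_LIMSEQ_iff)
  qed
qed

lemma sqn_ft1_trunc_diff:
  fixes f :: "'a::euclidean_space \<Rightarrow> complex"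
  assumes f: "l2 f" and g: "l2 g"
  shows "sqn (\<lambda>\<xi>. ft1 (trunc R f) \<xi> - ft1 (trunc S g) \<xi>) = (2 * pi) ^ DIM('a) * sqn (\<lambda>x. trunc R f x - trunc S g x)"
proof -
  have "(\<lambda>\<xi>. ft1 (trunc R f) \<xi> - ft1 (trunc S g) \<xi>) = ft1 (\<lambda>x. trunc R f x - trunc S g x)"
    by (simp add: ft1_diff integrable_trunc f g fun_eq_iff)
  then show ?thesis
    by (simp add: plancherel_l1_l2 l2_diff l2_trunc integrable_trunc f g)
qed

lemma l2_ft1_trunc: "l2 f \<Longrightarrow> l2 (ft1 (trunc R f))"
  by (intro plancherel_l1_l2 l2_trunc integrable_trunc)

text \<open>By Plancherel the transforms of truncations are Cauchy in L^2. A pointwise limit is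
  taken along a rapidly converging sequence of radii, and Fatou carries the Cauchy bound over to all
  radii.\<close>

lemma is_ft_exists:
  fixes f :: "'a::euclidean_space \<Rightarrow> complex"
  assumes f: "l2 f"
  shows "\<exists>g. is_ft f g"
proof -
  define \<kappa> where "\<kappa> = (2 * pi :: real) ^ DIM('a)"
  have \<kappa>: "\<kappa> > 0" by (simp add: \<kappa>_def)
  define T where "T R = sqn (\<lambda>x. f x - trunc R f x)" for R
  have "\<exists>R. \<forall>S\<ge>R. T S \<le> (1/4) ^ j / (4 * \<kappa>)" for j
  proof -
    have "(1/4) ^ j / (4 * \<kappa>) > 0" using \<kappa> by simp
    then have "eventually (\<lambda>S. T S < (1/4) ^ j / (4 * \<kappa>)) at_top"
      using sqn_trunc_tendsto[OF f] by (auto simp: order_tendsto_iff T_def)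
    then show ?thesis by (auto simp: eventually_at_top_linorder intro: less_imp_le)
  qed
  then obtain r where r: "\<And>j S. S \<ge> r j \<Longrightarrow> T S \<le> (1/4) ^ j / (4 * \<kappa>)" by metis
  \<comment> \<open>The maximum over indices up to j makes both \<open>q j\<close> and
    \<open>q (Suc j)\<close> at least \<open>r j\<close>, so that two consecutive truncations are
    close at the same rate; \<open>r\<close> itself need not be monotone.\<close>
  define q where "q j = Max (r ` {..j})" for j
  have q: "T (q j) \<le> (1/4) ^ j / (4 * \<kappa>)" "T (q (Suc j)) \<le> (1/4) ^ j / (4 * \<kappa>)" for j
    by (rule r, auto simp: q_def intro!: Max_ge)+
  have tri: "sqn (\<lambda>\<xi>. ft1 (trunc R f) \<xi> - ft1 (trunc S f) \<xi>) \<le> 2 * \<kappa> * T R + 2 * \<kappa> * T S" for R S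
  proof -
    have "sqn (\<lambda>x. trunc R f x - trunc S f x) \<le> 2 * sqn (\<lambda>x. trunc R f x - f x) + 2 * T S"
      unfolding T_def by (intro sqn_triangle l2_trunc f)
    also have "sqn (\<lambda>x. trunc R f x - f x) = T R" unfolding T_def by (rule sqn_minus_commute)
    finally have "\<kappa> * sqn (\<lambda>x. trunc R f x - trunc S f x) \<le> \<kappa> * (2 * T R + 2 * T S)"
      using \<kappa> by (intro mult_left_mono) auto
    then show ?thesis unfolding sqn_ft1_trunc_diff[OF f f] \<kappa>_def[symmetric] by (simp add: algebra_simps)
  qed
  define F where "F j = ft1 (trunc (q j) f)" for j
  have Fl: "l2 (F j)" for j unfolding F_def by (rule l2_ft1_trunc[OF f])
  have "sqn (\<lambda>x. F (Suc j) x - F j x) \<le> (1/4) ^ j" for j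
  proof -
    have "sqn (\<lambda>x. F (Suc j) x - F j x) \<le> 2 * \<kappa> * T (q (Suc j)) + 2 * \<kappa> * T (q j)"
      unfolding F_def by (rule tri)
    also have "\<dots> \<le> 2 * \<kappa> * ((1/4) ^ j / (4 * \<kappa>)) + 2 * \<kappa> * ((1/4) ^ j / (4 * \<kappa>))"
      using q \<kappa> by (intro add_mono mult_left_mono) auto
    also have "\<dots> = (1/4) ^ j" using \<kappa> by simp
    finally show ?thesis .
  qed
  from l2_rapid_limit[OF Fl this] obtain g where g[measurable]: "g \<in> borel_measurable borel"
    and lim: "AE x in lborel. (\<lambda>j. F j x) \<longlonglongrightarrow> g x" by blast
  \<comment> \<open>The slack (1/4)^J comes from starting the sequence at index J; it disappears
    when J tends to infinity at fixed R.\<close>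
  have bd: "l2 (\<lambda>\<xi>. ft1 (trunc R f) \<xi> - g \<xi>) \<and> sqn (\<lambda>\<xi>. ft1 (trunc R f) \<xi> - g \<xi>) \<le> 2 * \<kappa> * T R + (1/4) ^ J" for R J
  proof -
    note [measurable] = l2_measurable[OF f]
    have a: "l2 (\<lambda>\<xi>. ft1 (trunc R f) \<xi> - F (j + J) \<xi>)" for j
      by (intro l2_diff l2_ft1_trunc f Fl)
    have b: "sqn (\<lambda>\<xi>. ft1 (trunc R f) \<xi> - F (j + J) \<xi>) \<le> 2 * \<kappa> * T R + (1/4) ^ J" for j
    proof -
      have "sqn (\<lambda>\<xi>. ft1 (trunc R f) \<xi> - F (j + J) \<xi>) \<le> 2 * \<kappa> * T R + 2 * \<kappa> * T (q (j + J))"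
        unfolding F_def by (rule tri)
      also have "2 * \<kappa> * T (q (j + J)) \<le> 2 * \<kappa> * ((1/4) ^ (j + J) / (4 * \<kappa>))"
        using q \<kappa> by (intro mult_left_mono) auto
      also have "\<dots> = (1/4) ^ j * (1/4) ^ J / 2" using \<kappa> by (simp add: power_add)
      also have "\<dots> \<le> (1/4) ^ J"
      proof -
        have "(1/4::real) ^ j \<le> 1" by (simp add: power_le_one)
        then have "(1/4::real) ^ j * (1/4) ^ J \<le> 1 * (1/4) ^ J" by (intro mult_right_mono) auto
        moreover have "(0::real) \<le> (1/4) ^ J" by simp
        ultimately show ?thesis by linarith
      qed
      finally show ?thesis by simp
    qed
    have c: "AE \<xi> in lborel. (\<lambda>j. ft1 (trunc R f) \<xi> - F (j + J) \<xi>) \<longlonglongrightarrow> ft1 (trunc R f) \<xi> - g \<xi>"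
      using lim by eventually_elim (intro tendsto_intros LIMSEQ_ignore_initial_segment)
    have m: "(\<lambda>\<xi>. ft1 (trunc R f) \<xi> - g \<xi>) \<in> borel_measurable borel" by measurable
    show ?thesis using Fatou_sqn[OF a b m c] by blast
  qed
  \<comment> \<open>\<open>g\<close> is written as the difference of two square-integrable
    functions; any radius would serve.\<close>
  have "l2 (\<lambda>\<xi>. ft1 (trunc 0 f) \<xi> - (ft1 (trunc 0 f) \<xi> - g \<xi>))"
    by (rule l2_diff(1)[OF l2_ft1_trunc[OF f]]) (use bd in blast)
  then have "l2 g" by simp
  moreover have "((\<lambda>R. sqn (\<lambda>\<xi>. ft1 (trunc R f) \<xi> - g \<xi>)) \<longlongrightarrow> 0) at_top"
  proof (rule tendsto_sandwich[where f="\<lambda>_. 0"])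
    show "((\<lambda>R. 2 * \<kappa> * T R) \<longlongrightarrow> 0) at_top"
      using tendsto_mult_right_zero[OF sqn_trunc_tendsto[OF f], of "2 * \<kappa>"] by (simp add: T_def)
    have "sqn (\<lambda>\<xi>. ft1 (trunc R f) \<xi> - g \<xi>) \<le> 2 * \<kappa> * T R" for R
    proof (rule LIMSEQ_le_const)
      have "(\<lambda>J. 2 * \<kappa> * T R + (1/4) ^ J) \<longlonglongrightarrow> 2 * \<kappa> * T R + 0"
        by (intro tendsto_intros LIMSEQ_power_zero) simp
      then show "(\<lambda>J. 2 * \<kappa> * T R + (1/4) ^ J) \<longlonglongrightarrow> 2 * \<kappa> * T R" by simp
    qed (use bd in blast)
    then show "\<forall>\<^sub>F R in at_top. sqn (\<lambda>\<xi>. ft1 (trunc R f) \<xi> - g \<xi>) \<le> 2 * \<kappa> * T R" by simp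
  qed auto
  ultimately show ?thesis by (auto simp: is_ft_def)
qed

lemma is_ft_ft: "l2 f \<Longrightarrow> is_ft f (ft f)"
  unfolding ft_def using is_ft_exists by (rule someI_ex)

lemma l2_ft [intro]: "l2 f \<Longrightarrow> l2 (ft f)"
  using is_ft_ft by (auto simp: is_ft_def)

lemma ft_measurable [measurable (raw)]: "l2 f \<Longrightarrow> ft f \<in> borel_measurable borel"
  using l2_ft l2_measurable by blast

lemma l2_limit_unique_AE:
  fixes F :: "real \<Rightarrow> 'a::euclidean_space \<Rightarrow> complex"
  assumes F: "\<And>R. l2 (F R)" and g: "l2 g" and h: "l2 h"
    and 1: "((\<lambda>R. sqn (\<lambda>\<xi>. F R \<xi> - g \<xi>)) \<longlongrightarrow> 0) at_top"
    and 2: "((\<lambda>R. sqn (\<lambda>\<xi>. F R \<xi> - h \<xi>)) \<longlongrightarrow> 0) at_top"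
  shows "AE \<xi> in lborel. g \<xi> = h \<xi>"
proof -
  have "sqn (\<lambda>\<xi>. g \<xi> - h \<xi>) \<le> 0"
  proof (rule tendsto_lowerbound)
    show "((\<lambda>R. 2 * sqn (\<lambda>\<xi>. F R \<xi> - g \<xi>) + 2 * sqn (\<lambda>\<xi>. F R \<xi> - h \<xi>)) \<longlongrightarrow> 0) at_top"
      using tendsto_add[OF tendsto_mult_right_zero[OF 1, of 2] tendsto_mult_right_zero[OF 2, of 2]] by simp
    have "sqn (\<lambda>\<xi>. g \<xi> - h \<xi>) \<le> 2 * sqn (\<lambda>\<xi>. F R \<xi> - g \<xi>) + 2 * sqn (\<lambda>\<xi>. F R \<xi> - h \<xi>)" for R
      using sqn_triangle[OF g F[of R] h] by (simp add: sqn_minus_commute[of g])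
    then show "\<forall>\<^sub>F R in at_top. sqn (\<lambda>\<xi>. g \<xi> - h \<xi>) \<le> 2 * sqn (\<lambda>\<xi>. F R \<xi> - g \<xi>) + 2 * sqn (\<lambda>\<xi>. F R \<xi> - h \<xi>)"
      by simp
  qed simp
  then have "sqn (\<lambda>\<xi>. g \<xi> - h \<xi>) = 0" by (simp add: order_antisym)
  from sqn_eq_0_AE[OF l2_diff(1)[OF g h] this] show ?thesis by auto
qed

lemma is_ft_unique_AE:
  assumes f: "l2 f" and "is_ft f g" "is_ft f h"
  shows "AE \<xi> in lborel. g \<xi> = h \<xi>"
  using assms by (intro l2_limit_unique_AE[OF l2_ft1_trunc[OF f]]) (auto simp: is_ft_def)

section \<open>Linearity, Parseval's identity and surjectivity of the transform\<close>

lemma ft_limit: "l2 f \<Longrightarrow> ((\<lambda>R. sqn (\<lambda>\<xi>. ft1 (trunc R f) \<xi> - ft f \<xi>)) \<longlongrightarrow> 0) at_top"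
  using is_ft_ft by (auto simp: is_ft_def)

lemma ft_eq_ft1:
  fixes f :: "'a::euclidean_space \<Rightarrow> complex"
  assumes f: "l2 f" and i: "integrable lborel f"
  shows "AE \<xi> in lborel. ft f \<xi> = ft1 f \<xi>"
proof (rule is_ft_unique_AE[OF f is_ft_ft[OF f]])
  have "sqn (\<lambda>\<xi>. ft1 (trunc R f) \<xi> - ft1 f \<xi>) = (2 * pi) ^ DIM('a) * sqn (\<lambda>x. f x - trunc R f x)" for R
  proof -
    have "(\<lambda>\<xi>. ft1 (trunc R f) \<xi> - ft1 f \<xi>) = ft1 (\<lambda>x. trunc R f x - f x)"
      by (simp add: ft1_diff integrable_trunc f i fun_eq_iff)
    then show ?thesis
      by (simp add: plancherel_l1_l2 l2_diff l2_trunc integrable_trunc f i sqn_minus_commute[of f])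
  qed
  then show "is_ft f (ft1 f)"
    using tendsto_mult_right_zero[OF sqn_trunc_tendsto[OF f], of "(2 * pi) ^ DIM('a)"] plancherel_l1_l2[OF f i]
    by (simp add: is_ft_def)
qed

text \<open>\<open>ft\<close> is a choice within a class modulo null sets, so its algebraic laws
  hold only almost everywhere. Here both sides are L^2 limits of the same truncated
  transforms.\<close>

lemma ft_lincomb:
  fixes f g :: "'a::euclidean_space \<Rightarrow> complex"
  assumes f: "l2 f" and g: "l2 g"
  shows "AE \<xi> in lborel. ft (\<lambda>x. c * f x + d * g x) \<xi> = c * ft f \<xi> + d * ft g \<xi>"
proof (rule is_ft_unique_AE[OF _ is_ft_ft])
  let ?h = "\<lambda>x. c * f x + d * g x"
  show *: "l2 ?h" by (intro l2_add l2_cmult f g)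
  then show "l2 ?h" .
  have "((\<lambda>R. sqn (\<lambda>\<xi>. ft1 (trunc R ?h) \<xi> - (c * ft f \<xi> + d * ft g \<xi>))) \<longlongrightarrow> 0) at_top"
  proof (rule tendsto_sandwich[where f="\<lambda>_. 0"])
    show "((\<lambda>R. 2 * (cmod c)\<^sup>2 * sqn (\<lambda>\<xi>. ft1 (trunc R f) \<xi> - ft f \<xi>) + 2 * (cmod d)\<^sup>2 * sqn (\<lambda>\<xi>. ft1 (trunc R g) \<xi> - ft g \<xi>)) \<longlongrightarrow> 0) at_top"
      using tendsto_add[OF tendsto_mult_right_zero[OF ft_limit[OF f], of "2 * (cmod c)\<^sup>2"] tendsto_mult_right_zero[OF ft_limit[OF g], of "2 * (cmod d)\<^sup>2"]] by simp
    have "sqn (\<lambda>\<xi>. ft1 (trunc R ?h) \<xi> - (c * ft f \<xi> + d * ft g \<xi>))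
      \<le> 2 * (cmod c)\<^sup>2 * sqn (\<lambda>\<xi>. ft1 (trunc R f) \<xi> - ft f \<xi>) + 2 * (cmod d)\<^sup>2 * sqn (\<lambda>\<xi>. ft1 (trunc R g) \<xi> - ft g \<xi>)" for R
    proof -
      have "trunc R ?h = (\<lambda>x. c * trunc R f x + d * trunc R g x)" by (auto simp: trunc_def)
      then have "ft1 (trunc R ?h) \<xi> - (c * ft f \<xi> + d * ft g \<xi>) = c * (ft1 (trunc R f) \<xi> - ft f \<xi>) + d * (ft1 (trunc R g) \<xi> - ft g \<xi>)" for \<xi>
        by (simp add: ft1_add ft1_cmult integrable_trunc f g algebra_simps)
      then show ?thesis
        using l2_add(2)[OF l2_cmult[OF l2_diff(1)[OF l2_ft1_trunc[OF f, of R] l2_ft[OF f]], of c] l2_cmult[OF l2_diff(1)[OF l2_ft1_trunc[OF g, of R] l2_ft[OF g]], of d]]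
        by (simp add: sqn_cmult)
    qed
    then show "\<forall>\<^sub>F R in at_top. sqn (\<lambda>\<xi>. ft1 (trunc R ?h) \<xi> - (c * ft f \<xi> + d * ft g \<xi>))
      \<le> 2 * (cmod c)\<^sup>2 * sqn (\<lambda>\<xi>. ft1 (trunc R f) \<xi> - ft f \<xi>) + 2 * (cmod d)\<^sup>2 * sqn (\<lambda>\<xi>. ft1 (trunc R g) \<xi> - ft g \<xi>)" by simp
  qed auto
  moreover have "l2 (\<lambda>\<xi>. c * ft f \<xi> + d * ft g \<xi>)" by (intro l2_add l2_cmult l2_ft f g)
  ultimately show "is_ft ?h (\<lambda>\<xi>. c * ft f \<xi> + d * ft g \<xi>)" by (simp add: is_ft_def)
qed

lemma ft_add: "l2 f \<Longrightarrow> l2 g \<Longrightarrow> AE \<xi> in lborel. ft (\<lambda>x. f x + g x) \<xi> = ft f \<xi> + ft g \<xi>"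
  and ft_diff: "l2 f \<Longrightarrow> l2 g \<Longrightarrow> AE \<xi> in lborel. ft (\<lambda>x. f x - g x) \<xi> = ft f \<xi> - ft g \<xi>"
  and ft_cmult: "l2 f \<Longrightarrow> AE \<xi> in lborel. ft (\<lambda>x. c * f x) \<xi> = c * ft f \<xi>"
  using ft_lincomb[of f g 1 1] ft_lincomb[of f g 1 "-1"] ft_lincomb[of f f c 0] by simp_all

lemma sqn_tendsto:
  assumes F: "\<And>R. l2 (F R)" and g: "l2 g" and lim: "((\<lambda>R. sqn (\<lambda>x. F R x - g x)) \<longlongrightarrow> 0) A"
  shows "((\<lambda>R. sqn (F R)) \<longlongrightarrow> sqn g) A"
proof -
  have "((\<lambda>R. sqn (F R) - sqn g) \<longlongrightarrow> 0) A"
  proof (rule Lim_null_comparison)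
    show "((\<lambda>R. sqn (\<lambda>x. F R x - g x) + 2 * sqrt (sqn (\<lambda>x. F R x - g x) * sqn g)) \<longlongrightarrow> 0) A"
      using tendsto_add[OF lim tendsto_mult_right_zero[OF tendsto_real_sqrt[OF tendsto_mult_left_zero[OF lim, of "sqn g"], simplified], of 2]] by simp
    show "\<forall>\<^sub>F R in A. norm (sqn (F R) - sqn g) \<le> sqn (\<lambda>x. F R x - g x) + 2 * sqrt (sqn (\<lambda>x. F R x - g x) * sqn g)"
    proof (rule always_eventually, rule allI)
      fix R
      have d: "l2 (\<lambda>x. F R x - g x)" by (intro l2_diff F g)
      have "sqn (F R) - sqn g = sqn (\<lambda>x. F R x - g x) + 2 * Re (ip (\<lambda>x. F R x - g x) g)"
        unfolding ip_diff_left[OF F g g] sqn_diff_expand[OF F g] ip_self by simp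
      moreover have "\<bar>Re (ip (\<lambda>x. F R x - g x) g)\<bar> \<le> sqrt (sqn (\<lambda>x. F R x - g x) * sqn g)"
        using real_le_rsqrt[OF ip_bound[OF d g]] abs_Re_le_cmod order_trans by blast
      ultimately show "norm (sqn (F R) - sqn g) \<le> sqn (\<lambda>x. F R x - g x) + 2 * sqrt (sqn (\<lambda>x. F R x - g x) * sqn g)"
        using sqn_nonneg[of "\<lambda>x. F R x - g x"] unfolding real_norm_def abs_le_iff by (auto simp: abs_le_iff simp del: sqn_nonneg)
    qed
  qed
  then show ?thesis by (simp add: LIM_zero_iff)
qed

theorem plancherel:
  fixes f :: "'a::euclidean_space \<Rightarrow> complex"
  assumes f: "l2 f"
  shows "sqn (ft f) = (2 * pi) ^ DIM('a) * sqn f"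
proof (rule tendsto_unique)
  show "((\<lambda>R. sqn (ft1 (trunc R f))) \<longlongrightarrow> sqn (ft f)) at_top"
    by (rule sqn_tendsto[OF l2_ft1_trunc[OF f] l2_ft[OF f] ft_limit[OF f]])
  have "((\<lambda>R. sqn (trunc R f)) \<longlongrightarrow> sqn f) at_top"
    using sqn_trunc_tendsto[OF f] by (intro sqn_tendsto l2_trunc f) (simp add: sqn_minus_commute[of f])
  then show "((\<lambda>R. sqn (ft1 (trunc R f))) \<longlongrightarrow> (2 * pi) ^ DIM('a) * sqn f) at_top"
    by (simp add: plancherel_l1_l2 l2_trunc integrable_trunc f tendsto_mult_left)
qed simp

lemma sqn_ft_diff:
  fixes f g :: "'a::euclidean_space \<Rightarrow> complex"
  assumes f: "l2 f" and g: "l2 g"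
  shows "sqn (\<lambda>\<xi>. ft f \<xi> - ft g \<xi>) = (2 * pi) ^ DIM('a) * sqn (\<lambda>x. f x - g x)"
proof -
  have "sqn (\<lambda>\<xi>. ft f \<xi> - ft g \<xi>) = sqn (ft (\<lambda>x. f x - g x))"
    using ft_diff[OF f g] l2_measurable[OF l2_ft] f g
    by (intro sqn_cong_AE l2_measurable l2_ft l2_diff) auto
  then show ?thesis by (simp add: plancherel l2_diff f g)
qed

text \<open>Polarisation: Plancherel applied to f - h gives the real part of the pairing, and the
  imaginary part is the real part with \<open>\<i> * g\<close> in place of g.\<close>

theorem parseval:
  fixes f g :: "'a::euclidean_space \<Rightarrow> complex"
  assumes f: "l2 f" and g: "l2 g"
  shows "ip (ft f) (ft g) = (2 * pi) ^ DIM('a) * ip f g"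
proof -
  have re: "Re (ip (ft f) (ft h)) = (2 * pi) ^ DIM('a) * Re (ip f h)" if h: "l2 h" for h
    using sqn_diff_expand[OF l2_ft[OF f] l2_ft[OF h]] sqn_diff_expand[OF f h]
    by (simp add: sqn_ft_diff f h plancherel algebra_simps)
  have i: "ip u (\<lambda>x. \<i> * v x) = - \<i> * ip u v" for u v :: "'a \<Rightarrow> complex"
    unfolding ip_def by (simp add: mult.left_commute)
  have "ip (ft f) (ft (\<lambda>x. \<i> * g x)) = ip (ft f) (\<lambda>x. \<i> * ft g x)"
    unfolding ip_def using ft_cmult[OF g, of \<i>] l2_measurable[OF l2_ft[OF f]] l2_measurable[OF l2_ft[OF g]] l2_measurable[OF l2_ft[OF l2_cmult[OF g, of \<i>]]]
    by (intro integral_cong_AE) auto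
  with re[OF l2_cmult[OF g, of \<i>]] have im: "Im (ip (ft f) (ft g)) = (2 * pi) ^ DIM('a) * Im (ip f g)"
    by (simp add: i)
  have "ip (ft f) (ft g) = complex_of_real ((2 * pi) ^ DIM('a)) * ip f g"
    by (rule complex_eqI) (simp_all only: re[OF g] im times_complex.sel Re_complex_of_real Im_complex_of_real mult_zero_left diff_zero add_0_right)
  then show ?thesis by simp
qed

text \<open>For truncations this is Fubini; the bilinear pairing is continuous in L^2, so the radius
  can tend to infinity on both sides.\<close>

lemma ft_multiplication:
  assumes f: "l2 f" and g: "l2 g"
  shows "(LINT x|lborel. ft f x * g x) = (LINT x|lborel. f x * ft g x)"
proof -
  have tr: "(LINT x|lborel. ft1 (trunc R f) x * trunc R g x) = (LINT x|lborel. trunc R f x * ft1 (trunc R g) x)" for R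
  proof -
    note [measurable] = l2_measurable[OF f] l2_measurable[OF g]
    have "(LINT x|lborel. ft1 (trunc R f) x * trunc R g x) = (LINT x|lborel. LINT y|lborel. trunc R g x * trunc R f y * cis (- (y \<bullet> x)))"
      unfolding ft1_def by (simp add: mult_ac flip: integral_mult_right_zero)
    also have "\<dots> = (LINT y|lborel. LINT x|lborel. trunc R g x * trunc R f y * cis (- (y \<bullet> x)))"
      by (intro Fubini_bounded_kernel[where C=1] integrable_trunc f g) auto
    also have "\<dots> = (LINT x|lborel. trunc R f x * ft1 (trunc R g) x)"
      unfolding ft1_def by (simp add: mult_ac inner_commute flip: integral_mult_right_zero)
    finally show ?thesis .
  qed
  have lim: "((\<lambda>R. LINT x|lborel. F R x * G R x) \<longlongrightarrow> (LINT x|lborel. u x * v x)) at_top"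
    if F: "\<And>R::real. l2 (F R)" and G: "\<And>R. l2 (G R)" and u: "l2 u" and v: "l2 v" and
     Fu: "((\<lambda>R. sqn (\<lambda>x. F R x - u x)) \<longlongrightarrow> 0) at_top" and Gv: "((\<lambda>R. sqn (\<lambda>x. G R x - v x)) \<longlongrightarrow> 0) at_top"
   for F G and u v :: "'a \<Rightarrow> complex"
  proof -
    have Gs: "((\<lambda>R. sqn (G R)) \<longlongrightarrow> sqn v) at_top" by (rule sqn_tendsto[OF G v Gv])
    have "((\<lambda>R. (LINT x|lborel. F R x * G R x) - (LINT x|lborel. u x * v x)) \<longlongrightarrow> 0) at_top"
    proof (rule Lim_null_comparison)
      have "((\<lambda>R. sqrt (sqn (\<lambda>x. F R x - u x) * sqn (G R)) + sqrt (sqn u * sqn (\<lambda>x. G R x - v x))) \<longlongrightarrow> sqrt (0 * sqn v) + sqrt (sqn u * 0)) at_top"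
        by (intro tendsto_intros Fu Gv Gs)
      then show "((\<lambda>R. sqrt (sqn (\<lambda>x. F R x - u x) * sqn (G R)) + sqrt (sqn u * sqn (\<lambda>x. G R x - v x))) \<longlongrightarrow> 0) at_top" by simp
      show "\<forall>\<^sub>F R in at_top. norm ((LINT x|lborel. F R x * G R x) - (LINT x|lborel. u x * v x))
         \<le> sqrt (sqn (\<lambda>x. F R x - u x) * sqn (G R)) + sqrt (sqn u * sqn (\<lambda>x. G R x - v x))"
      proof (rule always_eventually, rule allI)
        fix R
        have "(LINT x|lborel. F R x * G R x) - (LINT x|lborel. u x * v x) = ip (\<lambda>x. F R x - u x) (\<lambda>x. cnj (G R x)) + ip u (\<lambda>x. cnj (G R x - v x))"
          unfolding ip_def by (simp add: l2_mult_integrable F G u v left_diff_distrib right_diff_distrib)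
        also have "cmod \<dots> \<le> cmod (ip (\<lambda>x. F R x - u x) (\<lambda>x. cnj (G R x))) + cmod (ip u (\<lambda>x. cnj (G R x - v x)))"
          by (rule norm_triangle_ineq)
        also have "\<dots> \<le> sqrt (sqn (\<lambda>x. F R x - u x) * sqn (G R)) + sqrt (sqn u * sqn (\<lambda>x. G R x - v x))"
          using ip_bound[OF l2_diff(1)[OF F u] l2_cnj[OF G], of R R] ip_bound[OF u l2_cnj[OF l2_diff(1)[OF G v]], of R]
          by (intro add_mono real_le_rsqrt) (simp_all only: sqn_cnj)
        finally show "norm ((LINT x|lborel. F R x * G R x) - (LINT x|lborel. u x * v x))
         \<le> sqrt (sqn (\<lambda>x. F R x - u x) * sqn (G R)) + sqrt (sqn u * sqn (\<lambda>x. G R x - v x))" .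
      qed
    qed
    then show ?thesis by (simp add: LIM_zero_iff)
  qed
  have tru: "((\<lambda>R. sqn (\<lambda>x. trunc R u x - u x)) \<longlongrightarrow> 0) at_top" if "l2 u" for u :: "'a \<Rightarrow> complex"
    using sqn_trunc_tendsto[OF that] by (simp add: sqn_minus_commute[of u])
  show ?thesis
  proof (rule tendsto_unique[OF trivial_limit_at_top_linorder])
    show "((\<lambda>R. LINT x|lborel. ft1 (trunc R f) x * trunc R g x) \<longlongrightarrow> (LINT x|lborel. ft f x * g x)) at_top"
      by (intro lim l2_ft1_trunc l2_trunc l2_ft f g ft_limit tru)
    show "((\<lambda>R. LINT x|lborel. ft1 (trunc R f) x * trunc R g x) \<longlongrightarrow> (LINT x|lborel. f x * ft g x)) at_top"
      unfolding tr by (intro lim l2_ft1_trunc l2_trunc l2_ft f g ft_limit tru)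
  qed
qed

text \<open>The candidate for the inverse transform is a conjugated forward transform divided by (2
  pi)^n. The multiplication formula gives \<open>ip (ft h) g\<close> = \<open>sqn g\<close>, and
  \<open>sqn (ft h)\<close> has the same value, so the square of the difference expands to 0; no
  inversion formula enters.\<close>

theorem ft_surj:
  fixes g :: "'a::euclidean_space \<Rightarrow> complex"
  assumes g: "l2 g"
  obtains h where "l2 h" "AE \<xi> in lborel. ft h \<xi> = g \<xi>"
proof -
  define \<kappa> where "\<kappa> = (2 * pi :: real) ^ DIM('a)"
  have \<kappa>: "\<kappa> > 0" by (simp add: \<kappa>_def)
  let ?G = "ft (\<lambda>x. cnj (g x))"
  have G: "l2 ?G" by (intro l2_ft l2_cnj g)
  define h where "h x = complex_of_real (1 / \<kappa>) * cnj (?G x)" for x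
  have h: "l2 h" unfolding h_def by (intro l2_cmult l2_cnj G)
  have sG: "sqn ?G = \<kappa> * sqn g" by (simp add: plancherel l2_cnj g sqn_cnj \<kappa>_def)
  have sh: "sqn h = sqn g / \<kappa>"
    unfolding h_def sqn_cmult sqn_cnj sG using \<kappa> by (simp add: norm_divide power2_eq_square)
  have "ip (ft h) g = (LINT x|lborel. ft h x * cnj (g x))" by (simp add: ip_def)
  also have "\<dots> = (LINT x|lborel. h x * ?G x)" by (rule ft_multiplication[OF h l2_cnj[OF g]])
  also have "\<dots> = (LINT x|lborel. complex_of_real \<kappa> * (h x * cnj (h x)))"
    using \<kappa> by (simp add: h_def field_simps)
  also have "\<dots> = complex_of_real \<kappa> * ip h h" by (simp add: ip_def)
  also have "\<dots> = complex_of_real (sqn g)" unfolding ip_self sh using \<kappa> by simp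
  finally have "sqn (\<lambda>x. ft h x - g x) = 0"
    unfolding sqn_diff_expand[OF l2_ft[OF h] g] plancherel[OF h] \<kappa>_def[symmetric] sh using \<kappa> by simp
  from sqn_eq_0_AE[OF l2_diff(1)[OF l2_ft[OF h] g] this] h show ?thesis by (intro that) auto
qed

lemma ft_shift:
  fixes f :: "'a::euclidean_space \<Rightarrow> complex"
  assumes f: "l2 f"
  shows "AE \<xi> in lborel. ft (\<lambda>x. f (x + h)) \<xi> = cis (h \<bullet> \<xi>) * ft f \<xi>"
proof -
  note [measurable] = l2_measurable[OF f]
  let ?f = "\<lambda>x. f (x + h)"
  define F where "F R x = trunc R f (x + h)" for R x
  have F: "l2 (F R)" "integrable lborel (F R)" for R
    unfolding F_def using integrable_trunc[OF f] by (auto intro!: l2_shift l2_trunc f simp: integrable_shift)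
  have eq: "sqn (\<lambda>x. F R x - ?f x) = sqn (\<lambda>x. f x - trunc R f x)" for R
    unfolding F_def using sqn_shift[of "\<lambda>x. trunc R f x - f x" h] by (simp add: sqn_minus_commute[of f])
  show ?thesis
  proof (rule l2_limit_unique_AE[where F="\<lambda>R. ft (F R)"])
    show "l2 (\<lambda>\<xi>. cis (h \<bullet> \<xi>) * ft f \<xi>)" by (intro l2_bounded_mult1 l2_ft f) auto
    show "((\<lambda>R. sqn (\<lambda>\<xi>. ft (F R) \<xi> - ft ?f \<xi>)) \<longlongrightarrow> 0) at_top"
      unfolding sqn_ft_diff[OF F(1) l2_shift[OF f]] eq
      using tendsto_mult_right_zero[OF sqn_trunc_tendsto[OF f], of "(2 * pi) ^ DIM('a)"] .
    have "sqn (\<lambda>\<xi>. ft (F R) \<xi> - cis (h \<bullet> \<xi>) * ft f \<xi>) = sqn (\<lambda>\<xi>. ft1 (trunc R f) \<xi> - ft f \<xi>)" for R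
    proof -
      have "sqn (\<lambda>\<xi>. ft (F R) \<xi> - cis (h \<bullet> \<xi>) * ft f \<xi>) = sqn (\<lambda>\<xi>. cis (h \<bullet> \<xi>) * (ft1 (trunc R f) \<xi> - ft f \<xi>))"
      proof (rule sqn_cong_AE)
        have [measurable]: "ft f \<in> borel_measurable borel" "ft (F R) \<in> borel_measurable borel" 
          using f F(1) by (auto intro: l2_measurable)
        show "(\<lambda>\<xi>. ft (F R) \<xi> - cis (h \<bullet> \<xi>) * ft f \<xi>) \<in> borel_measurable borel"
          "(\<lambda>\<xi>. cis (h \<bullet> \<xi>) * (ft1 (trunc R f) \<xi> - ft f \<xi>)) \<in> borel_measurable borel" by measurable
        have "ft1 (F R) \<xi> = cis (h \<bullet> \<xi>) * ft1 (trunc R f) \<xi>" for \<xi>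
          unfolding F_def by (rule ft1_shift) measurable
        then show "AE \<xi> in lborel. ft (F R) \<xi> - cis (h \<bullet> \<xi>) * ft f \<xi> = cis (h \<bullet> \<xi>) * (ft1 (trunc R f) \<xi> - ft f \<xi>)"
          using ft_eq_ft1[OF F, of R] by (auto simp: right_diff_distrib)
      qed
      then show ?thesis by (simp add: sqn_unimodular)
    qed
    then show "((\<lambda>R. sqn (\<lambda>\<xi>. ft (F R) \<xi> - cis (h \<bullet> \<xi>) * ft f \<xi>)) \<longlongrightarrow> 0) at_top"
      using ft_limit[OF f] by simp
  qed (intro l2_ft F l2_shift f)+
qed

section \<open>Sobolev norms through dyadic differences\<close>

definition jw :: "real \<Rightarrow> 'a::euclidean_space \<Rightarrow> real" where
  "jw a \<xi> = (1 + (norm \<xi>)\<^sup>2) powr a"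

definition ha :: "real \<Rightarrow> ('a::euclidean_space \<Rightarrow> complex) \<Rightarrow> bool" where
  "ha a f \<longleftrightarrow> l2 f \<and> integrable lborel (\<lambda>\<xi>. jw a \<xi> * (cmod (ft f \<xi>))\<^sup>2)"

definition hn :: "real \<Rightarrow> ('a::euclidean_space \<Rightarrow> complex) \<Rightarrow> real" where
  "hn a f = (LINT \<xi>|lborel. jw a \<xi> * (cmod (ft f \<xi>))\<^sup>2)"

text \<open>For 0 < a < 1 the H^a norm is equivalent to the sum of the squared difference quotients over all
  scales 2^{-k}. At a = 1 that sum diverges, and a single scale k = K with K tending to infinity replaces it.\<close>

definition ks :: "real \<Rightarrow> nat \<Rightarrow> nat set" where
  "ks a K = (if a = 0 then {} else if a < 1 then {..K} else {K})"

text \<open>The factor h^(-a) of a difference quotient with step h = 2^(-k).\<close>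

definition cf :: "real \<Rightarrow> nat \<Rightarrow> real" where
  "cf a k = (2 powr a) ^ k"

definition dq :: "real \<Rightarrow> nat \<Rightarrow> 'a::euclidean_space \<Rightarrow> ('a \<Rightarrow> complex) \<Rightarrow> 'a \<Rightarrow> complex" where
  "dq a k b f x = complex_of_real (cf a k) * (f (x + (1/2) ^ k *\<^sub>R b) - f x)"

text \<open>Finitely many scales keep \<open>ws a K f\<close> meaningful for every square-integrable
  f; belonging to H^a then amounts to boundedness in K.\<close>

definition ws :: "real \<Rightarrow> nat \<Rightarrow> ('a::euclidean_space \<Rightarrow> complex) \<Rightarrow> real" where
  "ws a K f = sqn f + (\<Sum>b\<in>Basis. \<Sum>k\<in>ks a K. sqn (dq a k b f))"

text \<open>The Fourier multiplier of \<open>ws\<close>: integrated against |ft f|^2 it gives (2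
  pi)^n \<open>ws a K f\<close>. Norm equivalence thus reduces to comparing it with
  \<open>jw a\<close>.\<close>

definition sy :: "real \<Rightarrow> nat \<Rightarrow> 'a::euclidean_space \<Rightarrow> real" where
  "sy a K \<xi> = 1 + (\<Sum>b\<in>Basis. \<Sum>k\<in>ks a K. (cf a k)\<^sup>2 * (cmod (cis ((1/2) ^ k * (\<xi> \<bullet> b)) - 1))\<^sup>2)"

section \<open>Comparison of the dyadic symbol with the Sobolev weight\<close>

lemma finite_ks [simp]: "finite (ks a K)" by (simp add: ks_def)

lemma jw_measurable [measurable]: "jw a \<in> borel_measurable borel"
  unfolding jw_def[abs_def] by measurable

lemma jw_pos: "0 < jw a \<xi>" unfolding jw_def
  by (smt (verit) powr_gt_zero zero_le_power2)

lemma jw_ge_1: "0 \<le> a \<Longrightarrow> 1 \<le> jw a \<xi>"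
  unfolding jw_def by (rule ge_one_powr_ge_zero) auto

lemma cf_sq: "(cf a k)\<^sup>2 = (4 powr a) ^ k"
proof -
  have "(4::real) powr a = 2 powr a * 2 powr a" using powr_mult[of 2 2 a] by simp
  then show ?thesis by (simp add: cf_def power_mult_distrib power2_eq_square)
qed

lemma cf_nonneg [simp]: "0 \<le> cf a k" by (simp add: cf_def)

lemma cmod_cis_minus_1: "(cmod (cis x - 1))\<^sup>2 = 4 * (sin (x / 2))\<^sup>2"
proof -
  have "(cmod (cis x - 1))\<^sup>2 = (cos x - 1)\<^sup>2 + (sin x)\<^sup>2" by (simp add: cmod_power2)
  also have "\<dots> = 2 - 2 * cos x"
    using sin_cos_squared_add[of x] by (simp add: power2_eq_square algebra_simps)
  also have "cos x = 1 - 2 * (sin (x / 2))\<^sup>2" using cos_double_sin[of "x / 2"] by simp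
  finally show ?thesis by simp
qed

lemma cmod_cis_minus_1_le: "(cmod (cis x - 1))\<^sup>2 \<le> 4 * min 1 (x\<^sup>2)"
proof -
  have "(sin (x / 2))\<^sup>2 \<le> 1" by (simp add: abs_square_le_1)
  moreover have "(sin (x / 2))\<^sup>2 \<le> (x / 2)\<^sup>2" using abs_sin_x_le_abs_x[of "x / 2"] by (simp only: abs_le_square_iff)
  moreover have "(x / 2)\<^sup>2 \<le> x\<^sup>2" by (simp add: power_divide)
  ultimately show ?thesis by (simp add: cmod_cis_minus_1)
qed

lemma sin_ge_half:
  assumes "0 \<le> y" "y \<le> 1" shows "y / 2 \<le> sin (y::real)"
proof -
  have "(\<lambda>y. sin y - y / 2) 0 \<le> (\<lambda>y. sin y - y / 2) y"
  proof (rule DERIV_nonneg_imp_nondecreasing[OF assms(1)], intro exI conjI)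
    fix x :: real assume x: "0 \<le> x" "x \<le> y"
    show "((\<lambda>y. sin y - y / 2) has_real_derivative cos x - 1 / 2) (at x)"
      by (auto intro!: derivative_eq_intros)
    have "cos (pi / 3) \<le> cos x" using x assms pi_gt3 by (intro cos_monotone_0_pi_le) auto
    then show "0 \<le> cos x - 1 / 2" by (simp add: cos_60)
  qed
  then show ?thesis by simp
qed

lemma cmod_cis_minus_1_ge:
  assumes "\<bar>x\<bar> \<le> 2" shows "x\<^sup>2 / 4 \<le> (cmod (cis x - 1))\<^sup>2"
proof -
  have "\<bar>x / 2\<bar> / 2 \<le> sin \<bar>x / 2\<bar>" using assms by (intro sin_ge_half) auto
  moreover have "\<bar>sin (x / 2)\<bar> = \<bar>sin \<bar>x / 2\<bar>\<bar>" by (cases "x \<ge> 0") auto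
  ultimately have "\<bar>x / 4\<bar> \<le> \<bar>sin (x / 2)\<bar>" by simp
  then have "(x / 4)\<^sup>2 \<le> (sin (x / 2))\<^sup>2" by (simp only: abs_le_square_iff)
  then show ?thesis by (simp add: cmod_cis_minus_1 power_divide)
qed

lemma half_pow_sq: "((1/2) ^ k)\<^sup>2 = (1/4::real) ^ k"
  by (simp add: power2_eq_square flip: power_mult_distrib)

text \<open>Halving \<theta> shifts the scales by one, so T(K+1, \<theta>) = min(1, \<theta>^2) + q
  T(K, \<theta>/2). For |\<theta>| \<le> 1 the sum is geometric with ratio q/4, below 1 because a <
  1; larger \<theta> are halved until they fall into that range.\<close>

lemma dyadic_sum_upper:
  fixes a :: real
  assumes a: "0 < a" "a < 1"
  obtains D where "D > 0" "\<And>K \<theta>. (\<Sum>k\<le>K. (4 powr a) ^ k * min 1 (((1/2) ^ k * \<theta>)\<^sup>2)) \<le> D * (1 + \<theta>\<^sup>2) powr a"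
proof -
  define q where "q = 4 powr a"
  have q1: "q > 1" unfolding q_def using a by (intro gr_one_powr) auto
  have "4 powr a < 4 powr 1" using a by (intro powr_less_mono) auto
  then have q4: "q < 4" by (simp add: q_def)
  define S where "S = 1 / (1 - q / 4)"
  have S: "S > 0" using q4 by (simp add: S_def)
  \<comment> \<open>The induction for |\<theta>| > 1 would lose 1 at each halving. Subtracting
    \<open>E\<close> from the bound absorbs the loss, since q E = E + 1; \<open>D\<close> is chosen
    so that 1 + q S + E fits when the halving ends.\<close>
  define E where "E = 1 / (q - 1)"
  define D where "D = 1 + q * S + E"
  have E: "E > 0" "q * E = E + 1" using q1 by (auto simp: E_def field_simps)
  have D: "D > 0" "D \<ge> S" using q1 S E by (auto simp: D_def intro!: add_pos_pos)
     (smt (verit) mult_left_le_one_le mult_le_cancel_right1)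
  define T where "T K \<theta> = (\<Sum>k\<le>K. q ^ k * min 1 (((1/2) ^ k * \<theta>)\<^sup>2))" for K \<theta>
  have Ts: "T (Suc K) \<theta> = min 1 (\<theta>\<^sup>2) + q * T K (\<theta> / 2)" for K \<theta>
    unfolding T_def by (subst sum.atMost_Suc_shift) (simp add: sum_distrib_left mult_ac)
  have small: "T K \<theta> \<le> S" if "\<bar>\<theta>\<bar> \<le> 1" for K \<theta>
  proof -
    have t: "\<theta>\<^sup>2 \<le> 1" using that by (simp add: abs_square_le_1)
    have "T K \<theta> \<le> (\<Sum>k\<le>K. (q / 4) ^ k)" unfolding T_def
    proof (rule sum_mono)
      fix k
      have "min 1 (((1/2) ^ k * \<theta>)\<^sup>2) \<le> (1/4) ^ k * \<theta>\<^sup>2"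
        by (simp add: power_mult_distrib half_pow_sq)
      also have "\<dots> \<le> (1/4) ^ k" using t by (simp add: mult_left_le)
      finally have "q ^ k * min 1 (((1/2) ^ k * \<theta>)\<^sup>2) \<le> q ^ k * (1/4) ^ k"
        using q1 by (intro mult_left_mono) auto
      then show "q ^ k * min 1 (((1/2) ^ k * \<theta>)\<^sup>2) \<le> (q / 4) ^ k" by (simp add: power_divide)
    qed
    also have "\<dots> = (1 - (q / 4) ^ Suc K) / (1 - q / 4)"
      using q4 by (subst sum_gp0) auto
    also have "\<dots> \<le> S" unfolding S_def using q4 q1 by (intro divide_right_mono) auto
    finally show ?thesis .
  qed
  have big: "T K \<theta> \<le> D * (\<theta>\<^sup>2) powr a - E" if "\<bar>\<theta>\<bar> > 1" for K \<theta>
    using that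
  proof (induction K arbitrary: \<theta>)
    case 0
    then have "1 \<le> \<theta>\<^sup>2" using abs_le_square_iff[of 1 \<theta>] by simp
    then have "1 \<le> (\<theta>\<^sup>2) powr a" using a by (intro ge_one_powr_ge_zero) auto
    then have "D * 1 \<le> D * (\<theta>\<^sup>2) powr a" using D by (intro mult_left_mono) auto
    moreover have "T 0 \<theta> \<le> 1" by (simp add: T_def)
    moreover have "1 + E \<le> D" using q1 S by (simp add: D_def)
    ultimately show ?case by linarith
  next
    case (Suc K)
    have p1: "1 \<le> \<theta>\<^sup>2" using Suc.prems abs_le_square_iff[of 1 \<theta>] by simp
    then have p: "1 \<le> (\<theta>\<^sup>2) powr a" using a by (intro ge_one_powr_ge_zero) auto
    have m: "T (Suc K) \<theta> \<le> 1 + q * T K (\<theta> / 2)" unfolding Ts by simp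
    show ?case
    proof (cases "\<bar>\<theta> / 2\<bar> > 1")
      case True
      have "(\<theta> / 2)\<^sup>2 powr a = (\<theta>\<^sup>2) powr a / q"
        unfolding q_def by (simp add: power_divide powr_divide)
      then have "q * T K (\<theta> / 2) \<le> q * (D * ((\<theta>\<^sup>2) powr a / q) - E)"
        using Suc.IH[OF True] q1 by (intro mult_left_mono) auto
      also have "\<dots> = D * (\<theta>\<^sup>2) powr a - (E + 1)"
        using q1 E(2) by (simp add: right_diff_distrib)
      finally show ?thesis using m by linarith
    next
      case False
      then have "q * T K (\<theta> / 2) \<le> q * S" using q1 by (intro mult_left_mono small) auto
      moreover have "D * 1 \<le> D * (\<theta>\<^sup>2) powr a" using D p by (intro mult_left_mono) auto
      ultimately show ?thesis using m by (simp add: D_def)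
    qed
  qed
  have "T K \<theta> \<le> D * (1 + \<theta>\<^sup>2) powr a" for K \<theta>
  proof (cases "\<bar>\<theta>\<bar> > 1")
    case True
    have "(\<theta>\<^sup>2) powr a \<le> (1 + \<theta>\<^sup>2) powr a" using a by (intro powr_mono2) auto
    then have "D * (\<theta>\<^sup>2) powr a \<le> D * (1 + \<theta>\<^sup>2) powr a" using D by (intro mult_left_mono) auto
    with big[OF True, of K] E show ?thesis by linarith
  next
    case False
    have "1 \<le> (1 + \<theta>\<^sup>2) powr a" using a by (intro ge_one_powr_ge_zero) auto
    then have "D * 1 \<le> D * (1 + \<theta>\<^sup>2) powr a" using D by (intro mult_left_mono) auto
    with small[of \<theta> K] False D show ?thesis by linarith
  qed
  with D(1) show ?thesis by (intro that[of D]) (auto simp: T_def q_def)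
qed

text \<open>Coordinates are treated separately, which leaves a one-dimensional symbol. At a = 1 the
  factor 4^K cancels the squared step of the single scale, so the bound 4 \<theta>^2 is independent
  of K.\<close>

lemma sy_upper:
  assumes a: "0 \<le> a" "a \<le> 1"
  obtains C where "C > 0" "\<And>K (\<xi>::'a::euclidean_space). sy a K \<xi> \<le> C * jw a \<xi>"
proof -
  have "\<exists>D>0. \<forall>K \<theta>. (\<Sum>k\<in>ks a K. (cf a k)\<^sup>2 * (cmod (cis ((1/2) ^ k * \<theta>) - 1))\<^sup>2) \<le> D * (1 + \<theta>\<^sup>2) powr a"
  proof -
    consider "a = 0" | "0 < a" "a < 1" | "a = 1" using a by linarith
    then show ?thesis
    proof cases
      case 1
      then show ?thesis by (intro exI[of _ 1]) (auto simp: ks_def)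
    next
      case 2
      obtain D where D: "D > 0"
        "\<And>K \<theta>. (\<Sum>k\<le>K. (4 powr a) ^ k * min 1 (((1/2) ^ k * \<theta>)\<^sup>2)) \<le> D * (1 + \<theta>\<^sup>2) powr a"
        by (rule dyadic_sum_upper[OF 2]) blast
      have "(\<Sum>k\<in>ks a K. (cf a k)\<^sup>2 * (cmod (cis ((1/2) ^ k * \<theta>) - 1))\<^sup>2) \<le> 4 * D * (1 + \<theta>\<^sup>2) powr a" for K \<theta>
      proof -
        have "(\<Sum>k\<in>ks a K. (cf a k)\<^sup>2 * (cmod (cis ((1/2) ^ k * \<theta>) - 1))\<^sup>2)
          \<le> (\<Sum>k\<le>K. (4 powr a) ^ k * (4 * min 1 (((1/2) ^ k * \<theta>)\<^sup>2)))"
          using 2 unfolding ks_def cf_sq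
          by (auto intro!: sum_mono mult_left_mono cmod_cis_minus_1_le)
        also have "\<dots> = 4 * (\<Sum>k\<le>K. (4 powr a) ^ k * min 1 (((1/2) ^ k * \<theta>)\<^sup>2))"
          by (simp add: sum_distrib_left mult_ac)
        also have "\<dots> \<le> 4 * (D * (1 + \<theta>\<^sup>2) powr a)" by (intro mult_left_mono D) auto
        finally show ?thesis by simp
      qed
      with D(1) show ?thesis by (intro exI[of _ "4 * D"]) auto
    next
      case 3
      have "(\<Sum>k\<in>ks a K. (cf a k)\<^sup>2 * (cmod (cis ((1/2) ^ k * \<theta>) - 1))\<^sup>2) \<le> 4 * (1 + \<theta>\<^sup>2) powr a" for K \<theta>
      proof -
        have "(\<Sum>k\<in>ks a K. (cf a k)\<^sup>2 * (cmod (cis ((1/2) ^ k * \<theta>) - 1))\<^sup>2)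
           = 4 ^ K * (cmod (cis ((1/2) ^ K * \<theta>) - 1))\<^sup>2"
          using 3 by (simp add: ks_def cf_sq)
        also have "\<dots> \<le> 4 ^ K * (4 * ((1/2) ^ K * \<theta>)\<^sup>2)"
          using cmod_cis_minus_1_le[of "(1/2) ^ K * \<theta>"] by (intro mult_left_mono) auto
        also have "\<dots> = 4 * \<theta>\<^sup>2"
        proof -
          have "(4::real) ^ K * ((1/2) ^ K)\<^sup>2 = 1" by (simp add: power_one_over power2_eq_square flip: power_mult_distrib)
          then show ?thesis by (simp add: power_mult_distrib mult.assoc[symmetric])
        qed
        also have "\<dots> \<le> 4 * (1 + \<theta>\<^sup>2) powr a" using 3 by (simp add: add_nonneg_nonneg)
        finally show ?thesis .
      qed
      then show ?thesis by (intro exI[of _ 4]) auto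
    qed
  qed
  then obtain D where D: "D > 0" "\<And>K \<theta>. (\<Sum>k\<in>ks a K. (cf a k)\<^sup>2 * (cmod (cis ((1/2) ^ k * \<theta>) - 1))\<^sup>2) \<le> D * (1 + \<theta>\<^sup>2) powr a"
    by blast
  have "sy a K \<xi> \<le> (1 + DIM('a) * D) * jw a \<xi>" for K and \<xi> :: 'a
  proof -
    have "(\<Sum>b\<in>Basis. \<Sum>k\<in>ks a K. (cf a k)\<^sup>2 * (cmod (cis ((1/2) ^ k * (\<xi> \<bullet> b)) - 1))\<^sup>2) \<le> (\<Sum>b\<in>(Basis::'a set). D * jw a \<xi>)"
    proof (rule sum_mono)
      fix b :: 'a assume b: "b \<in> Basis"
      have "(\<xi> \<bullet> b)\<^sup>2 \<le> (norm \<xi>)\<^sup>2" using Basis_le_norm[OF b, of \<xi>] by (metis power_mono abs_ge_zero power2_abs)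
      then have "(1 + (\<xi> \<bullet> b)\<^sup>2) powr a \<le> jw a \<xi>" unfolding jw_def using a by (intro powr_mono2) auto
      then have "D * (1 + (\<xi> \<bullet> b)\<^sup>2) powr a \<le> D * jw a \<xi>" using D(1) by (intro mult_left_mono) auto
      with D(2)[where K=K and \<theta>="\<xi> \<bullet> b"] show "(\<Sum>k\<in>ks a K. (cf a k)\<^sup>2 * (cmod (cis ((1/2) ^ k * (\<xi> \<bullet> b)) - 1))\<^sup>2) \<le> D * jw a \<xi>" by linarith
    qed
    then show ?thesis using jw_ge_1[OF a(1), of \<xi>] by (simp add: sy_def algebra_simps)
  qed
  moreover have "1 + DIM('a) * D > 0" using D by (simp add: add_pos_nonneg)
  ultimately show ?thesis by (rule that[rotated])
qed

lemma powr_add_le: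
  fixes x y :: real
  assumes "0 \<le> x" "0 \<le> y" "0 \<le> a" "a \<le> 1"
  shows "(x + y) powr a \<le> x powr a + y powr a"
proof (cases "x = 0 \<or> y = 0")
  case False
  then have xy: "x > 0" "y > 0" using assms by auto
  have "(x + y) powr a = (x + y) * (x + y) powr (a - 1)"
    using xy by (simp add: powr_mult_base)
  also have "\<dots> = x * (x + y) powr (a - 1) + y * (x + y) powr (a - 1)" by (simp add: distrib_right)
  also have "\<dots> \<le> x * x powr (a - 1) + y * y powr (a - 1)"
    using xy assms by (intro add_mono mult_left_mono powr_mono2') auto
  also have "\<dots> = x powr a + y powr a" using xy by (simp add: powr_mult_base)
  finally show ?thesis .
qed auto

lemma powr_sum_le:
  fixes f :: "'i \<Rightarrow> real"
  assumes "finite A" "\<And>i. i \<in> A \<Longrightarrow> 0 \<le> f i" "0 \<le> a" "a \<le> 1"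
  shows "(\<Sum>i\<in>A. f i) powr a \<le> (\<Sum>i\<in>A. f i powr a)"
  using assms(1,2)
proof (induction A rule: finite_induct)
  case (insert i A)
  then have "(f i + sum f A) powr a \<le> f i powr a + (sum f A) powr a"
    using assms by (intro powr_add_le) (auto intro!: sum_nonneg)
  with insert show ?case by auto
qed simp

text \<open>One scale adapted to the frequency already carries the weight. It belongs to the sum
  only from some K on, which depends on \<xi>, hence the eventual form. For a < 1 the factor 16 is 4
  from |cis x - 1|^2 \<ge> 1/4 times 4 from 4^a \<le> 4.\<close>

lemma sy_lower:
  assumes a: "0 \<le> a" "a \<le> 1"
  obtains c where "c > 0" "\<And>\<xi>::'a::euclidean_space. eventually (\<lambda>K. c * jw a \<xi> \<le> sy a K \<xi>) sequentially"
proof -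
  let ?S = "\<lambda>K \<theta>. \<Sum>k\<in>ks a K. (cf a k)\<^sup>2 * (cmod (cis ((1/2) ^ k * \<theta>) - 1))\<^sup>2"
  have S0: "0 \<le> ?S K \<theta>" for K \<theta> by (intro sum_nonneg) auto
  have one: "eventually (\<lambda>K. (\<theta>\<^sup>2) powr a \<le> 1 + 16 * ?S K \<theta>) sequentially" for \<theta> :: real
  proof (cases "a = 0 \<or> \<bar>\<theta>\<bar> < 1")
    case True
    then have "(\<theta>\<^sup>2) powr a \<le> 1"
    proof
      assume "\<bar>\<theta>\<bar> < 1"
      then have "\<theta>\<^sup>2 \<le> 1" by (simp add: abs_square_le_1)
      then have "(\<theta>\<^sup>2) powr a \<le> 1 powr a" using a by (intro powr_mono2) auto
      then show ?thesis by simp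
    qed auto
    then have "(\<theta>\<^sup>2) powr a \<le> 1 + 16 * ?S K \<theta>" for K using S0[of \<theta> K] by linarith
    then show ?thesis by simp
  next
    case False
    then have \<theta>: "1 \<le> \<bar>\<theta>\<bar>" and a0: "a > 0" using a by auto
    \<comment> \<open>The dyadic size of \<theta>: |\<theta>| / 2^k lies between 1 and 2, inside the
      range where \<open>cmod_cis_minus_1_ge\<close> applies.\<close>
    define k where "k = (LEAST k. \<bar>\<theta>\<bar> < 2 ^ Suc k)"
    obtain n where "\<bar>\<theta>\<bar> < 2 ^ n" using real_arch_pow[of 2 "\<bar>\<theta>\<bar>"] by auto
    also have "2 ^ n \<le> (2::real) ^ Suc n" by simp
    finally have ex: "\<exists>k. \<bar>\<theta>\<bar> < 2 ^ Suc k" by blast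
    then have k1: "\<bar>\<theta>\<bar> < 2 ^ Suc k" unfolding k_def by (rule LeastI_ex)
    have k2: "2 ^ k \<le> \<bar>\<theta>\<bar>"
    proof (cases k)
      case (Suc j)
      then have "\<not> \<bar>\<theta>\<bar> < 2 ^ Suc j" unfolding k_def using not_less_Least by (metis lessI)
      then show ?thesis using Suc by simp
    qed (use \<theta> in simp)
    show ?thesis
    proof (cases "a < 1")
      case True
      have "(\<theta>\<^sup>2) powr a \<le> 1 + 16 * ?S K \<theta>" if K: "K \<ge> k" for K
      proof -
        let ?x = "(1/2) ^ k * \<theta>"
        have x: "1 \<le> \<bar>?x\<bar>" "\<bar>?x\<bar> \<le> 2" using k1 k2 by (auto simp: abs_mult power_one_over field_simps)
        then have "1 \<le> ?x\<^sup>2" by (metis one_le_power power2_abs)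
        then have "1 / 4 \<le> (cmod (cis ?x - 1))\<^sup>2" using cmod_cis_minus_1_ge[OF x(2)] by linarith
        then have "(4 powr a) ^ k * (1 / 4) \<le> (cf a k)\<^sup>2 * (cmod (cis ?x - 1))\<^sup>2"
          unfolding cf_sq by (intro mult_left_mono) auto
        also have "\<dots> \<le> ?S K \<theta>" using K a0 True by (intro member_le_sum) (auto simp: ks_def)
        finally have *: "(4 powr a) ^ k \<le> 4 * ?S K \<theta>" by simp
        have "\<theta>\<^sup>2 \<le> (2 ^ Suc k)\<^sup>2" using k1 by (metis abs_ge_zero less_imp_le power2_abs power_mono)
        also have "(2 ^ Suc k)\<^sup>2 = (4::real) ^ Suc k" by (simp add: power2_eq_square flip: power_mult_distrib)
        finally have "(\<theta>\<^sup>2) powr a \<le> (4 ^ Suc k) powr a" using a by (intro powr_mono2) auto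
        also have "\<dots> = 4 powr a * (4 powr a) ^ k" by (simp add: powr_power powr_mult powr_powr flip: powr_realpow) (simp add: powr_powr mult.commute)
        also have "\<dots> \<le> 4 * (4 powr a) ^ k" using True powr_mono[of a 1 4] by (intro mult_right_mono) auto
        also have "\<dots> \<le> 16 * ?S K \<theta>" using * by simp
        finally show ?thesis by simp
      qed
      then show ?thesis by (auto simp: eventually_sequentially)
    next
      case False
      then have a1: "a = 1" using a by simp
      have "(\<theta>\<^sup>2) powr a \<le> 1 + 16 * ?S K \<theta>" if K: "K \<ge> k" for K
      proof -
        let ?x = "(1/2) ^ K * \<theta>"
        have "\<bar>\<theta>\<bar> \<le> 2 ^ Suc K" using K by (intro order_trans[OF less_imp_le[OF k1] power_increasing]) auto
        then have x: "\<bar>?x\<bar> \<le> 2" by (auto simp: abs_mult power_one_over field_simps)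
        have "?S K \<theta> = 4 ^ K * (cmod (cis ?x - 1))\<^sup>2" using a1 by (simp add: ks_def cf_sq)
        moreover have "4 ^ K * (?x\<^sup>2 / 4) \<le> 4 ^ K * (cmod (cis ?x - 1))\<^sup>2"
          by (intro mult_left_mono cmod_cis_minus_1_ge x) auto
        moreover have "4 ^ K * (?x\<^sup>2 / 4) = \<theta>\<^sup>2 / 4"
        proof -
          have "(4::real) ^ K * ((1/2) ^ K)\<^sup>2 = 1" by (simp add: power_one_over power2_eq_square flip: power_mult_distrib)
          then show ?thesis by (simp add: power_mult_distrib mult.assoc[symmetric])
        qed
        ultimately have "\<theta>\<^sup>2 \<le> 4 * ?S K \<theta>" by linarith
        then show ?thesis using a1 S0[of \<theta> K] by simp
      qed
      then show ?thesis by (auto simp: eventually_sequentially)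
    qed
  qed
  have "eventually (\<lambda>K. 1 / (16 * (1 + real DIM('a))) * jw a \<xi> \<le> sy a K \<xi>) sequentially" for \<xi> :: 'a
  proof -
    have "eventually (\<lambda>K. \<forall>b\<in>(Basis::'a set). ((\<xi> \<bullet> b)\<^sup>2) powr a \<le> 1 + 16 * ?S K (\<xi> \<bullet> b)) sequentially"
      by (intro eventually_ball_finite) (auto intro: one)
    then show ?thesis
    proof eventually_elim
      case (elim K)
      have "jw a \<xi> \<le> 1 powr a + ((norm \<xi>)\<^sup>2) powr a" unfolding jw_def using a by (intro powr_add_le) auto
      also have "((norm \<xi>)\<^sup>2) powr a \<le> (\<Sum>b\<in>Basis. ((\<xi> \<bullet> b)\<^sup>2) powr a)"
        unfolding norm_sq_Basis using a by (intro powr_sum_le) auto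
      also have "\<dots> \<le> (\<Sum>b\<in>(Basis::'a set). 1 + 16 * ?S K (\<xi> \<bullet> b))" using elim by (intro sum_mono) auto
      also have "\<dots> = DIM('a) + 16 * (sy a K \<xi> - 1)" by (simp add: sy_def sum.distrib sum_distrib_left)
      finally have j: "jw a \<xi> \<le> 1 + (DIM('a) + 16 * (sy a K \<xi> - 1))" by simp
      have "1 \<le> sy a K \<xi>" unfolding sy_def by (simp add: sum_nonneg)
      have "jw a \<xi> \<le> 16 * (1 + n) * t" if "jw a \<xi> \<le> 1 + (n + 16 * (t - 1))" "1 \<le> t" "0 \<le> n" for n t :: real
      proof -
        have "16 * (1 + n) * t = (1 + (n + 16 * (t - 1))) + (15 + 15 * n + 16 * (n * (t - 1)))"
          by (simp add: algebra_simps)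
        moreover have "0 \<le> 15 + 15 * n + 16 * (n * (t - 1))"
          using that by (intro add_nonneg_nonneg mult_nonneg_nonneg) auto
        ultimately show ?thesis using that(1) by (metis add_increasing2)
      qed
      from this[OF j \<open>1 \<le> sy a K \<xi>\<close>] have "jw a \<xi> \<le> 16 * (1 + real DIM('a)) * sy a K \<xi>" by simp
      then show ?case by (simp add: field_simps)
    qed
  qed
  then show ?thesis by (intro that[of "1 / (16 * (1 + real DIM('a)))"]) auto
qed

lemma l2_dq: "l2 f \<Longrightarrow> l2 (dq a k b f)"
  unfolding dq_def[abs_def] by (intro l2_cmult l2_diff l2_shift)

lemma dq_measurable [measurable]:
  assumes [measurable]: "f \<in> borel_measurable borel"
  shows "dq a k b f \<in> borel_measurable borel"
  unfolding dq_def[abs_def] by measurable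

lemma ft_dq:
  assumes f: "l2 f"
  shows "AE \<xi> in lborel. ft (dq a k b f) \<xi> = complex_of_real (cf a k) * (cis ((1/2) ^ k * (\<xi> \<bullet> b)) - 1) * ft f \<xi>"
proof -
  let ?s = "\<lambda>x. f (x + (1/2) ^ k *\<^sub>R b)"
  have "AE \<xi> in lborel. ft (dq a k b f) \<xi> = complex_of_real (cf a k) * ft (\<lambda>x. ?s x - f x) \<xi>"
    unfolding dq_def[abs_def] by (intro ft_cmult l2_diff l2_shift f)
  moreover have "AE \<xi> in lborel. ft (\<lambda>x. ?s x - f x) \<xi> = ft ?s \<xi> - ft f \<xi>"
    by (intro ft_diff l2_shift f)
  moreover have "AE \<xi> in lborel. ft ?s \<xi> = cis (((1/2) ^ k *\<^sub>R b) \<bullet> \<xi>) * ft f \<xi>"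
    by (intro ft_shift f)
  ultimately show ?thesis
    by eventually_elim (simp add: algebra_simps inner_commute[of b])
qed

lemma sqn_dq:
  fixes f :: "'a::euclidean_space \<Rightarrow> complex"
  assumes f: "l2 f"
  shows "integrable lborel (\<lambda>\<xi>. (cf a k)\<^sup>2 * (cmod (cis ((1/2) ^ k * (\<xi> \<bullet> b)) - 1))\<^sup>2 * (cmod (ft f \<xi>))\<^sup>2)"
    "(2 * pi) ^ DIM('a) * sqn (dq a k b f) = (LINT \<xi>|lborel. (cf a k)\<^sup>2 * (cmod (cis ((1/2) ^ k * (\<xi> \<bullet> b)) - 1))\<^sup>2 * (cmod (ft f \<xi>))\<^sup>2)"
proof -
  let ?g = "\<lambda>\<xi>. complex_of_real (cf a k) * (cis ((1/2) ^ k * (\<xi> \<bullet> b)) - 1) * ft f \<xi>"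
  note [measurable] = l2_measurable[OF l2_ft[OF f]] l2_measurable[OF l2_ft[OF l2_dq[OF f]]]
  have sq: "(cmod (?g \<xi>))\<^sup>2 = (cf a k)\<^sup>2 * (cmod (cis ((1/2) ^ k * (\<xi> \<bullet> b)) - 1))\<^sup>2 * (cmod (ft f \<xi>))\<^sup>2" for \<xi>
    by (simp add: norm_mult power_mult_distrib)
  have "l2 ?g" by (rule l2_cong_AE[OF _ l2_ft[OF l2_dq[OF f, of a k b]]]) (use ft_dq[OF f, of a k b] in auto)
  from l2_integrable[OF this] show "integrable lborel (\<lambda>\<xi>. (cf a k)\<^sup>2 * (cmod (cis ((1/2) ^ k * (\<xi> \<bullet> b)) - 1))\<^sup>2 * (cmod (ft f \<xi>))\<^sup>2)"
    unfolding sq .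
  have "sqn (ft (dq a k b f)) = sqn ?g"
    by (rule sqn_cong_AE) (use ft_dq[OF f, of a k b] in auto)
  then show "(2 * pi) ^ DIM('a) * sqn (dq a k b f) = (LINT \<xi>|lborel. (cf a k)\<^sup>2 * (cmod (cis ((1/2) ^ k * (\<xi> \<bullet> b)) - 1))\<^sup>2 * (cmod (ft f \<xi>))\<^sup>2)"
    unfolding plancherel[OF l2_dq[OF f]] by (simp only: sqn_def sq)
qed

lemma ws_fourier:
  fixes f :: "'a::euclidean_space \<Rightarrow> complex"
  assumes f: "l2 f"
  shows "integrable lborel (\<lambda>\<xi>. sy a K \<xi> * (cmod (ft f \<xi>))\<^sup>2)"
    "(2 * pi) ^ DIM('a) * ws a K f = (LINT \<xi>|lborel. sy a K \<xi> * (cmod (ft f \<xi>))\<^sup>2)"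
proof -
  let ?t = "\<lambda>b k \<xi>. (cf a k)\<^sup>2 * (cmod (cis ((1/2) ^ k * (\<xi> \<bullet> b)) - 1))\<^sup>2 * (cmod (ft f \<xi>))\<^sup>2"
  have eq: "sy a K \<xi> * (cmod (ft f \<xi>))\<^sup>2 = (cmod (ft f \<xi>))\<^sup>2 + (\<Sum>b\<in>Basis. \<Sum>k\<in>ks a K. ?t b k \<xi>)" for \<xi>
    by (simp add: sy_def distrib_right sum_distrib_right)
  note i1 = l2_integrable[OF l2_ft[OF f]] and i2 = sqn_dq(1)[OF f, of a]
  show "integrable lborel (\<lambda>\<xi>. sy a K \<xi> * (cmod (ft f \<xi>))\<^sup>2)"
    unfolding eq by (intro Bochner_Integration.integrable_add Bochner_Integration.integrable_sum i1 i2)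
  have "(LINT \<xi>|lborel. sy a K \<xi> * (cmod (ft f \<xi>))\<^sup>2) = sqn (ft f) + (\<Sum>b\<in>Basis. \<Sum>k\<in>ks a K. LINT \<xi>|lborel. ?t b k \<xi>)"
    unfolding eq sqn_def
    by (subst Bochner_Integration.integral_add[OF i1]) (simp_all only: Bochner_Integration.integral_sum Bochner_Integration.integrable_sum i2)
  then show "(2 * pi) ^ DIM('a) * ws a K f = (LINT \<xi>|lborel. sy a K \<xi> * (cmod (ft f \<xi>))\<^sup>2)"
    by (simp only: ws_def distrib_left sum_distrib_left plancherel[OF f] sqn_dq(2)[OF f])
qed

lemma ha_l2: "ha a f \<Longrightarrow> l2 f" by (simp add: ha_def)

lemma hn_nonneg [simp]: "0 \<le> hn a f"
  unfolding hn_def by (intro integral_nonneg_AE) (auto simp: less_imp_le[OF jw_pos])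

lemma ws_le_hn:
  assumes a: "0 \<le> a" "a \<le> 1"
  obtains C where "C > 0" "\<And>(f::'a::euclidean_space \<Rightarrow> complex) K. ha a f \<Longrightarrow> ws a K f \<le> C * hn a f"
proof -
  obtain C where C: "C > 0" "\<And>K (\<xi>::'a). sy a K \<xi> \<le> C * jw a \<xi>" by (rule sy_upper[OF a]) blast
  define \<kappa> where "\<kappa> = (2 * pi :: real) ^ DIM('a)"
  have \<kappa>: "\<kappa> > 0" by (simp add: \<kappa>_def)
  have "ws a K f \<le> C / \<kappa> * hn a f" if f: "ha a f" for K and f :: "'a \<Rightarrow> complex"
  proof -
    have "\<kappa> * ws a K f = (LINT \<xi>|lborel. sy a K \<xi> * (cmod (ft f \<xi>))\<^sup>2)"
      unfolding \<kappa>_def by (rule ws_fourier[OF ha_l2[OF f]])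
    also have "\<dots> \<le> (LINT \<xi>|lborel. C * (jw a \<xi> * (cmod (ft f \<xi>))\<^sup>2))"
    proof (rule integral_mono)
      show "sy a K \<xi> * (cmod (ft f \<xi>))\<^sup>2 \<le> C * (jw a \<xi> * (cmod (ft f \<xi>))\<^sup>2)" for \<xi>
        unfolding mult.assoc[symmetric] by (intro mult_right_mono C) auto
    qed (use f in \<open>auto simp: ha_def intro!: ws_fourier\<close>)
    also have "\<dots> = C * hn a f" by (simp add: hn_def)
    finally show ?thesis using \<kappa> by (simp add: field_simps)
  qed
  then show ?thesis using C(1) \<kappa> by (intro that[of "C / \<kappa>"]) auto
qed

text \<open>The lower bound on the symbol starts at a K that depends on the frequency. The minimum
  of \<open>c * jw a\<close> and \<open>sy a K\<close> is controlled for every K and eventually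
  equals \<open>c * jw a\<close> at each frequency, so Fatou applies.\<close>

lemma ha_of_ws:
  assumes a: "0 \<le> a" "a \<le> 1"
  obtains C where "C > 0" "\<And>(f::'a::euclidean_space \<Rightarrow> complex) B. l2 f \<Longrightarrow> (\<And>K. ws a K f \<le> B) \<Longrightarrow> ha a f \<and> hn a f \<le> C * B"
proof -
  obtain c where c: "c > 0" "\<And>\<xi>::'a. eventually (\<lambda>K. c * jw a \<xi> \<le> sy a K \<xi>) sequentially"
    by (rule sy_lower[OF a]) blast
  define \<kappa> where "\<kappa> = (2 * pi :: real) ^ DIM('a)"
  have \<kappa>: "\<kappa> > 0" by (simp add: \<kappa>_def)
  have "ha a f \<and> hn a f \<le> \<kappa> / c * B" if f: "l2 f" and B: "\<And>K. ws a K f \<le> B" for B and f :: "'a \<Rightarrow> complex"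
  proof -
    note [measurable] = l2_measurable[OF l2_ft[OF f]]
    have [measurable]: "sy a K \<in> borel_measurable borel" for K :: nat
      unfolding sy_def[abs_def] by measurable
    define F where "F K \<xi> = min (c * jw a \<xi>) (sy a K \<xi>) * (cmod (ft f \<xi>))\<^sup>2" for K \<xi>
    have [measurable]: "F K \<in> borel_measurable borel" for K unfolding F_def by measurable
    have sy0: "0 \<le> sy a K \<xi>" for K and \<xi> :: 'a unfolding sy_def by (intro add_nonneg_nonneg sum_nonneg) auto
    have F0: "0 \<le> F K \<xi>" for K \<xi> unfolding F_def using sy0[of K \<xi>] jw_pos[of a \<xi>] c(1) by auto
    have Fle: "F K \<xi> \<le> sy a K \<xi> * (cmod (ft f \<xi>))\<^sup>2" for K \<xi>
      unfolding F_def by (intro mult_right_mono) auto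
    have iF: "integrable lborel (F K)" for K
      by (rule Bochner_Integration.integrable_bound[OF ws_fourier(1)[OF f, of a K]])
         (use F0 Fle sy0 in auto)
    have bF: "(LINT \<xi>|lborel. F K \<xi>) \<le> \<kappa> * B" for K
    proof -
      have "(LINT \<xi>|lborel. F K \<xi>) \<le> (LINT \<xi>|lborel. sy a K \<xi> * (cmod (ft f \<xi>))\<^sup>2)"
        by (intro integral_mono iF ws_fourier f Fle)
      also have "\<dots> = \<kappa> * ws a K f" unfolding \<kappa>_def ws_fourier(2)[OF f] ..
      also have "\<dots> \<le> \<kappa> * B" using \<kappa> B by (intro mult_left_mono) auto
      finally show ?thesis .
    qed
    have lim: "AE \<xi> in lborel. (\<lambda>K. F K \<xi>) \<longlonglongrightarrow> c * jw a \<xi> * (cmod (ft f \<xi>))\<^sup>2"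
    proof (intro AE_I2 tendsto_eventually)
      fix \<xi>
      show "\<forall>\<^sub>F K in sequentially. F K \<xi> = c * jw a \<xi> * (cmod (ft f \<xi>))\<^sup>2"
        using c(2)[of \<xi>] by eventually_elim (simp add: F_def min_def)
    qed
    have i: "integrable lborel (\<lambda>\<xi>. c * jw a \<xi> * (cmod (ft f \<xi>))\<^sup>2)"
      and b: "(LINT \<xi>|lborel. c * jw a \<xi> * (cmod (ft f \<xi>))\<^sup>2) \<le> \<kappa> * B"
      by (rule Fatou_real[OF iF F0 bF _ lim], measurable)+
    have "integrable lborel (\<lambda>\<xi>. (1 / c) * (c * jw a \<xi> * (cmod (ft f \<xi>))\<^sup>2))"
      by (rule integrable_mult_right[OF i])
    then have "ha a f" using f c(1) by (simp add: ha_def)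
    moreover have "c * hn a f \<le> \<kappa> * B" using b by (simp add: hn_def mult.assoc)
    ultimately show ?thesis using c(1) by (simp add: field_simps)
  qed
  then show ?thesis using c(1) \<kappa> by (intro that[of "\<kappa> / c"]) auto
qed

section \<open>Leibniz rule for cutoffs and tails of difference quotients\<close>

lemma ks_sum_bound:
  assumes a: "0 \<le> a" "a \<le> 1"
  obtains S where "S > 0" "\<And>K. (\<Sum>k\<in>ks a K. (cf a k)\<^sup>2 * ((1/2) ^ k)\<^sup>2) \<le> S"
proof -
  \<comment> \<open>This is the squared cost of a difference quotient falling on a factor with
    Lipschitz constant 1. The ratio 4^a / 4 is below 1 for a < 1; at a = 1 it equals 1, but only one
    scale is summed.\<close>
  have e: "(cf a k)\<^sup>2 * ((1/2) ^ k)\<^sup>2 = (4 powr a / 4) ^ k" for k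
    unfolding cf_sq by (simp add: power_divide power2_eq_square flip: power_mult_distrib)
  consider "a = 0" | "0 < a" "a < 1" | "a = 1" using a by linarith
  then show ?thesis
  proof cases
    case 1 then show ?thesis by (intro that[of 1]) (auto simp: ks_def)
  next
    case 2
    have "4 powr a < 4 powr 1" using 2 by (intro powr_less_mono) auto
    then have r: "0 < 4 powr a / 4" "4 powr a / 4 < 1" by auto
    have "(\<Sum>k\<in>ks a K. (4 powr a / 4) ^ k) \<le> 1 / (1 - 4 powr a / 4)" for K
    proof -
      have "(\<Sum>k\<in>ks a K. (4 powr a / 4) ^ k) = (1 - (4 powr a / 4) ^ Suc K) / (1 - 4 powr a / 4)"
        using 2 r by (simp add: ks_def sum_gp0)
      also have "\<dots> \<le> 1 / (1 - 4 powr a / 4)" using r by (intro divide_right_mono) auto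
      finally show ?thesis .
    qed
    then show ?thesis unfolding e[symmetric] using r by (intro that[of "1 / (1 - 4 powr a / 4)"]) auto
  next
    case 3 then show ?thesis by (intro that[of 1]) (unfold e, auto simp: ks_def)
  qed
qed

text \<open>The difference falls either on f, with the factor m evaluated at the shifted point, or
  on m, where it is at most L times the step. The shifted argument stays in the statement so that
  the support of m can still localise the first term.\<close>

lemma dq_mult_bound:
  fixes m f :: "'a::euclidean_space \<Rightarrow> complex"
  assumes f: "l2 f" and [measurable]: "m \<in> borel_measurable borel" and m1: "\<And>x. cmod (m x) \<le> 1"
    and L: "\<And>x y. cmod (m x - m y) \<le> L * norm (x - y)" and b: "b \<in> Basis"
  shows "sqn (dq a k b (\<lambda>x. m x * f x)) \<le> 2 * sqn (\<lambda>x. m (x + (1/2) ^ k *\<^sub>R b) * dq a k b f x)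
     + 2 * (L\<^sup>2 * ((cf a k)\<^sup>2 * ((1/2) ^ k)\<^sup>2) * sqn f)"
proof -
  note [measurable] = l2_measurable[OF f]
  let ?h = "(1/2) ^ k *\<^sub>R b"
  have nh: "norm ?h = (1/2) ^ k" using b by simp
  let ?u = "\<lambda>x. m (x + ?h) * dq a k b f x"
  let ?v = "\<lambda>x. (complex_of_real (cf a k) * (m (x + ?h) - m x)) * f x"
  have eq: "dq a k b (\<lambda>x. m x * f x) = (\<lambda>x. ?u x + ?v x)"
    by (auto simp: dq_def algebra_simps)
  have u: "l2 ?u" by (intro l2_bounded_mult1 l2_dq f m1) measurable
  have vb: "cmod (complex_of_real (cf a k) * (m (x + ?h) - m x)) \<le> cf a k * (L * (1/2) ^ k)" for x
    using L[of "x + ?h" x] nh by (simp add: norm_mult mult_left_mono)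
  have v: "l2 ?v" "sqn ?v \<le> (cf a k * (L * (1/2) ^ k))\<^sup>2 * sqn f"
    by (rule l2_bounded_mult[OF f _ vb], measurable)+
  have "sqn (dq a k b (\<lambda>x. m x * f x)) \<le> 2 * sqn ?u + 2 * sqn ?v"
    unfolding eq by (rule l2_add[OF u v(1)])
  with v(2) show ?thesis by (simp add: power_mult_distrib mult_ac)
qed

text \<open>Tails must be small uniformly in K, so they are reduced to finitely many scales. For a <
  1 the norms of the quotients are summable over the scales. At a = 1 they are not, but the
  quotients are Cauchy in L^2, so all fine scales lie close to the scale k0.\<close>

lemma dq_tail_finite:
  fixes f :: "'a::euclidean_space \<Rightarrow> complex"
  assumes a: "0 \<le> a" "a \<le> 1" and f: "ha a f" and e: "0 < e" and b: "b \<in> Basis"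
  shows "\<exists>k0. \<forall>K r. (\<Sum>k\<in>ks a K. sqn (\<lambda>x. dq a k b f x - trunc r (dq a k b f) x))
     \<le> e + 2 * (\<Sum>k\<le>k0. sqn (\<lambda>x. dq a k b f x - trunc r (dq a k b f) x))"
proof -
  note fl = ha_l2[OF f]
  note [measurable] = l2_measurable[OF l2_ft[OF fl]]
  let ?D = "\<lambda>k. dq a k b f"
  let ?t = "\<lambda>r k. sqn (\<lambda>x. ?D k x - trunc r (?D k) x)"
  have D: "l2 (?D k)" for k by (rule l2_dq[OF fl])
  have red: "(\<lambda>x. u x - trunc r u x) = (\<lambda>x. indicator (- ball 0 r) x * u x)" for r and u :: "'a \<Rightarrow> complex"
    by (auto simp: trunc_def indicator_def)
  have trl: "l2 (\<lambda>x. u x - trunc r u x)" "sqn (\<lambda>x. u x - trunc r u x) \<le> sqn u" if "l2 u" for r and u :: "'a \<Rightarrow> complex"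
    unfolding red by (rule l2_bounded_mult1[OF that]; auto simp: indicator_def)+
  consider "a = 0" | "0 < a" "a < 1" | "a = 1" using a by linarith
  then show ?thesis
  proof cases
    case 1
    then show ?thesis using e by (auto simp: ks_def intro!: exI[of _ 0] add_nonneg_nonneg)
  next
    case 2
    obtain C where C: "C > 0" "\<And>(f::'a \<Rightarrow> complex) K. ha a f \<Longrightarrow> ws a K f \<le> C * hn a f"
      by (rule ws_le_hn[OF a]) blast
    have ksK: "ks a K = {..K}" for K using 2 by (simp add: ks_def)
    have bd: "(\<Sum>k\<le>K. sqn (?D k)) \<le> C * hn a f" for K
    proof -
      have "(\<Sum>k\<le>K. sqn (?D k)) \<le> (\<Sum>b\<in>Basis. \<Sum>k\<in>ks a K. sqn (dq a k b f))"
        unfolding ksK by (rule member_le_sum[OF b]) (auto intro!: sum_nonneg)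
      also have "\<dots> \<le> ws a K f" by (simp add: ws_def)
      finally show ?thesis using C(2)[OF f, of K] by linarith
    qed
    have "summable (\<lambda>k. sqn (?D k))"
      by (rule bounded_imp_summable[OF _ bd]) simp
    from summable_partial_sum_bound[OF this e] obtain k0 where k0: "\<And>m n. m \<ge> k0 \<Longrightarrow> norm (\<Sum>k=m..n. sqn (?D k)) < e"
      by blast
    have "(\<Sum>k\<in>ks a K. ?t r k) \<le> e + 2 * (\<Sum>k\<le>k0. ?t r k)" for K r
    proof -
      have nn: "0 \<le> (\<Sum>k\<le>k0. ?t r k)" by (intro sum_nonneg) simp
      have "(\<Sum>k\<le>K. ?t r k) \<le> (\<Sum>k\<in>{..k0} \<union> {k0..K}. ?t r k)" by (intro sum_mono2) auto
      also have "\<dots> \<le> (\<Sum>k\<le>k0. ?t r k) + (\<Sum>k=k0..K. ?t r k)"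
        by (subst sum.union_inter[symmetric]) (auto intro!: sum_nonneg)
      also have "(\<Sum>k=k0..K. ?t r k) \<le> (\<Sum>k=k0..K. sqn (?D k))" by (intro sum_mono trl D)
      also have "\<dots> \<le> e" using k0[of k0 K] by simp
      finally show ?thesis unfolding ksK using nn by linarith
    qed
    then show ?thesis by blast
  next
    case 3
    define \<kappa> where "\<kappa> = (2 * pi :: real) ^ DIM('a)"
    have \<kappa>: "\<kappa> > 0" by (simp add: \<kappa>_def)
    define m where "m k \<xi> = complex_of_real (cf a k) * (cis ((1/2) ^ k * (\<xi> \<bullet> b)) - 1)" for k and \<xi> :: 'a
    have [measurable]: "m k \<in> borel_measurable borel" for k unfolding m_def by measurable
    have cf2: "cf a k = 2 ^ k" for k using 3 by (simp add: cf_def)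
    have mb: "(cmod (m k \<xi>))\<^sup>2 \<le> 4 * (\<xi> \<bullet> b)\<^sup>2" for k \<xi>
    proof -
      have "(cmod (m k \<xi>))\<^sup>2 = (2 ^ k)\<^sup>2 * (cmod (cis ((1/2) ^ k * (\<xi> \<bullet> b)) - 1))\<^sup>2"
        by (simp add: m_def norm_mult power_mult_distrib cf2 norm_power)
      also have "\<dots> \<le> (2 ^ k)\<^sup>2 * (4 * ((1/2) ^ k * (\<xi> \<bullet> b))\<^sup>2)"
        using cmod_cis_minus_1_le[of "(1/2) ^ k * (\<xi> \<bullet> b)"] by (intro mult_left_mono) auto
      also have "\<dots> = 4 * (\<xi> \<bullet> b)\<^sup>2"
        by (simp add: power_mult_distrib power_one_over field_simps)
      finally show ?thesis .
    qed
    \<comment> \<open>The limit multiplier is that of the partial derivative along b; the rate is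
      the second-order Taylor error of the exponential times the factor 2^k.\<close>
    have ml: "(\<lambda>k. m k \<xi>) \<longlonglongrightarrow> \<i> * (\<xi> \<bullet> b)" for \<xi>
    proof -
      have "(\<lambda>k. m k \<xi> - \<i> * (\<xi> \<bullet> b)) \<longlonglongrightarrow> 0"
      proof (rule Lim_null_comparison)
        show "(\<lambda>k. (\<xi> \<bullet> b)\<^sup>2 * (1/2) ^ k) \<longlonglongrightarrow> 0"
          by (intro tendsto_mult_right_zero LIMSEQ_power_zero) simp
        show "\<forall>\<^sub>F k in sequentially. norm (m k \<xi> - \<i> * (\<xi> \<bullet> b)) \<le> (\<xi> \<bullet> b)\<^sup>2 * (1/2) ^ k"
        proof (rule always_eventually, rule allI)
          fix k
          let ?x = "(1/2) ^ k * (\<xi> \<bullet> b)"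
          have "cmod (cis ?x - 1 - \<i> * ?x) \<le> ?x\<^sup>2 / 2"
            using iexp_approx1[of ?x 1] by (simp add: cis_conv_exp numeral_2_eq_2 diff_diff_eq)
          then have "2 ^ k * cmod (cis ?x - 1 - \<i> * ?x) \<le> 2 ^ k * (?x\<^sup>2 / 2)" by (intro mult_left_mono) auto
          moreover have "m k \<xi> - \<i> * (\<xi> \<bullet> b) = complex_of_real (2 ^ k) * (cis ?x - 1 - \<i> * ?x)"
            by (simp add: m_def cf2 right_diff_distrib power_one_over)
          then have "cmod (m k \<xi> - \<i> * (\<xi> \<bullet> b)) = 2 ^ k * cmod (cis ?x - 1 - \<i> * ?x)"
            by (simp add: norm_mult norm_power)
          moreover have "2 ^ k * (?x\<^sup>2 / 2) \<le> (\<xi> \<bullet> b)\<^sup>2 * (1/2) ^ k"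
            by (simp add: power_mult_distrib power_one_over power2_eq_square field_simps)
          ultimately show "norm (m k \<xi> - \<i> * (\<xi> \<bullet> b)) \<le> (\<xi> \<bullet> b)\<^sup>2 * (1/2) ^ k" by linarith
        qed
      qed
      then show ?thesis by (simp add: LIM_zero_iff)
    qed
    define G where "G k \<xi> = (m k \<xi> - \<i> * (\<xi> \<bullet> b)) * ft f \<xi>" for k \<xi>
    have [measurable]: "G k \<in> borel_measurable borel" for k unfolding G_def by measurable
    have iw: "integrable lborel (\<lambda>\<xi>. 10 * (jw a \<xi> * (cmod (ft f \<xi>))\<^sup>2))" using f by (simp add: ha_def)
    \<comment> \<open>10 = 2 * 4 + 2 * 1: the factor 4 comes from \<open>mb\<close>, the factor 1
      from the limit multiplier. The majorant is integrable because f lies in H^1.\<close>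
    have Gle: "(cmod (G k \<xi>))\<^sup>2 \<le> 10 * (jw a \<xi> * (cmod (ft f \<xi>))\<^sup>2)" for k \<xi>
    proof -
      have "(\<xi> \<bullet> b)\<^sup>2 \<le> (norm \<xi>)\<^sup>2" using Basis_le_norm[OF b, of \<xi>] by (metis power_mono abs_ge_zero power2_abs)
      also have "\<dots> \<le> jw a \<xi>" using 3 by (simp add: jw_def add_nonneg_nonneg)
      finally have j: "(\<xi> \<bullet> b)\<^sup>2 \<le> jw a \<xi>" .
      have "(cmod (m k \<xi> - \<i> * (\<xi> \<bullet> b)))\<^sup>2 \<le> 2 * (cmod (m k \<xi>))\<^sup>2 + 2 * (cmod (\<i> * (\<xi> \<bullet> b)))\<^sup>2" by (rule norm_diff_sq_le)
      also have "\<dots> \<le> 10 * jw a \<xi>" using mb[of k \<xi>] j by (simp add: norm_mult)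
      finally have "(cmod (m k \<xi> - \<i> * (\<xi> \<bullet> b)))\<^sup>2 * (cmod (ft f \<xi>))\<^sup>2 \<le> 10 * jw a \<xi> * (cmod (ft f \<xi>))\<^sup>2"
        by (intro mult_right_mono) auto
      then show ?thesis by (simp add: G_def norm_mult power_mult_distrib)
    qed
    have G: "l2 (G k)" for k
      unfolding l2_def using order_trans[OF Gle[of k] abs_ge_self] by (auto intro!: Bochner_Integration.integrable_bound[OF iw] AE_I2)
    have "(\<lambda>k. sqn (G k)) \<longlonglongrightarrow> 0"
    proof (rule sqn_tendsto_0_dominated[OF _ iw Gle])
      show "AE \<xi> in lborel. (\<lambda>k. G k \<xi>) \<longlonglongrightarrow> 0"
        unfolding G_def using ml by (intro AE_I2 tendsto_mult_left_zero) (simp add: LIM_zero_iff)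
    qed measurable
    \<comment> \<open>Two such terms, each doubled, give \<kappa> e / 2 for the transforms and e / 2
      for the quotients; a further doubling below uses up the allowance e.\<close>
    then have "eventually (\<lambda>k. sqn (G k) < \<kappa> * e / 8) sequentially"
      by (rule order_tendstoD) (use e \<kappa> in simp)
    then obtain k0 where k0: "\<And>k. k \<ge> k0 \<Longrightarrow> sqn (G k) < \<kappa> * e / 8" by (auto simp: eventually_sequentially)
    have dd: "sqn (\<lambda>x. ?D k x - ?D k0 x) \<le> e / 2" if k: "k \<ge> k0" for k
    proof -
      have "\<kappa> * sqn (\<lambda>x. ?D k x - ?D k0 x) = sqn (\<lambda>\<xi>. ft (?D k) \<xi> - ft (?D k0) \<xi>)"
        unfolding \<kappa>_def by (rule sqn_ft_diff[OF D D, symmetric])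
      also have "\<dots> = sqn (\<lambda>\<xi>. G k \<xi> - G k0 \<xi>)"
      proof (rule sqn_cong_AE)
        show "AE \<xi> in lborel. ft (?D k) \<xi> - ft (?D k0) \<xi> = G k \<xi> - G k0 \<xi>"
          using ft_dq[OF fl, of a k b] ft_dq[OF fl, of a k0 b]
          by eventually_elim (simp add: G_def m_def left_diff_distrib)
        show "(\<lambda>\<xi>. ft (?D k) \<xi> - ft (?D k0) \<xi>) \<in> borel_measurable borel"
          by (intro l2_measurable l2_diff l2_ft D)
      qed measurable
      also have "\<dots> \<le> 2 * sqn (G k) + 2 * sqn (G k0)" by (rule l2_diff[OF G G])
      also have "\<dots> \<le> \<kappa> * (e / 2)" using k0[OF k] k0[of k0] by simp
      finally show ?thesis using \<kappa> by simp
    qed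
    have "(\<Sum>k\<in>ks a K. ?t r k) \<le> e + 2 * (\<Sum>k\<le>k0. ?t r k)" for K r
    proof -
      have nn: "0 \<le> (\<Sum>k\<le>k0. ?t r k)" by (intro sum_nonneg) simp
      have S: "(\<Sum>k\<in>ks a K. ?t r k) = ?t r K" using 3 by (simp add: ks_def)
      show ?thesis
      proof (cases "K \<le> k0")
        case True
        then have "?t r K \<le> (\<Sum>k\<le>k0. ?t r k)" by (intro member_le_sum) auto
        then show ?thesis unfolding S using nn e by linarith
      next
        case False
        let ?E = "\<lambda>x. ?D K x - ?D k0 x"
        have E: "l2 ?E" by (intro l2_diff D)
        have "(\<lambda>x. ?D K x - trunc r (?D K) x) = (\<lambda>x. (?E x - trunc r ?E x) + (?D k0 x - trunc r (?D k0) x))"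
          by (auto simp: trunc_def)
        then have "?t r K \<le> 2 * sqn (\<lambda>x. ?E x - trunc r ?E x) + 2 * ?t r k0"
          using l2_add(2)[OF trl(1)[OF E, of r] trl(1)[OF D[of k0], of r]] by simp
        also have "sqn (\<lambda>x. ?E x - trunc r ?E x) \<le> e / 2" using trl(2)[OF E, of r] dd[of K] False by simp
        also have "?t r k0 \<le> (\<Sum>k\<le>k0. ?t r k)" by (intro member_le_sum) auto
        finally show ?thesis unfolding S by simp
      qed
    qed
    then show ?thesis by blast
  qed
qed

text \<open>One radius works for all K. This is what allows the cutoff error to be bounded in
  \<open>ws\<close> for every K and then in H^a by \<open>ha_of_ws\<close>.\<close>

lemma dq_tail:
  fixes f :: "'a::euclidean_space \<Rightarrow> complex"
  assumes a: "0 \<le> a" "a \<le> 1" and f: "ha a f" and e: "0 < e"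
  shows "eventually (\<lambda>r. \<forall>K. (\<Sum>b\<in>Basis. \<Sum>k\<in>ks a K. sqn (\<lambda>x. dq a k b f x - trunc r (dq a k b f) x)) \<le> e) at_top"
proof -
  define e' where "e' = e / (2 * DIM('a))"
  have e': "e' > 0" using e by (simp add: e'_def)
  let ?t = "\<lambda>r k b. sqn (\<lambda>x. dq a k b f x - trunc r (dq a k b f) x)"
  have "eventually (\<lambda>r. \<forall>b\<in>(Basis::'a set). \<forall>K. (\<Sum>k\<in>ks a K. ?t r k b) \<le> 2 * e') at_top"
  proof (intro eventually_ball_finite ballI)
    fix b :: 'a assume b: "b \<in> Basis"
    from dq_tail_finite[OF a f e' b] obtain k0 where k0: "\<And>K r. (\<Sum>k\<in>ks a K. ?t r k b) \<le> e' + 2 * (\<Sum>k\<le>k0. ?t r k b)"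
      by blast
    have "((\<lambda>r. 2 * (\<Sum>k\<le>k0. ?t r k b)) \<longlongrightarrow> 2 * (\<Sum>k\<le>k0. 0)) at_top"
      by (intro tendsto_mult_left tendsto_sum sqn_trunc_tendsto l2_dq ha_l2[OF f])
    then have "eventually (\<lambda>r. 2 * (\<Sum>k\<le>k0. ?t r k b) < e') at_top"
      by (rule order_tendstoD) (use e' in simp)
    then show "eventually (\<lambda>r. \<forall>K. (\<Sum>k\<in>ks a K. ?t r k b) \<le> 2 * e') at_top"
    proof eventually_elim
      case (elim r)
      show ?case
      proof
        fix K show "(\<Sum>k\<in>ks a K. ?t r k b) \<le> 2 * e'" using k0[where K=K and r=r] elim by linarith
      qed
    qed
  qed simp
  then show ?thesis
  proof eventually_elim
    case (elim r)
    have "(\<Sum>b\<in>Basis. \<Sum>k\<in>ks a K. ?t r k b) \<le> (\<Sum>b\<in>(Basis::'a set). 2 * e')" for K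
      using elim by (intro sum_mono) auto
    also have "(\<Sum>b\<in>(Basis::'a set). 2 * e') = e" by (simp add: e'_def)
    finally show ?case by blast
  qed
qed

section \<open>The interaction picture\<close>

text \<open>One formula for the identity (c = 1, h = 0, d = 0) and for difference quotients (d = 1),
  so that a single duality estimate covers a mixed family of both.\<close>

definition op2 :: "real \<Rightarrow> 'a::euclidean_space \<Rightarrow> real \<Rightarrow> ('a \<Rightarrow> complex) \<Rightarrow> 'a \<Rightarrow> complex" where
  "op2 c h d f x = complex_of_real c * (f (x + h) - complex_of_real d * f x)"

lemma dq_eq_op2: "dq a k b = op2 (cf a k) ((1/2) ^ k *\<^sub>R b) 1"
  by (simp add: dq_def op2_def fun_eq_iff)

lemma op2_measurable [measurable]:
  assumes [measurable]: "f \<in> borel_measurable borel"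
  shows "op2 c h d f \<in> borel_measurable borel"
  unfolding op2_def[abs_def] by measurable

lemma l2_op2: "l2 f \<Longrightarrow> l2 (op2 c h d f)"
  unfolding op2_def[abs_def] by (intro l2_cmult l2_diff l2_shift)

lemma integrable_op2:
  assumes f: "integrable lborel f" shows "integrable lborel (op2 c h d f)"
proof -
  have [measurable]: "f \<in> borel_measurable borel" using f by auto
  show ?thesis unfolding op2_def[abs_def]
    using f by (intro integrable_mult_right Bochner_Integration.integrable_diff) (simp_all add: integrable_shift)
qed

lemma ft1_op2:
  assumes f: "integrable lborel f"
  shows "ft1 (op2 c h d f) \<xi> = complex_of_real c * (cis (h \<bullet> \<xi>) - complex_of_real d) * ft1 f \<xi>"
proof -
  have [measurable]: "f \<in> borel_measurable borel" using f by auto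
  have i: "integrable lborel (\<lambda>x. f (x + h))" using f by (simp add: integrable_shift)
  show ?thesis unfolding op2_def[abs_def] ft1_cmult
    by (subst ft1_diff) (simp_all add: i f ft1_shift ft1_cmult algebra_simps)
qed

lemma ft_op2:
  assumes f: "l2 f"
  shows "AE \<xi> in lborel. ft (op2 c h d f) \<xi> = complex_of_real c * (cis (h \<bullet> \<xi>) - complex_of_real d) * ft f \<xi>"
proof -
  let ?s = "\<lambda>x. f (x + h)"
  have "AE \<xi> in lborel. ft (op2 c h d f) \<xi> = complex_of_real c * ft (\<lambda>x. ?s x - complex_of_real d * f x) \<xi>"
    unfolding op2_def[abs_def] by (intro ft_cmult l2_diff l2_shift l2_cmult f)
  moreover have "AE \<xi> in lborel. ft (\<lambda>x. ?s x - complex_of_real d * f x) \<xi> = ft ?s \<xi> - ft (\<lambda>x. complex_of_real d * f x) \<xi>"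
    by (intro ft_diff l2_shift l2_cmult f)
  moreover have "AE \<xi> in lborel. ft (\<lambda>x. complex_of_real d * f x) \<xi> = complex_of_real d * ft f \<xi>"
    by (intro ft_cmult f)
  moreover have "AE \<xi> in lborel. ft ?s \<xi> = cis (h \<bullet> \<xi>) * ft f \<xi>"
    by (intro ft_shift f)
  ultimately show ?thesis by eventually_elim (simp add: algebra_simps)
qed

section \<open>L^1 bounds for difference quotients of a product\<close>

lemma l1_mult_sq:
  assumes f: "l2 f" and g: "l2 g"
  shows "(LINT x|lborel. cmod (f x * g x))\<^sup>2 \<le> sqn f * sqn g"
  using l2_norm_mult_sq[OF f g] by (simp add: norm_mult)

text \<open>Each Leibniz term is a product of two L^2 functions, one of them a difference quotient.
  Measuring the product in L^1 therefore costs no Sobolev embedding and no more than a derivatives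
  on either factor.\<close>

lemma dq_product_l1:
  fixes f g :: "'a::euclidean_space \<Rightarrow> complex"
  assumes f: "l2 f" and g: "l2 g"
  shows "(LINT x|lborel. cmod (dq a k b (\<lambda>x. f x * g x) x))\<^sup>2
    \<le> 2 * (sqn f * sqn (dq a k b g)) + 2 * (sqn (dq a k b f) * sqn g)"
proof -
  note [measurable] = l2_measurable[OF f] l2_measurable[OF g]
  let ?h = "(1/2) ^ k *\<^sub>R b"
  let ?u = "\<lambda>x. f (x + ?h) * dq a k b g x" and ?v = "\<lambda>x. dq a k b f x * g x"
  have eq: "dq a k b (\<lambda>x. f x * g x) x = ?u x + ?v x" for x by (simp add: dq_def algebra_simps)
  have u: "integrable lborel ?u" and v: "integrable lborel ?v"
    by (intro l2_mult_integrable l2_shift l2_dq f g)+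
  have "(LINT x|lborel. cmod (dq a k b (\<lambda>x. f x * g x) x)) \<le> (LINT x|lborel. cmod (?u x) + cmod (?v x))"
    unfolding eq using u v by (intro integral_mono) (auto intro: norm_triangle_ineq)
  also have "\<dots> = (LINT x|lborel. cmod (?u x)) + (LINT x|lborel. cmod (?v x))" using u v by simp
  finally have "(LINT x|lborel. cmod (dq a k b (\<lambda>x. f x * g x) x))\<^sup>2 \<le> ((LINT x|lborel. cmod (?u x)) + (LINT x|lborel. cmod (?v x)))\<^sup>2"
    by (intro power_mono) auto
  also have "\<dots> \<le> 2 * (LINT x|lborel. cmod (?u x))\<^sup>2 + 2 * (LINT x|lborel. cmod (?v x))\<^sup>2"
    using norm_add_sq_le[of "LINT x|lborel. cmod (?u x)" "LINT x|lborel. cmod (?v x)"] by simp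
  also have "(LINT x|lborel. cmod (?u x))\<^sup>2 \<le> sqn f * sqn (dq a k b g)"
    using l1_mult_sq[OF l2_shift[OF f, of ?h] l2_dq[OF g, of a k b]] by (simp add: sqn_shift)
  also have "(LINT x|lborel. cmod (?v x))\<^sup>2 \<le> sqn (dq a k b f) * sqn g"
    by (rule l1_mult_sq[OF l2_dq[OF f] g])
  finally show ?thesis by simp
qed

text \<open>The squared L^1 norms are summed over all scales at once: in each Leibniz term only one
  factor depends on the scale. The factor 5 is 4 for the quotients plus 1 for the product
  itself.\<close>

lemma product_l1_family:
  fixes f g :: "'a::euclidean_space \<Rightarrow> complex"
  assumes f: "l2 f" and g: "l2 g"
  shows "(LINT x|lborel. cmod (f x * g x))\<^sup>2 + (\<Sum>b\<in>Basis. \<Sum>k\<in>ks a K. (LINT x|lborel. cmod (dq a k b (\<lambda>x. f x * g x) x))\<^sup>2)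
    \<le> 5 * (ws a K f * ws a K g)"
proof -
  let ?S = "\<lambda>f. \<Sum>b\<in>Basis. \<Sum>k\<in>ks a K. sqn (dq a k b f)"
  have S0: "0 \<le> ?S f" "0 \<le> ?S g" by (intro sum_nonneg; simp)+
  have "(\<Sum>b\<in>Basis. \<Sum>k\<in>ks a K. (LINT x|lborel. cmod (dq a k b (\<lambda>x. f x * g x) x))\<^sup>2)
    \<le> (\<Sum>b\<in>Basis. \<Sum>k\<in>ks a K. 2 * (sqn f * sqn (dq a k b g)) + 2 * (sqn (dq a k b f) * sqn g))"
    by (intro sum_mono dq_product_l1 f g)
  also have "\<dots> = 2 * (sqn f * ?S g) + 2 * (?S f * sqn g)"
    by (simp add: sum.distrib sum_distrib_left sum_distrib_right)
  also have "\<dots> \<le> 2 * (ws a K f * ws a K g) + 2 * (ws a K f * ws a K g)"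
    using S0 by (intro add_mono mult_left_mono mult_mono) (auto simp: ws_def)
  finally have 1: "(\<Sum>b\<in>Basis. \<Sum>k\<in>ks a K. (LINT x|lborel. cmod (dq a k b (\<lambda>x. f x * g x) x))\<^sup>2) \<le> 4 * (ws a K f * ws a K g)" by simp
  have "sqn f * sqn g \<le> ws a K f * ws a K g"
    using S0 by (intro mult_mono) (auto simp: ws_def)
  with l1_mult_sq[OF f g] 1 show ?thesis by linarith
qed

text \<open>Applied with p = n/2, so p > 1 reflects n \<ge> 3; the bound does not depend on the
  upper end s.\<close>

lemma integral_powr_decay:
  fixes t s p :: real
  assumes t: "0 < t" "t \<le> s" and p: "p > 1"
  shows "integrable lborel (\<lambda>u. indicator {t..s} u * u powr (- p))"
    "(LINT u|lborel. indicator {t..s} u * u powr (- p)) \<le> t powr (1 - p) / (p - 1)"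
proof -
  let ?F = "\<lambda>u. u powr (1 - p) / (1 - p)"
  have d: "(?F has_real_derivative u powr (- p)) (at u)" if "t \<le> u" "u \<le> s" for u
  proof -
    have "(?F has_real_derivative ((1 - p) * u powr (1 - p - 1)) / (1 - p)) (at u)"
      using that t p by (intro derivative_eq_intros has_real_derivative_powr) auto
    then show ?thesis using p by simp
  qed
  have hb: "has_bochner_integral lborel (\<lambda>x. x powr (- p) * indicator {t..s} x) (?F s - ?F t)"
    by (rule has_bochner_integral_FTC_Icc_real[OF t(2) d]) (use t in \<open>auto intro!: continuous_intros\<close>)
  then show "integrable lborel (\<lambda>u. indicator {t..s} u * u powr (- p))"
    by (auto simp: has_bochner_integral_iff mult.commute)
  have "(LINT u|lborel. indicator {t..s} u * u powr (- p)) = ?F s - ?F t"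
    using hb by (simp add: has_bochner_integral_iff mult.commute)
  also have "\<dots> = t powr (1 - p) / (p - 1) - s powr (1 - p) / (p - 1)"
    using p by (simp add: field_simps)
  also have "\<dots> \<le> t powr (1 - p) / (p - 1)" using p by simp
  finally show "(LINT u|lborel. indicator {t..s} u * u powr (- p)) \<le> t powr (1 - p) / (p - 1)" .
qed

text \<open>Fatou is applied to the sum of the squares rather than to each member, so the bound on
  the whole family is not multiplied by its size.\<close>

lemma Fatou_sum:
  fixes F :: "nat \<Rightarrow> 'i \<Rightarrow> 'a::euclidean_space \<Rightarrow> complex"
  assumes I: "finite I" and F: "\<And>j i. i \<in> I \<Longrightarrow> l2 (F j i)" and b: "\<And>j. (\<Sum>i\<in>I. sqn (F j i)) \<le> B"
    and m: "\<And>i. i \<in> I \<Longrightarrow> f i \<in> borel_measurable borel"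
    and lim: "\<And>i. i \<in> I \<Longrightarrow> AE x in lborel. (\<lambda>j. F j i x) \<longlonglongrightarrow> f i x"
  shows "\<And>i. i \<in> I \<Longrightarrow> l2 (f i)" "(\<Sum>i\<in>I. sqn (f i)) \<le> B"
proof -
  show l: "l2 (f i)" if i: "i \<in> I" for i
  proof -
    have "sqn (F j i) \<le> B" for j
      using member_le_sum[of i I "\<lambda>i. sqn (F j i)"] I i b[of j] by simp
    from Fatou_sqn(1)[OF F[OF i] this m[OF i] lim[OF i]] show ?thesis .
  qed
  let ?H = "\<lambda>j x. \<Sum>i\<in>I. (cmod (F j i x))\<^sup>2"
  have "AE x in lborel. \<forall>i\<in>I. (\<lambda>j. F j i x) \<longlonglongrightarrow> f i x"
    using lim I by (simp add: AE_finite_all)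
  then have lim': "AE x in lborel. (\<lambda>j. ?H j x) \<longlonglongrightarrow> (\<Sum>i\<in>I. (cmod (f i x))\<^sup>2)"
    by eventually_elim (intro tendsto_intros, auto)
  have "(LINT x|lborel. (\<Sum>i\<in>I. (cmod (f i x))\<^sup>2)) \<le> B"
  proof (rule Fatou_real(2)[where F="?H", OF _ _ _ _ lim'])
    show "integrable lborel (?H j)" for j
      by (intro Bochner_Integration.integrable_sum l2_integrable F)
    show "(LINT x|lborel. ?H j x) \<le> B" for j
      using b[of j] F by (simp add: sqn_def l2_integrable)
    show "(\<lambda>x. \<Sum>i\<in>I. (cmod (f i x))\<^sup>2) \<in> borel_measurable borel"
      by (intro borel_measurable_sum borel_measurable_power measurable_compose[OF m borel_measurable_norm])
  qed (simp add: sum_nonneg)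
  then show "(\<Sum>i\<in>I. sqn (f i)) \<le> B" using l by (simp add: sqn_def l2_integrable)
qed

text \<open>\<open>duhamel\<close> is the only link between \<open>\<phi>\<close> and the product of
  \<open>V\<close> and \<open>\<Psi>\<close>. All data are Borel representatives bounded at every
  time, and \<open>meas\<close> is what Fubini needs for the joint integral over time and
  frequency.\<close>

locale interaction =
  fixes a :: real and V \<Psi> \<phi> :: "real \<Rightarrow> 'a::euclidean_space \<Rightarrow> complex" and B :: real
  assumes dim: "3 \<le> DIM('a)" and a: "0 \<le> a" "a \<le> 1"
    and V: "\<And>u. ha a (V u)" "\<And>u. hn a (V u) \<le> B"
    and Psi: "\<And>u. ha a (\<Psi> u)" "\<And>u. hn a (\<Psi> u) \<le> B"
    and phi: "\<And>t. ha a (\<phi> t)" "\<And>t. hn a (\<phi> t) \<le> B"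
    and meas: "(\<lambda>(u, \<xi>). ft1 (\<lambda>x. V u x * \<Psi> u x) \<xi>) \<in> borel_measurable (borel \<Otimes>\<^sub>M borel)"
    and duhamel: "\<And>t s. 0 < t \<Longrightarrow> t \<le> s \<Longrightarrow> AE \<xi> in lborel. ft (\<phi> s) \<xi> - ft (\<phi> t) \<xi> =
       - \<i> * (LINT u|lborel. indicator {t..s} u * (cis (u * (norm \<xi>)\<^sup>2) * ft1 (\<lambda>x. V u x * \<Psi> u x) \<xi>))"
begin

definition G :: "real \<Rightarrow> 'a \<Rightarrow> complex" where "G u x = V u x * \<Psi> u x"

lemma B_nonneg: "0 \<le> B" using V(2)[of 0] hn_nonneg order_trans by blast

lemma l2V: "l2 (V u)" and l2Psi: "l2 (\<Psi> u)" and l2phi: "l2 (\<phi> u)"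
  using V(1) Psi(1) phi(1) by (auto intro: ha_l2)

lemma ws_bound:
  obtains D where "D > 0" "\<And>u K. ws a K (V u) \<le> D" "\<And>u K. ws a K (\<Psi> u) \<le> D" "\<And>u K. ws a K (\<phi> u) \<le> D"
proof -
  obtain C where C: "C > 0" "\<And>(f::'a \<Rightarrow> complex) K. ha a f \<Longrightarrow> ws a K f \<le> C * hn a f"
    by (rule ws_le_hn[OF a]) blast
  have "ws a K f \<le> C * B + 1" if "ha a f" "hn a f \<le> B" for K and f :: "'a \<Rightarrow> complex"
    using C(2)[OF that(1), of K] mult_left_mono[OF that(2), of C] C(1) by linarith
  moreover have "C * B + 1 > 0" using C(1) B_nonneg by (simp add: add_nonneg_pos)
  ultimately show ?thesis using V Psi phi by (intro that[of "C * B + 1"]) auto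
qed

lemma integrable_G: "integrable lborel (G u)"
  unfolding G_def[abs_def] by (rule l2_mult_integrable[OF l2V l2Psi])

lemma G_family_bound:
  obtains M where "M > 0" "\<And>u. (LINT x|lborel. cmod (G u x)) \<le> M"
    "\<And>u K. (LINT x|lborel. cmod (G u x))\<^sup>2 + (\<Sum>b\<in>Basis. \<Sum>k\<in>ks a K. (LINT x|lborel. cmod (dq a k b (G u) x))\<^sup>2) \<le> M\<^sup>2"
proof -
  obtain D where D: "D > 0" "\<And>u K. ws a K (V u) \<le> D" "\<And>u K. ws a K (\<Psi> u) \<le> D" by (rule ws_bound) blast
  \<comment> \<open>5 D^2 \<le> (3 D)^2, which leaves a perfect square for the later Cauchy-Schwarz
    step.\<close>
  define M where "M = 3 * D"
  have fam: "(LINT x|lborel. cmod (G u x))\<^sup>2 + (\<Sum>b\<in>Basis. \<Sum>k\<in>ks a K. (LINT x|lborel. cmod (dq a k b (G u) x))\<^sup>2) \<le> M\<^sup>2" for u K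
  proof -
    have "(LINT x|lborel. cmod (G u x))\<^sup>2 + (\<Sum>b\<in>Basis. \<Sum>k\<in>ks a K. (LINT x|lborel. cmod (dq a k b (G u) x))\<^sup>2)
      \<le> 5 * (ws a K (V u) * ws a K (\<Psi> u))"
      unfolding G_def[abs_def] by (rule product_l1_family[OF l2V l2Psi])
    also have "\<dots> \<le> 5 * (D * D)"
      using D by (intro mult_left_mono mult_mono) (auto simp: ws_def intro!: add_nonneg_nonneg sum_nonneg)
    also have "\<dots> \<le> M\<^sup>2" by (simp add: M_def power2_eq_square)
    finally show ?thesis .
  qed
  have "(LINT x|lborel. cmod (G u x)) \<le> M" for u
  proof (rule power2_le_imp_le)
    have "0 \<le> (\<Sum>b\<in>Basis. \<Sum>k\<in>ks a 0. (LINT x|lborel. cmod (dq a k b (G u) x))\<^sup>2)" by (intro sum_nonneg) auto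
    with fam[of u 0] show "(LINT x|lborel. cmod (G u x))\<^sup>2 \<le> M\<^sup>2" by linarith
  qed (use D in \<open>simp add: M_def\<close>)
  with fam D(1) show ?thesis by (intro that[of M]) (auto simp: M_def)
qed

text \<open>The integral of (pi/u)^(n/2) over u \<ge> t, divided by the Parseval constant (2
  pi)^n.\<close>

definition decay :: "real \<Rightarrow> real" where
  "decay t = sqrt pi ^ DIM('a) / (2 * pi) ^ DIM('a) * (t powr (1 - real DIM('a) / 2) / (real DIM('a) / 2 - 1))"

lemma decay_nonneg: "0 \<le> decay t"
  unfolding decay_def using dim by (intro mult_nonneg_nonneg divide_nonneg_nonneg) auto

text \<open>The pairing is moved to the frequency side, Duhamel's formula is inserted, and at each
  time u the dispersive estimate is applied to the source. Keeping the sum over I inside the time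
  integral means that the squared L^1 norms have to add up only at each fixed u; the bound is then
  independent of the size of I and of s.\<close>

lemma pairing_bound:
  fixes c d :: "'i \<Rightarrow> real" and h :: "'i \<Rightarrow> 'a" and p :: "'i \<Rightarrow> 'a \<Rightarrow> complex"
  assumes I: "finite I" and p: "\<And>i. i \<in> I \<Longrightarrow> l2 (p i)" "\<And>i. i \<in> I \<Longrightarrow> integrable lborel (p i)"
    and M: "0 \<le> M" "\<And>u. (\<Sum>i\<in>I. (LINT x|lborel. cmod (op2 (c i) (h i) (d i) (G u) x))\<^sup>2) \<le> M\<^sup>2"
    and t: "0 < t" "t \<le> s"
  shows "cmod (\<Sum>i\<in>I. ip (op2 (c i) (h i) (d i) (\<lambda>x. \<phi> s x - \<phi> t x)) (p i))
    \<le> decay t * M * sqrt (\<Sum>i\<in>I. (LINT x|lborel. cmod (p i x))\<^sup>2)"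
proof -
  define \<kappa> where "\<kappa> = (2 * pi :: real) ^ DIM('a)"
  have \<kappa>: "\<kappa> > 0" by (simp add: \<kappa>_def)
  define w where "w x = \<phi> s x - \<phi> t x" for x
  have w: "l2 w" unfolding w_def by (intro l2_diff l2phi)
  define W where "W = ft w"
  have W: "l2 W" unfolding W_def by (rule l2_ft[OF w])
  define m where "m i \<xi> = complex_of_real (c i) * (cis (h i \<bullet> \<xi>) - complex_of_real (d i))" for i \<xi>
  have [measurable]: "m i \<in> borel_measurable borel" for i unfolding m_def[abs_def] by measurable
  have mb: "cmod (m i \<xi>) \<le> \<bar>c i\<bar> * (1 + \<bar>d i\<bar>)" for i \<xi>
    unfolding m_def norm_mult norm_of_real
    by (intro mult_left_mono) (use norm_triangle_ineq4[of "cis (h i \<bullet> \<xi>)" "complex_of_real (d i)"] in auto)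
  define P where "P i = (LINT x|lborel. cmod (p i x))" for i
  define A where "A i u = (LINT x|lborel. cmod (op2 (c i) (h i) (d i) (G u) x))" for i u
  have mp: "p i \<in> borel_measurable borel" if "i \<in> I" for i using p(1)[OF that] by (rule l2_measurable)
  \<comment> \<open>All multipliers and test functions are collected in one bounded factor, so that
    Duhamel's formula is inserted once for the whole family.\<close>
  define Q where "Q \<xi> = (\<Sum>i\<in>I. m i \<xi> * cnj (ft1 (p i) \<xi>))" for \<xi>
  have [measurable]: "Q \<in> borel_measurable borel" unfolding Q_def[abs_def] using mp by measurable
  define CQ where "CQ = (\<Sum>i\<in>I. (\<bar>c i\<bar> * (1 + \<bar>d i\<bar>)) * P i)"
  have Qb: "cmod (Q \<xi>) \<le> CQ" for \<xi>
  proof -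
    have "cmod (Q \<xi>) \<le> (\<Sum>i\<in>I. cmod (m i \<xi> * cnj (ft1 (p i) \<xi>)))" unfolding Q_def by (rule norm_sum)
    also have "\<dots> \<le> CQ" unfolding CQ_def norm_mult P_def
      by (intro sum_mono mult_mono mb) (auto simp: ft1_bound)
    finally show ?thesis .
  qed
  obtain M0 where M0: "M0 > 0" "\<And>u. (LINT x|lborel. cmod (G u x)) \<le> M0" by (rule G_family_bound) blast
  have Gm [measurable]: "(\<lambda>x. ft1 (G (fst x)) (snd x)) \<in> borel_measurable (borel \<Otimes>\<^sub>M borel)"
    using meas unfolding G_def[abs_def] by (simp add: case_prod_beta')
  have Gb: "cmod (ft1 (G u) \<xi>) \<le> M0" for u \<xi>
    using ft1_bound[of "G u" \<xi>] M0(2)[of u] by linarith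
  have iF: "integrable lborel (\<lambda>\<xi>. W \<xi> * Q \<xi>)"
  proof -
    have "integrable lborel (\<lambda>\<xi>. \<Sum>i\<in>I. (m i \<xi> * W \<xi>) * cnj (ft1 (p i) \<xi>))"
      using p mb by (intro Bochner_Integration.integrable_sum ip_integrable l2_bounded_mult[OF W _ mb] plancherel_l1_l2) auto
    then show ?thesis unfolding Q_def by (simp add: sum_distrib_left mult_ac)
  qed
  have lhs: "complex_of_real \<kappa> * (\<Sum>i\<in>I. ip (op2 (c i) (h i) (d i) w) (p i)) = (LINT \<xi>|lborel. W \<xi> * Q \<xi>)"
  proof -
    have one: "complex_of_real \<kappa> * ip (op2 (c i) (h i) (d i) w) (p i) = (LINT \<xi>|lborel. (m i \<xi> * W \<xi>) * cnj (ft1 (p i) \<xi>))" if i: "i \<in> I" for i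
    proof -
      have "complex_of_real \<kappa> * ip (op2 (c i) (h i) (d i) w) (p i) = ip (ft (op2 (c i) (h i) (d i) w)) (ft (p i))"
        using parseval[OF l2_op2[OF w] p(1)[OF i]] by (simp add: \<kappa>_def)
      also have "\<dots> = (LINT \<xi>|lborel. (m i \<xi> * W \<xi>) * cnj (ft1 (p i) \<xi>))"
        unfolding ip_def
      proof (rule integral_cong_AE)
        show "AE \<xi> in lborel. ft (op2 (c i) (h i) (d i) w) \<xi> * cnj (ft (p i) \<xi>) = m i \<xi> * W \<xi> * cnj (ft1 (p i) \<xi>)"
          using ft_op2[OF w, of "c i" "h i" "d i"] ft_eq_ft1[OF p[OF i]]
          by eventually_elim (simp add: m_def W_def)
      qed (use l2_measurable[OF l2_ft[OF p(1)[OF i]]] l2_measurable[OF l2_ft[OF l2_op2[OF w]]] mp[OF i] l2_measurable[OF W] in measurable)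
      finally show ?thesis .
    qed
    have "complex_of_real \<kappa> * (\<Sum>i\<in>I. ip (op2 (c i) (h i) (d i) w) (p i)) = (\<Sum>i\<in>I. LINT \<xi>|lborel. (m i \<xi> * W \<xi>) * cnj (ft1 (p i) \<xi>))"
      unfolding sum_distrib_left by (intro sum.cong refl one)
    also have "\<dots> = (LINT \<xi>|lborel. (\<Sum>i\<in>I. (m i \<xi> * W \<xi>) * cnj (ft1 (p i) \<xi>)))"
      using p mb by (intro Bochner_Integration.integral_sum[symmetric] ip_integrable l2_bounded_mult[OF W _ mb] plancherel_l1_l2) auto
    also have "\<dots> = (LINT \<xi>|lborel. W \<xi> * Q \<xi>)" unfolding Q_def by (simp add: sum_distrib_left mult_ac)
    finally show ?thesis .
  qed
  define PP where "PP = sqrt (\<Sum>i\<in>I. (P i)\<^sup>2)"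
  have PP0: "0 \<le> PP" unfolding PP_def by (intro real_sqrt_ge_zero sum_nonneg) auto
  define n2 where "n2 = real DIM('a) / 2"
  have n2: "n2 > 1" using dim by (simp add: n2_def)
  define X where "X = sqrt pi ^ DIM('a) * (t powr (1 - n2) / (n2 - 1)) * M * PP"
  \<comment> \<open>\<open>W * Q\<close> is integrable, but after inserting Duhamel the factors
    \<open>Q\<close> and \<open>ft1 (G u)\<close> are merely bounded in \<xi>. The Gaussian restores
    the integrability that Fubini requires; the bound \<open>X\<close> does not depend on
    it.\<close>
  have reg: "cmod (LINT \<xi>|lborel. complex_of_real (exp (- \<epsilon> * (norm \<xi>)\<^sup>2)) * (W \<xi> * Q \<xi>)) \<le> X" if \<epsilon>: "\<epsilon> > 0" for \<epsilon>
  proof -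
    let ?e = "\<lambda>\<xi>::'a. complex_of_real (exp (- \<epsilon> * (norm \<xi>)\<^sup>2))"
    let ?i = "\<lambda>u. indicator {t..s} u :: complex"
    let ?k = "\<lambda>(\<xi>) u. Q \<xi> * (cis (u * (norm \<xi>)\<^sup>2) * ft1 (G u) \<xi>)"
    have ie: "integrable lborel ?e" using integrable_gauss_cis[OF \<epsilon>, of "0::'a"] by simp
    have ii: "integrable lborel ?i"
      by (rule Bochner_Integration.integrable_bound[where f="indicator {t..s} :: real \<Rightarrow> real"])
         (use t in \<open>auto simp: indicator_def intro!: integrable_real_indicator\<close>)
    have duh: "AE \<xi> in lborel. W \<xi> = - \<i> * (LINT u|lborel. ?i u * (cis (u * (norm \<xi>)\<^sup>2) * ft1 (G u) \<xi>))"
      using duhamel[OF t] ft_diff[OF l2phi l2phi, of s t]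
      unfolding W_def w_def[abs_def] G_def[abs_def] by eventually_elim simp
    have [measurable]: "W \<in> borel_measurable borel" using W by (rule l2_measurable)
    have "(LINT \<xi>|lborel. ?e \<xi> * (W \<xi> * Q \<xi>)) = (LINT \<xi>|lborel. - \<i> * (LINT u|lborel. ?e \<xi> * ?i u * ?k \<xi> u))"
    proof (rule integral_cong_AE)
      show "AE \<xi> in lborel. ?e \<xi> * (W \<xi> * Q \<xi>) = - \<i> * (LINT u|lborel. ?e \<xi> * ?i u * ?k \<xi> u)"
        using duh
      proof eventually_elim
        case (elim \<xi>)
        have "(LINT u|lborel. ?e \<xi> * ?i u * ?k \<xi> u) = (LINT u|lborel. (?e \<xi> * Q \<xi>) * (?i u * (cis (u * (norm \<xi>)\<^sup>2) * ft1 (G u) \<xi>)))"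
          by (intro Bochner_Integration.integral_cong refl) (simp add: mult_ac)
        also have "\<dots> = (?e \<xi> * Q \<xi>) * (LINT u|lborel. ?i u * (cis (u * (norm \<xi>)\<^sup>2) * ft1 (G u) \<xi>))"
          by (rule integral_mult_right_zero)
        finally have eq: "(LINT u|lborel. ?e \<xi> * ?i u * ?k \<xi> u) = (?e \<xi> * Q \<xi>) * (LINT u|lborel. ?i u * (cis (u * (norm \<xi>)\<^sup>2) * ft1 (G u) \<xi>))" .
        show ?case unfolding elim eq by (simp only: mult_ac)
      qed
      have "(\<lambda>x. ft1 (G (snd x)) (fst x)) \<in> borel_measurable (borel \<Otimes>\<^sub>M borel)"
        using measurable_compose[OF measurable_pair_swap' Gm] by (simp add: case_prod_beta')
      then have [measurable]: "(\<lambda>(\<xi>, u). ft1 (G u) \<xi>) \<in> borel_measurable (borel \<Otimes>\<^sub>M borel)"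
        by (simp add: case_prod_beta')
      show "(\<lambda>\<xi>. - \<i> * (LINT u|lborel. ?e \<xi> * ?i u * ?k \<xi> u)) \<in> borel_measurable lborel" by measurable
    qed measurable
    also have "\<dots> = - \<i> * (LINT \<xi>|lborel. LINT u|lborel. ?e \<xi> * ?i u * ?k \<xi> u)" by (rule integral_mult_right_zero)
    also have "(LINT \<xi>|lborel. LINT u|lborel. ?e \<xi> * ?i u * ?k \<xi> u) = (LINT u|lborel. LINT \<xi>|lborel. ?e \<xi> * ?i u * ?k \<xi> u)"
    proof (rule Fubini_bounded_kernel[OF ie ii, where C="CQ * M0"])
      show "cmod (?k \<xi> u) \<le> CQ * M0" for \<xi> u
        unfolding norm_mult norm_cis mult_1 using Qb Gb M0(1) order_trans[OF norm_ge_zero Qb[of 0]] by (intro mult_mono) auto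
      have "(\<lambda>x. ft1 (G (snd x)) (fst x)) \<in> borel_measurable (borel \<Otimes>\<^sub>M borel)"
        using measurable_compose[OF measurable_pair_swap' Gm] by (simp add: case_prod_beta')
      then have [measurable]: "(\<lambda>(\<xi>, u). ft1 (G u) \<xi>) \<in> borel_measurable (borel \<Otimes>\<^sub>M borel)"
        by (simp add: case_prod_beta')
      show "(\<lambda>(\<xi>, u). ?k \<xi> u) \<in> borel_measurable (borel \<Otimes>\<^sub>M borel)" by measurable
    qed
    finally have eq: "cmod (LINT \<xi>|lborel. ?e \<xi> * (W \<xi> * Q \<xi>)) = cmod (LINT u|lborel. LINT \<xi>|lborel. ?e \<xi> * ?i u * ?k \<xi> u)"
      by (simp add: norm_mult)
    have inner: "cmod (LINT \<xi>|lborel. ?e \<xi> * ?i u * ?k \<xi> u) \<le> indicator {t..s} u * u powr (- n2) * (sqrt pi ^ DIM('a) * M * PP)" for u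
    proof (cases "u \<in> {t..s}")
      case True
      then have u: "u > 0" using t by auto
      have iG: "integrable lborel (op2 (c i) (h i) (d i) (G u))" for i by (rule integrable_op2[OF integrable_G])
      let ?f = "\<lambda>i \<xi>. ?e \<xi> * cis (u * (norm \<xi>)\<^sup>2) * ft1 (op2 (c i) (h i) (d i) (G u)) \<xi> * cnj (ft1 (p i) \<xi>)"
      have intf: "integrable lborel (?f i)" if i: "i \<in> I" for i
      proof (rule Bochner_Integration.integrable_bound)
        show "integrable lborel (\<lambda>\<xi>. A i u * P i * exp (- \<epsilon> * (norm \<xi>)\<^sup>2))"
          by (intro integrable_mult_right integrable_gauss \<epsilon>)
        have [measurable]: "op2 (c i) (h i) (d i) (G u) \<in> borel_measurable borel" using iG[of i] by auto
        show "?f i \<in> borel_measurable lborel" using mp[OF i] by measurable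
        show "AE \<xi> in lborel. norm (?f i \<xi>) \<le> norm (A i u * P i * exp (- \<epsilon> * (norm \<xi>)\<^sup>2))"
        proof (rule AE_I2)
          fix \<xi>
          have "norm (?f i \<xi>) = exp (- \<epsilon> * (norm \<xi>)\<^sup>2) * (cmod (ft1 (op2 (c i) (h i) (d i) (G u)) \<xi>) * cmod (ft1 (p i) \<xi>))"
            by (simp add: norm_mult)
          also have "\<dots> \<le> exp (- \<epsilon> * (norm \<xi>)\<^sup>2) * (A i u * P i)"
            unfolding A_def P_def by (intro mult_left_mono mult_mono ft1_bound) auto
          finally show "norm (?f i \<xi>) \<le> norm (A i u * P i * exp (- \<epsilon> * (norm \<xi>)\<^sup>2))"
            by (simp add: abs_mult A_def P_def mult_ac)
        qed
      qed
      have "(LINT \<xi>|lborel. ?e \<xi> * ?i u * ?k \<xi> u) = (LINT \<xi>|lborel. (\<Sum>i\<in>I. ?f i \<xi>))"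
      proof (intro Bochner_Integration.integral_cong refl)
        fix \<xi>
        have "?f i \<xi> = (?e \<xi> * (cis (u * (norm \<xi>)\<^sup>2) * ft1 (G u) \<xi>)) * (m i \<xi> * cnj (ft1 (p i) \<xi>))" for i
          unfolding ft1_op2[OF integrable_G] m_def by (simp only: mult_ac)
        then have "(\<Sum>i\<in>I. ?f i \<xi>) = (?e \<xi> * (cis (u * (norm \<xi>)\<^sup>2) * ft1 (G u) \<xi>)) * Q \<xi>"
          unfolding Q_def sum_distrib_left by (simp only:)
        moreover have "?i u = 1" using True by simp
        ultimately show "?e \<xi> * ?i u * ?k \<xi> u = (\<Sum>i\<in>I. ?f i \<xi>)" by (simp only: mult_ac mult_1_left mult_1_right)
      qed
      also have "\<dots> = (\<Sum>i\<in>I. LINT \<xi>|lborel. ?f i \<xi>)" using intf by (rule Bochner_Integration.integral_sum)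
      finally have e1: "(LINT \<xi>|lborel. ?e \<xi> * ?i u * ?k \<xi> u) = (\<Sum>i\<in>I. LINT \<xi>|lborel. ?f i \<xi>)" .
      have "cmod (LINT \<xi>|lborel. ?e \<xi> * ?i u * ?k \<xi> u) \<le> (\<Sum>i\<in>I. cmod (LINT \<xi>|lborel. ?f i \<xi>))"
        unfolding e1 by (rule norm_sum)
      also have "\<dots> \<le> (\<Sum>i\<in>I. sqrt (pi / u) ^ DIM('a) * (A i u * P i))"
      proof (rule sum_mono)
        fix i assume i: "i \<in> I"
        have "cmod (LINT \<xi>|lborel. ?f i \<xi>) \<le> sqrt (pi / u) ^ DIM('a) * (LINT x|lborel. cmod (op2 (c i) (h i) (d i) (G u) x)) * (LINT x|lborel. cmod (p i x))"
          by (rule dispersive_pairing[OF iG[of i] p(2)[OF i] \<epsilon> u])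
        then show "cmod (LINT \<xi>|lborel. ?f i \<xi>) \<le> sqrt (pi / u) ^ DIM('a) * (A i u * P i)"
          by (simp only: A_def P_def mult.assoc)
      qed
      also have "\<dots> = sqrt (pi / u) ^ DIM('a) * (\<Sum>i\<in>I. A i u * P i)" by (simp add: sum_distrib_left)
      also have "\<dots> \<le> sqrt (pi / u) ^ DIM('a) * (M * PP)"
      proof (rule mult_left_mono)
        \<comment> \<open>Cauchy-Schwarz over the family at the fixed time u, so that only the joint
          bound M on the sources is used.\<close>
        have "(\<Sum>i\<in>I. A i u * P i)\<^sup>2 \<le> (\<Sum>i\<in>I. (A i u)\<^sup>2) * (\<Sum>i\<in>I. (P i)\<^sup>2)"
          by (rule Cauchy_Schwarz_ineq_sum)
        also have "\<dots> \<le> M\<^sup>2 * (\<Sum>i\<in>I. (P i)\<^sup>2)"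
          unfolding A_def by (intro mult_right_mono M sum_nonneg) auto
        also have "\<dots> = (M * PP)\<^sup>2" unfolding PP_def by (simp add: power_mult_distrib sum_nonneg)
        finally show "(\<Sum>i\<in>I. A i u * P i) \<le> M * PP"
          by (rule power2_le_imp_le) (use M(1) PP0 in simp)
      qed (use u in simp)
      also have "sqrt (pi / u) ^ DIM('a) = u powr (- n2) * sqrt pi ^ DIM('a)"
      proof -
        have "sqrt u ^ DIM('a) = u powr n2"
          using u by (simp add: n2_def powr_half_sqrt[symmetric] powr_realpow[symmetric] powr_powr)
        moreover have "sqrt (pi / u) ^ DIM('a) = sqrt pi ^ DIM('a) / sqrt u ^ DIM('a)"
          by (simp add: real_sqrt_divide power_divide)
        ultimately show ?thesis by (simp add: powr_minus_divide)
      qed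
      finally show ?thesis using True by (simp add: mult_ac)
    qed (auto)
    have i1: "integrable lborel (\<lambda>u. indicator {t..s} u * u powr (- n2) * (sqrt pi ^ DIM('a) * M * PP))"
      by (intro integrable_mult_left integral_powr_decay t n2)
    have "cmod (LINT u|lborel. LINT \<xi>|lborel. ?e \<xi> * ?i u * ?k \<xi> u) \<le> (LINT u|lborel. indicator {t..s} u * u powr (- n2) * (sqrt pi ^ DIM('a) * M * PP))"
    proof (rule order_trans[OF integral_norm_bound])
      show "(LINT u|lborel. cmod (LINT \<xi>|lborel. ?e \<xi> * ?i u * ?k \<xi> u)) \<le> (LINT u|lborel. indicator {t..s} u * u powr (- n2) * (sqrt pi ^ DIM('a) * M * PP))"
      proof (rule integral_mono[OF _ i1 inner])
        have [measurable]: "(\<lambda>(u, \<xi>). ft1 (G u) \<xi>) \<in> borel_measurable (borel \<Otimes>\<^sub>M borel)"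
          using Gm by (simp add: case_prod_beta')
        show "integrable lborel (\<lambda>u. cmod (LINT \<xi>|lborel. ?e \<xi> * ?i u * ?k \<xi> u))"
        proof (rule Bochner_Integration.integrable_bound[OF i1])
          show "(\<lambda>u. cmod (LINT \<xi>|lborel. ?e \<xi> * ?i u * ?k \<xi> u)) \<in> borel_measurable lborel" by measurable
          show "AE u in lborel. norm (cmod (LINT \<xi>|lborel. ?e \<xi> * ?i u * ?k \<xi> u)) \<le> norm (indicator {t..s} u * u powr (- n2) * (sqrt pi ^ DIM('a) * M * PP))"
            using inner by (intro AE_I2) (smt (verit) norm_ge_zero real_norm_def)
        qed
      qed
    qed
    also have "\<dots> = (LINT u|lborel. indicator {t..s} u * u powr (- n2)) * (sqrt pi ^ DIM('a) * M * PP)"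
      by (rule integral_mult_left_zero)
    also have "\<dots> \<le> (t powr (1 - n2) / (n2 - 1)) * (sqrt pi ^ DIM('a) * M * PP)"
      using M(1) PP0 by (intro mult_right_mono integral_powr_decay t n2) auto
    also have "\<dots> = X" by (simp add: X_def)
    finally show ?thesis unfolding eq .
  qed
  \<comment> \<open>The Gaussian is removed along \<epsilon> = 1/(m+1), with the integrable function
    |W Q| itself as majorant.\<close>
  have lim: "(\<lambda>m. LINT \<xi>|lborel. complex_of_real (exp (- inverse (real (Suc m)) * (norm \<xi>)\<^sup>2)) * (W \<xi> * Q \<xi>))
     \<longlonglongrightarrow> (LINT \<xi>|lborel. W \<xi> * Q \<xi>)"
  proof (rule integral_dominated_convergence[where w="\<lambda>\<xi>. cmod (W \<xi> * Q \<xi>)"])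
    have [measurable]: "W \<in> borel_measurable borel" using W by (rule l2_measurable)
    show "(\<lambda>\<xi>. W \<xi> * Q \<xi>) \<in> borel_measurable lborel"
      "(\<lambda>\<xi>. complex_of_real (exp (- inverse (real (Suc m)) * (norm \<xi>)\<^sup>2)) * (W \<xi> * Q \<xi>)) \<in> borel_measurable lborel" for m
      by measurable
    show "integrable lborel (\<lambda>\<xi>. cmod (W \<xi> * Q \<xi>))" using iF by (rule integrable_norm)
    show "AE \<xi> in lborel. norm (complex_of_real (exp (- inverse (real (Suc m)) * (norm \<xi>)\<^sup>2)) * (W \<xi> * Q \<xi>)) \<le> cmod (W \<xi> * Q \<xi>)" for m
    proof (rule AE_I2)
      fix \<xi> :: 'a
      have "exp (- inverse (real (Suc m)) * (norm \<xi>)\<^sup>2) \<le> 1" by simp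
      then show "norm (complex_of_real (exp (- inverse (real (Suc m)) * (norm \<xi>)\<^sup>2)) * (W \<xi> * Q \<xi>)) \<le> cmod (W \<xi> * Q \<xi>)"
        unfolding norm_mult[of "complex_of_real _"] norm_of_real by (intro mult_left_le_one_le) auto
    qed
    show "AE \<xi> in lborel. (\<lambda>m. complex_of_real (exp (- inverse (real (Suc m)) * (norm \<xi>)\<^sup>2)) * (W \<xi> * Q \<xi>)) \<longlonglongrightarrow> W \<xi> * Q \<xi>"
    proof (rule AE_I2)
      fix \<xi> :: 'a
      have "(\<lambda>m. complex_of_real (exp (- inverse (real (Suc m)) * (norm \<xi>)\<^sup>2)) * (W \<xi> * Q \<xi>)) \<longlonglongrightarrow> complex_of_real (exp (- 0 * (norm \<xi>)\<^sup>2)) * (W \<xi> * Q \<xi>)"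
        by (intro tendsto_intros LIMSEQ_inverse_real_of_nat)
      then show "(\<lambda>m. complex_of_real (exp (- inverse (real (Suc m)) * (norm \<xi>)\<^sup>2)) * (W \<xi> * Q \<xi>)) \<longlonglongrightarrow> W \<xi> * Q \<xi>" by simp
    qed
  qed
  have "cmod (LINT \<xi>|lborel. W \<xi> * Q \<xi>) \<le> X"
    using reg[of "inverse (real (Suc _))"] by (intro LIMSEQ_le_const2[OF tendsto_norm[OF lim]] exI[of _ 0] allI impI) simp
  then have "\<kappa> * cmod (\<Sum>i\<in>I. ip (op2 (c i) (h i) (d i) w) (p i)) \<le> X"
    unfolding lhs[symmetric] norm_mult using \<kappa> by simp
  then have "cmod (\<Sum>i\<in>I. ip (op2 (c i) (h i) (d i) w) (p i)) \<le> X / \<kappa>" using \<kappa> by (simp add: field_simps)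
  also have "X / \<kappa> = decay t * M * PP" by (simp add: X_def decay_def \<kappa>_def n2_def)
  finally show ?thesis unfolding w_def PP_def P_def .
qed

text \<open>The increments are tested against their own truncations: the pairing becomes the sum S
  to be estimated, and on the ball the squared L^1 norms of the test functions are at most the
  volume times S. The resulting inequality S \<le> X sqrt(vol S) is solved for S.\<close>

lemma local_l2_bound:
  fixes c d :: "'i \<Rightarrow> real" and h :: "'i \<Rightarrow> 'a"
  assumes I: "finite I"
    and M: "0 \<le> M" "\<And>u. (\<Sum>i\<in>I. (LINT x|lborel. cmod (op2 (c i) (h i) (d i) (G u) x))\<^sup>2) \<le> M\<^sup>2"
    and t: "0 < t" "t \<le> s"
  shows "(\<Sum>i\<in>I. sqn (trunc R (op2 (c i) (h i) (d i) (\<lambda>x. \<phi> s x - \<phi> t x)))) \<le> (decay t * M)\<^sup>2 * measure lborel (ball 0 R :: 'a set)"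
proof -
  let ?w = "\<lambda>i. op2 (c i) (h i) (d i) (\<lambda>x. \<phi> s x - \<phi> t x)"
  have w: "l2 (?w i)" for i by (intro l2_op2 l2_diff l2phi)
  define S where "S = (\<Sum>i\<in>I. sqn (trunc R (?w i)))"
  have S0: "0 \<le> S" unfolding S_def by (intro sum_nonneg) simp
  let ?v = "measure lborel (ball 0 R :: 'a set)"
  have ip: "ip f (trunc R f) = complex_of_real (sqn (trunc R f))" for f :: "'a \<Rightarrow> complex"
    unfolding ip_self[symmetric] ip_def by (intro Bochner_Integration.integral_cong) (auto simp: trunc_def)
  have v: "(LINT x|lborel. cmod (trunc R (?w i) x))\<^sup>2 \<le> ?v * sqn (trunc R (?w i))" for i
  proof -
    have e: "trunc R (?w i) x = indicator (ball 0 R) x * trunc R (?w i) x" for x by (auto simp: trunc_def indicator_def)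
    have b: "ball 0 R \<in> sets borel" "emeasure lborel (ball 0 R :: 'a set) < \<infinity>"
      using emeasure_lborel_ball_finite by auto
    show ?thesis
      using l1_mult_sq[OF l2_indicator(1)[OF b] l2_trunc[OF w, of R i]] unfolding e[symmetric] l2_indicator(2)[OF b] .
  qed
  have "S = cmod (\<Sum>i\<in>I. ip (?w i) (trunc R (?w i)))"
    unfolding ip S_def of_real_sum[symmetric] norm_of_real using S0 by (simp add: S_def)
  also have "\<dots> \<le> decay t * M * sqrt (\<Sum>i\<in>I. (LINT x|lborel. cmod (trunc R (?w i) x))\<^sup>2)"
    by (rule pairing_bound[OF I _ _ M t]) (auto intro: l2_trunc integrable_trunc w)
  also have "\<dots> \<le> decay t * M * sqrt (?v * S)"
    unfolding S_def sum_distrib_left using decay_nonneg M(1)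
    by (intro mult_left_mono real_sqrt_le_mono sum_mono v) auto
  finally have "S\<^sup>2 \<le> (decay t * M * sqrt (?v * S))\<^sup>2" using S0 by (rule power_mono)
  also have "\<dots> = (decay t * M)\<^sup>2 * ?v * S" using S0 by (simp add: power_mult_distrib)
  finally have "S * S \<le> (decay t * M)\<^sup>2 * ?v * S" by (simp add: power2_eq_square)
  \<comment> \<open>A positive S is cancelled from the quadratic inequality; S = 0 is
    separate.\<close>
  then show ?thesis using S0 unfolding S_def[symmetric]
    by (cases "S = 0") (auto simp: mult_le_cancel_right)
qed

text \<open>Duality between L^1 and L^infinity by hand: testing with the phase of the increment on
  the set where it exceeds the bound gives an integral inequality that forces this set to be null.
  Balls keep the set of finite measure.\<close>

lemma AE_increment_bound:
  assumes M: "0 \<le> M" "\<And>u. (LINT x|lborel. cmod (G u x)) \<le> M" and t: "0 < t" "t \<le> s"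
  shows "AE x in lborel. cmod (\<phi> s x - \<phi> t x) \<le> decay t * M"
proof -
  define w where "w x = \<phi> s x - \<phi> t x" for x
  define X where "X = decay t * M"
  have X: "0 \<le> X" using decay_nonneg M by (simp add: X_def)
  have w: "l2 w" unfolding w_def by (intro l2_diff l2phi)
  note [measurable] = l2_measurable[OF w]
  have o: "op2 1 0 0 f = f" for f :: "'a \<Rightarrow> complex" by (simp add: op2_def fun_eq_iff)
  have null: "AE x in lborel. x \<in> ball 0 R \<longrightarrow> cmod (w x) \<le> X" for R :: real
  proof -
    define A where "A = {x \<in> ball 0 R. X < cmod (w x)}"
    have A[measurable]: "A \<in> sets borel"
    proof -
      have "A = ball 0 R \<inter> {x \<in> space borel. X < cmod (w x)}" by (auto simp: A_def)
      also have "\<dots> \<in> sets borel" by (intro sets.Int) (simp, measurable)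
      finally show ?thesis .
    qed
    have Afin: "emeasure lborel A < \<infinity>"
      by (rule le_less_trans[OF emeasure_mono emeasure_lborel_ball_finite[of "0::'a" R]]) (auto simp: A_def)
    \<comment> \<open>The conjugate of \<open>sgn (w x)\<close> rotates w onto the positive axis, so
      the pairing is the integral of |w| over A.\<close>
    define p where "p x = sgn (w x) * indicator A x" for x
    have p2: "l2 p" unfolding p_def
      by (rule l2_bounded_mult1[OF l2_indicator(1)[OF A Afin]]) (auto simp: norm_sgn borel_measurable_sgn)
    have ip1: "integrable lborel p"
    proof (rule Bochner_Integration.integrable_bound[where f="indicator A :: 'a \<Rightarrow> real"])
      show "integrable lborel (indicator A :: 'a \<Rightarrow> real)" using Afin by auto
      show "p \<in> borel_measurable lborel" using l2_measurable[OF p2] by simp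
      show "AE x in lborel. norm (p x) \<le> norm (indicator A x :: real)"
        by (intro AE_I2) (auto simp: p_def norm_mult norm_sgn indicator_def)
    qed
    have np: "cmod (p x) = indicator A x" for x
      using X by (auto simp: p_def A_def norm_mult norm_sgn indicator_def)
    have wp: "w x * cnj (p x) = complex_of_real (cmod (w x) * indicator A x)" for x
    proof -
      have "w x * cnj (sgn (w x)) = complex_of_real (cmod (w x))"
        by (cases "w x = 0") (auto simp: sgn_eq complex_norm_square[symmetric] power2_eq_square)
      then show ?thesis by (simp add: p_def indicator_def)
    qed
    have iwA: "integrable lborel (\<lambda>x. cmod (w x) * indicator A x)"
      using integrable_norm[OF ip_integrable[OF w p2]] by (simp add: norm_mult np)
    have M1: "(\<Sum>i\<in>{()}. (LINT x|lborel. cmod (op2 1 0 0 (G u) x))\<^sup>2) \<le> M\<^sup>2" for u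
      unfolding o using M by (simp add: power_mono)
    have "cmod (\<Sum>i\<in>{()}. ip (op2 1 0 0 (\<lambda>x. \<phi> s x - \<phi> t x)) p) \<le> decay t * M * sqrt (\<Sum>i\<in>{()}. (LINT x|lborel. cmod (p x))\<^sup>2)"
      by (rule pairing_bound[where p="\<lambda>_. p" and c="\<lambda>_. 1" and h="\<lambda>_. 0" and d="\<lambda>_. 0", OF _ p2 ip1 M(1) M1 t]) auto
    then have le: "cmod (ip w p) \<le> X * (LINT x|lborel. indicator A x)"
      unfolding o w_def[symmetric] X_def np by simp
    have "ip w p = complex_of_real (LINT x|lborel. cmod (w x) * indicator A x)"
      unfolding ip_def wp by (rule integral_complex_of_real)
    then have "(LINT x|lborel. cmod (w x) * indicator A x) \<le> X * (LINT x|lborel. indicator A x)"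
      using le by simp
    moreover have iA: "integrable lborel (\<lambda>x. X * indicator A x)" using Afin by auto
    ultimately have "(LINT x|lborel. cmod (w x) * indicator A x - X * indicator A x) \<le> 0"
      using iwA by simp
    moreover have nn: "AE x in lborel. 0 \<le> cmod (w x) * indicator A x - X * indicator A x"
      by (intro AE_I2) (auto simp: A_def indicator_def)
    ultimately have "(LINT x|lborel. cmod (w x) * indicator A x - X * indicator A x) = 0"
      using integral_nonneg_AE[OF nn] by linarith
    then have "AE x in lborel. cmod (w x) * indicator A x - X * indicator A x = 0"
      using integral_nonneg_eq_0_iff_AE[OF Bochner_Integration.integrable_diff[OF iwA iA] nn] by simp
    then show ?thesis by eventually_elim (auto simp: A_def indicator_def split: if_splits)
  qed
  have "AE x in lborel. \<forall>n::nat. x \<in> ball 0 (real n) \<longrightarrow> cmod (w x) \<le> X"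
    unfolding AE_all_countable using null by blast
  then show ?thesis
  proof eventually_elim
    case (elim x)
    obtain n :: nat where "norm x < real n" using reals_Archimedean2 by blast
    with elim show ?case by (auto simp: w_def X_def)
  qed
qed

end

section \<open>Cutoffs and the limit\<close>

text \<open>The index None carries the function itself and Some its quotients, so that
  \<open>ws\<close> becomes one sum of the kind that \<open>local_l2_bound\<close>
  estimates.\<close>

definition fam :: "real \<Rightarrow> (nat \<times> 'a::euclidean_space) option \<Rightarrow> ('a \<Rightarrow> complex) \<Rightarrow> 'a \<Rightarrow> complex" where
  "fam a i = (case i of None \<Rightarrow> op2 1 0 0 | Some (k, b) \<Rightarrow> op2 (cf a k) ((1/2) ^ k *\<^sub>R b) 1)"

definition fam_index :: "real \<Rightarrow> nat \<Rightarrow> (nat \<times> 'a::euclidean_space) option set" where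
  "fam_index a K = insert None (Some ` (ks a K \<times> Basis))"

lemma fam_simps [simp]: "fam a None f = f" "fam a (Some (k, b)) f = dq a k b f"
  by (simp_all add: fam_def dq_eq_op2) (simp add: op2_def fun_eq_iff)

lemma finite_fam_index [simp]: "finite (fam_index a K)" by (simp add: fam_index_def)

lemma sum_fam_index:
  "(\<Sum>i\<in>(fam_index a K :: (nat \<times> 'a::euclidean_space) option set). F i) = F None + (\<Sum>b\<in>Basis. \<Sum>k\<in>ks a K. F (Some (k, b)))"
proof -
  have "(\<Sum>i\<in>Some ` (ks a K \<times> (Basis::'a set)). F i) = (\<Sum>(k, b)\<in>ks a K \<times> Basis. F (Some (k, b)))"
    by (subst sum.reindex) (auto intro!: inj_onI simp: case_prod_beta')
  also have "\<dots> = (\<Sum>k\<in>ks a K. \<Sum>b\<in>Basis. F (Some (k, b)))" by (rule sum.cartesian_product[symmetric])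
  also have "\<dots> = (\<Sum>b\<in>Basis. \<Sum>k\<in>ks a K. F (Some (k, b)))" by (rule sum.swap)
  finally show ?thesis unfolding fam_index_def by (subst sum.insert) auto
qed

lemma ws_fam: "ws a K f = (\<Sum>i\<in>fam_index a K. sqn (fam a i f))"
  by (simp add: sum_fam_index ws_def)

lemma fam_eq_op2:
  obtains c h d where "\<And>i f. fam a i f = op2 (c i) (h i) (d i) f"
proof
  show "fam a i f = op2 (case i of None \<Rightarrow> 1 | Some (k, b) \<Rightarrow> cf a k)
    (case i of None \<Rightarrow> 0 | Some (k, b) \<Rightarrow> (1/2) ^ k *\<^sub>R b) (case i of None \<Rightarrow> 0 | Some (k, b) \<Rightarrow> 1) f" for i f
    by (auto simp: fam_def split: option.splits)
qed

lemma l2_fam: "l2 f \<Longrightarrow> l2 (fam a i f)"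
  using fam_eq_op2[of a] l2_op2 by metis

lemma fam_measurable: "f \<in> borel_measurable borel \<Longrightarrow> fam a i f \<in> borel_measurable borel"
  using fam_eq_op2[of a] op2_measurable by metis

lemma fam_tendsto:
  fixes F :: "nat \<Rightarrow> 'a::euclidean_space \<Rightarrow> complex" and i :: "(nat \<times> 'a) option"
  assumes "AE x in lborel. (\<lambda>j. F j x) \<longlonglongrightarrow> f x"
  shows "AE x in lborel. (\<lambda>j. fam a i (F j) x) \<longlonglongrightarrow> fam a i f x"
proof -
  obtain c h d where e: "\<And>(i :: (nat \<times> 'a) option) f. fam a i f = op2 (c i) (h i) (d i) f" by (rule fam_eq_op2[of a]) blast
  show ?thesis unfolding e using assms AE_shift[OF assms, of "h i"]
    by eventually_elim (auto simp: op2_def intro!: tendsto_intros)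
qed

section \<open>Multiplication by cutoffs in the dyadic norm\<close>

lemma sqn_mono:
  assumes [measurable]: "f \<in> borel_measurable borel" and g: "l2 g" and le: "\<And>x. cmod (f x) \<le> cmod (g x)"
  shows "l2 f" "sqn f \<le> sqn g"
proof -
  have sq: "(cmod (f x))\<^sup>2 \<le> (cmod (g x))\<^sup>2" for x using le by (intro power_mono) auto
  have i: "integrable lborel (\<lambda>x. (cmod (f x))\<^sup>2)"
    by (rule Bochner_Integration.integrable_bound[OF l2_integrable[OF g]]) (use sq in auto)
  then show "l2 f" by (simp add: l2_def)
  show "sqn f \<le> sqn g" unfolding sqn_def by (intro integral_mono i l2_integrable g sq)
qed

lemma ip_split_right:
  assumes "l2 f" "l2 g" "l2 h"
  shows "ip f g = ip f (\<lambda>x. g x - h x) + ip f h"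
  unfolding ip_def using assms by (simp add: right_diff_distrib ip_integrable)

text \<open>The first two terms are localised by m, up to a shift by at most one step. The third is
  the cost of differencing m, quadratic in its Lipschitz constant, and thus vanishes for cutoffs on
  growing balls.\<close>

lemma ws_mult:
  fixes m f :: "'a::euclidean_space \<Rightarrow> complex" and L S :: real
  assumes f: "l2 f" and m: "m \<in> borel_measurable borel" "\<And>x. cmod (m x) \<le> 1"
    and L: "\<And>x y. cmod (m x - m y) \<le> L * norm (x - y)"
    and S: "(\<Sum>k\<in>ks a K. (cf a k)\<^sup>2 * ((1/2) ^ k)\<^sup>2) \<le> S"
  shows "ws a K (\<lambda>x. m x * f x) \<le> sqn (\<lambda>x. m x * f x)
     + 2 * (\<Sum>b\<in>Basis. \<Sum>k\<in>ks a K. sqn (\<lambda>x. m (x + (1/2) ^ k *\<^sub>R b) * dq a k b f x))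
     + 2 * (L\<^sup>2 * (DIM('a) * S) * sqn f)"
proof -
  let ?q = "\<lambda>k. (cf a k)\<^sup>2 * ((1/2) ^ k)\<^sup>2"
  have "(\<Sum>b\<in>Basis. \<Sum>k\<in>ks a K. sqn (dq a k b (\<lambda>x. m x * f x)))
    \<le> (\<Sum>b\<in>Basis. \<Sum>k\<in>ks a K. 2 * sqn (\<lambda>x. m (x + (1/2) ^ k *\<^sub>R b) * dq a k b f x) + 2 * (L\<^sup>2 * ?q k * sqn f))"
    by (intro sum_mono dq_mult_bound f m L) auto
  also have "\<dots> = 2 * (\<Sum>b\<in>Basis. \<Sum>k\<in>ks a K. sqn (\<lambda>x. m (x + (1/2) ^ k *\<^sub>R b) * dq a k b f x))
     + 2 * (L\<^sup>2 * (DIM('a) * (\<Sum>k\<in>ks a K. ?q k)) * sqn f)"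
    by (simp add: sum.distrib sum_distrib_left sum_distrib_right mult_ac)
  also have "2 * (L\<^sup>2 * (DIM('a) * (\<Sum>k\<in>ks a K. ?q k)) * sqn f) \<le> 2 * (L\<^sup>2 * (DIM('a) * S) * sqn f)"
    using S by (intro mult_left_mono mult_right_mono) auto
  finally show ?thesis by (simp add: ws_def)
qed

lemma hn_add_le:
  assumes f: "ha a f" and g: "ha a g"
  shows "hn a (\<lambda>x. f x + g x) \<le> 2 * hn a f + 2 * hn a g"
proof -
  note fl = ha_l2[OF f] and gl = ha_l2[OF g]
  note [measurable] = l2_measurable[OF l2_ft[OF fl]] l2_measurable[OF l2_ft[OF gl]] l2_measurable[OF l2_ft[OF l2_add(1)[OF fl gl]]]
  let ?r = "\<lambda>\<xi>. 2 * (jw a \<xi> * (cmod (ft f \<xi>))\<^sup>2) + 2 * (jw a \<xi> * (cmod (ft g \<xi>))\<^sup>2)"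
  have ir: "integrable lborel ?r" using f g by (simp add: ha_def)
  have le: "AE \<xi> in lborel. jw a \<xi> * (cmod (ft (\<lambda>x. f x + g x) \<xi>))\<^sup>2 \<le> ?r \<xi>"
    using ft_add[OF fl gl]
  proof eventually_elim
    case (elim \<xi>)
    have "jw a \<xi> * (cmod (ft f \<xi> + ft g \<xi>))\<^sup>2 \<le> jw a \<xi> * (2 * (cmod (ft f \<xi>))\<^sup>2 + 2 * (cmod (ft g \<xi>))\<^sup>2)"
      by (intro mult_left_mono norm_add_sq_le) (simp add: less_imp_le[OF jw_pos])
    then show ?case unfolding elim by (simp add: distrib_left mult_ac)
  qed
  have "integrable lborel (\<lambda>\<xi>. jw a \<xi> * (cmod (ft (\<lambda>x. f x + g x) \<xi>))\<^sup>2)"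
  proof (rule Bochner_Integration.integrable_bound[OF ir])
    show "AE \<xi> in lborel. norm (jw a \<xi> * (cmod (ft (\<lambda>x. f x + g x) \<xi>))\<^sup>2) \<le> norm (?r \<xi>)"
      using le by eventually_elim (simp add: abs_mult less_imp_le[OF jw_pos] order_trans[OF _ abs_ge_self])
  qed measurable
  then have "hn a (\<lambda>x. f x + g x) \<le> (LINT \<xi>|lborel. ?r \<xi>)"
    unfolding hn_def by (intro integral_mono_AE ir le)
  also have "\<dots> = 2 * hn a f + 2 * hn a g" using f g by (simp add: hn_def ha_def)
  finally show ?thesis .
qed

lemma hn_minus:
  assumes f: "l2 f" shows "hn a (\<lambda>x. - f x) = hn a f" "ha a (\<lambda>x. - f x) \<longleftrightarrow> ha a f"
proof -
  have m: "l2 (\<lambda>x. - f x)" using l2_cmult[OF f, of "-1"] by simp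
  note [measurable] = l2_measurable[OF l2_ft[OF f]] l2_measurable[OF l2_ft[OF m]]
  have e: "AE \<xi> in lborel. jw a \<xi> * (cmod (ft (\<lambda>x. - f x) \<xi>))\<^sup>2 = jw a \<xi> * (cmod (ft f \<xi>))\<^sup>2"
    using ft_cmult[OF f, of "-1"] by (auto simp: norm_minus_cancel)
  show "hn a (\<lambda>x. - f x) = hn a f" unfolding hn_def by (rule integral_cong_AE[OF _ _ e]) measurable
  have "integrable lborel (\<lambda>\<xi>. jw a \<xi> * (cmod (ft (\<lambda>x. - f x) \<xi>))\<^sup>2) = integrable lborel (\<lambda>\<xi>. jw a \<xi> * (cmod (ft f \<xi>))\<^sup>2)"
    by (rule integrable_cong_AE[OF _ _ e]) measurable
  then show "ha a (\<lambda>x. - f x) \<longleftrightarrow> ha a f" using f m by (simp add: ha_def)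
qed

locale cutoff_interaction = interaction a V \<Psi> \<phi> B
  for a :: real and V \<Psi> \<phi> :: "real \<Rightarrow> 'a::euclidean_space \<Rightarrow> complex" and B :: real +
  fixes chi :: "real \<Rightarrow> real" and \<alpha> L :: real
  assumes chi_range: "\<And>s. 0 \<le> chi s" "\<And>s. chi s \<le> 1"
    and chi_one: "\<And>s. 1 \<le> s \<Longrightarrow> chi s = 1" and chi_zero: "\<And>s. s \<le> 1/2 \<Longrightarrow> chi s = 0"
    and chi_lipschitz: "\<And>s r. \<bar>chi s - chi r\<bar> \<le> L * \<bar>s - r\<bar>"
    and alpha: "0 < \<alpha>" "\<alpha> < 1 - 2 / real DIM('a)"
begin

section \<open>Cutoffs at radius t^\<alpha> and the limit profile\<close>

definition cut_out :: "real \<Rightarrow> 'a \<Rightarrow> complex" where "cut_out t x = complex_of_real (chi (norm x / t powr \<alpha>))"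
definition cut_in :: "real \<Rightarrow> 'a \<Rightarrow> complex" where "cut_in t x = complex_of_real (1 - chi (norm x / t powr \<alpha>))"

lemma chi_measurable [measurable]: "chi \<in> borel_measurable borel"
proof -
  have "L-lipschitz_on UNIV chi"
    using chi_lipschitz chi_lipschitz[of 1 0] by (intro lipschitz_onI) (auto simp: dist_real_def)
  then show ?thesis by (intro borel_measurable_continuous_onI lipschitz_on_continuous_on)
qed

lemma cutoff_measurable [measurable]: "cut_out t \<in> borel_measurable borel" "cut_in t \<in> borel_measurable borel"
  unfolding cut_out_def[abs_def] cut_in_def[abs_def] by measurable

lemma cutoff_le_1: "cmod (cut_out t x) \<le> 1" "cmod (cut_in t x) \<le> 1"
  unfolding cut_out_def cut_in_def norm_of_real using chi_range by (auto simp: abs_le_iff intro: order_trans[of _ 0])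

lemma cutoff_lipschitz:
  assumes t: "0 < t"
  shows "cmod (cut_out t x - cut_out t y) \<le> (L / t powr \<alpha>) * norm (x - y)"
    "cmod (cut_in t x - cut_in t y) \<le> (L / t powr \<alpha>) * norm (x - y)"
proof -
  have L: "0 \<le> L" using chi_lipschitz[of 1 0] by simp
  have "\<bar>chi (norm x / t powr \<alpha>) - chi (norm y / t powr \<alpha>)\<bar> \<le> L * \<bar>norm x / t powr \<alpha> - norm y / t powr \<alpha>\<bar>"
    by (rule chi_lipschitz)
  also have "\<dots> = L / t powr \<alpha> * \<bar>norm x - norm y\<bar>" by (simp flip: diff_divide_distrib)
  also have "\<dots> \<le> L / t powr \<alpha> * norm (x - y)"
    using L by (intro mult_left_mono norm_triangle_ineq3) auto
  finally have *: "\<bar>chi (norm x / t powr \<alpha>) - chi (norm y / t powr \<alpha>)\<bar> \<le> (L / t powr \<alpha>) * norm (x - y)" .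
  then show "cmod (cut_out t x - cut_out t y) \<le> (L / t powr \<alpha>) * norm (x - y)"
    unfolding cut_out_def by (simp only: of_real_diff[symmetric] norm_of_real)
  from * show "cmod (cut_in t x - cut_in t y) \<le> (L / t powr \<alpha>) * norm (x - y)"
    unfolding cut_in_def of_real_diff[symmetric] norm_of_real by (simp add: abs_minus_commute)
qed

lemma inner_eq_0: "0 < t \<Longrightarrow> t powr \<alpha> \<le> norm x \<Longrightarrow> cut_in t x = 0"
  unfolding cut_in_def using chi_one[of "norm x / t powr \<alpha>"] by simp

lemma outer_eq_0: "0 < t \<Longrightarrow> norm x \<le> t powr \<alpha> / 2 \<Longrightarrow> cut_out t x = 0"
  unfolding cut_out_def using chi_zero[of "norm x / t powr \<alpha>"] by (simp add: field_simps)

lemma inner_plus_outer: "cut_in t x * z + cut_out t x * z = z"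
  by (simp add: cut_in_def cut_out_def algebra_simps)

text \<open>Dyadic times need only countably many exceptional null sets, and along them the
  increments are geometric. The local bound for increments does not involve the later time, so Fatou
  transfers it to the limit profile at every t > 0, with all scales included.\<close>

lemma exists_limit:
  obtains \<Omega> M D where "ha a \<Omega>" "0 < M" "0 < D" "sqn \<Omega> \<le> D"
    "\<And>t R K. 0 < t \<Longrightarrow> (\<Sum>i\<in>fam_index a K. sqn (trunc R (fam a i (\<lambda>x. \<Omega> x - \<phi> t x)))) \<le> (decay t * M)\<^sup>2 * measure lborel (ball 0 R :: 'a set)"
proof -
  obtain D where D: "D > 0" "\<And>u K. ws a K (\<phi> u) \<le> D" by (rule ws_bound) blast
  obtain M where M: "M > 0" "\<And>u. (LINT x|lborel. cmod (G u x)) \<le> M"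
    "\<And>u K. (LINT x|lborel. cmod (G u x))\<^sup>2 + (\<Sum>b\<in>Basis. \<Sum>k\<in>ks a K. (LINT x|lborel. cmod (dq a k b (G u) x))\<^sup>2) \<le> M\<^sup>2"
    by (rule G_family_bound) blast
  define F where "F j = \<phi> (2 ^ j)" for j :: nat
  have F: "l2 (F j)" for j unfolding F_def by (rule l2phi)
  note [measurable] = l2_measurable[OF F]
  \<comment> \<open>The factor by which \<open>decay\<close> shrinks when time doubles; below 1
    since n \<ge> 3.\<close>
  define r where "r = 2 powr (1 - real DIM('a) / 2)"
  have r: "0 \<le> r" "r < 1" using dim by (auto simp: r_def intro!: powr_less_one)
  define C where "C = decay 1 * M"
  have dec: "decay (2 ^ j) * M = C * r ^ j" for j
    unfolding decay_def C_def r_def by (simp add: powr_powr mult.commute flip: powr_realpow)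
  have "AE x in lborel. \<forall>j. cmod (F (Suc j) x - F j x) \<le> C * r ^ j"
    unfolding AE_all_countable F_def dec[symmetric]
    by (intro allI AE_increment_bound) (use M in auto)
  then have conv: "AE x in lborel. convergent (\<lambda>j. F j x)"
    by eventually_elim (use r in \<open>auto intro: geometric_increments_convergent\<close>)
  define \<Omega> where "\<Omega> x = lim (\<lambda>j. F j x)" for x
  have [measurable]: "\<Omega> \<in> borel_measurable borel" unfolding \<Omega>_def[abs_def] by measurable
  have lim: "AE x in lborel. (\<lambda>j. F j x) \<longlonglongrightarrow> \<Omega> x"
    using conv by eventually_elim (simp add: convergent_LIMSEQ_iff \<Omega>_def)
  have b: "(\<Sum>i\<in>fam_index a K. sqn (fam a i (F j))) \<le> D" for j K
    using D(2)[of K "2 ^ j"] by (simp add: ws_fam F_def)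
  have Om: "\<And>i. i \<in> fam_index a K \<Longrightarrow> l2 (fam a i \<Omega>)" "(\<Sum>i\<in>fam_index a K. sqn (fam a i \<Omega>)) \<le> D" for K
    by (rule Fatou_sum[where F="\<lambda>j i. fam a i (F j)" and I="fam_index a K", OF _ _ b];
        simp add: l2_fam F fam_measurable fam_tendsto lim)+
  have n: "None \<in> (fam_index a K :: (nat \<times> 'a) option set)" for K by (simp add: fam_index_def)
  have l2Om: "l2 \<Omega>" using Om(1)[OF n] by simp
  have wsOm: "ws a K \<Omega> \<le> D" for K unfolding ws_fam by (rule Om(2))
  obtain C2 where C2: "C2 > 0" "\<And>(f::'a \<Rightarrow> complex) B. l2 f \<Longrightarrow> (\<And>K. ws a K f \<le> B) \<Longrightarrow> ha a f \<and> hn a f \<le> C2 * B"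
    by (rule ha_of_ws[OF a]) blast
  have haOm: "ha a \<Omega>" using C2(2)[OF l2Om wsOm] by blast
  have sqOm: "sqn \<Omega> \<le> D"
  proof -
    have "0 \<le> (\<Sum>b\<in>(Basis::'a set). \<Sum>k\<in>ks a 0. sqn (dq a k b \<Omega>))" by (intro sum_nonneg) simp
    then show ?thesis using wsOm[of 0] by (simp add: ws_def)
  qed
  have loc: "(\<Sum>i\<in>fam_index a K. sqn (trunc R (fam a i (\<lambda>x. \<Omega> x - \<phi> t x)))) \<le> (decay t * M)\<^sup>2 * measure lborel (ball 0 R :: 'a set)"
    if t: "0 < t" for t R K
  proof -
    \<comment> \<open>The sequence is started past t, because \<open>local_l2_bound\<close> compares
      t with later times only.\<close>
    obtain J :: nat where J: "t < 2 ^ J" using real_arch_pow[of 2 t] by auto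
    let ?w = "\<lambda>j x. F (j + J) x - \<phi> t x"
    have w: "l2 (?w j)" for j by (intro l2_diff F l2phi)
    have wl: "AE x in lborel. (\<lambda>j. ?w j x) \<longlonglongrightarrow> \<Omega> x - \<phi> t x"
      using lim by eventually_elim (intro tendsto_intros LIMSEQ_ignore_initial_segment)
    obtain c h d where e: "\<And>(i :: (nat \<times> 'a) option) f. fam a i f = op2 (c i) (h i) (d i) f" by (rule fam_eq_op2[of a]) blast
    have Mf: "(\<Sum>i\<in>fam_index a K. (LINT x|lborel. cmod (op2 (c i) (h i) (d i) (G u) x))\<^sup>2) \<le> M\<^sup>2" for u
      using M(3)[of u K] unfolding e[symmetric] sum_fam_index by simp
    have b: "(\<Sum>i\<in>fam_index a K. sqn (trunc R (fam a i (?w j)))) \<le> (decay t * M)\<^sup>2 * measure lborel (ball 0 R :: 'a set)" for j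
    proof -
      have "t \<le> 2 ^ (j + J)"
        by (rule order_trans[OF less_imp_le[OF J] power_increasing]) auto
      from local_l2_bound[OF _ _ Mf t this, where R=R] show ?thesis
        using M(1) unfolding e F_def by simp
    qed
    show ?thesis
    proof (rule Fatou_sum(2)[where F="\<lambda>j i. trunc R (fam a i (?w j))", OF _ _ b])
      show "trunc R (fam a i (\<lambda>x. \<Omega> x - \<phi> t x)) \<in> borel_measurable borel" for i
        by (intro trunc_measurable fam_measurable l2_measurable l2_diff l2Om l2phi)
      show "AE x in lborel. (\<lambda>j. trunc R (fam a i (?w j)) x) \<longlonglongrightarrow> trunc R (fam a i (\<lambda>x. \<Omega> x - \<phi> t x)) x" for i
        using fam_tendsto[OF wl, of a i] by eventually_elim (auto simp: trunc_def)
    qed (auto intro: l2_trunc l2_fam w)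
  qed
  show ?thesis by (rule that[OF haOm M(1) D(1) sqOm loc])
qed

lemma ws_constants:
  obtains C S where "0 < C" "\<And>(f::'a \<Rightarrow> complex) B. l2 f \<Longrightarrow> (\<And>K. ws a K f \<le> B) \<Longrightarrow> ha a f \<and> hn a f \<le> C * B"
    "0 < S" "\<And>K. (\<Sum>k\<in>ks a K. (cf a k)\<^sup>2 * ((1/2) ^ k)\<^sup>2) \<le> S"
proof -
  obtain C where C: "C > 0" "\<And>(f::'a \<Rightarrow> complex) B. l2 f \<Longrightarrow> (\<And>K. ws a K f \<le> B) \<Longrightarrow> ha a f \<and> hn a f \<le> C * B"
    by (rule ha_of_ws[OF a]) blast
  obtain S where S: "S > 0" "\<And>K. (\<Sum>k\<in>ks a K. (cf a k)\<^sup>2 * ((1/2) ^ k)\<^sup>2) \<le> S"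
    by (rule ks_sum_bound[OF a]) blast
  show ?thesis by (rule that[OF C S])
qed

section \<open>Vanishing of the inner difference and of the outer tail in H^a\<close>

lemma powr_alpha_at_top: "filterlim (\<lambda>t. t powr \<alpha>) at_top at_top"
proof -
  have "((\<lambda>t. t powr (- \<alpha>)) \<longlongrightarrow> 0) at_top"
    using alpha by (intro tendsto_neg_powr filterlim_ident) auto
  moreover have "eventually (\<lambda>t. 0 < t powr (- \<alpha>)) at_top"
    using eventually_gt_at_top[of 0] by eventually_elim simp
  ultimately have "filterlim (\<lambda>t. inverse (t powr (- \<alpha>))) at_top at_top"
    by (rule filterlim_inverse_at_top)
  then show ?thesis by (simp add: powr_minus)
qed

lemma lipschitz_const_tendsto: "((\<lambda>t. (L / t powr \<alpha>)\<^sup>2) \<longlongrightarrow> 0) at_top"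
proof -
  have "((\<lambda>t. L / t powr \<alpha>) \<longlongrightarrow> 0) at_top"
    by (rule tendsto_divide_0[OF tendsto_const filterlim_at_top_imp_at_infinity[OF powr_alpha_at_top]])
  from tendsto_power[OF this, of 2] show ?thesis by simp
qed

lemma l2_inner: "l2 f \<Longrightarrow> l2 (\<lambda>x. cut_in t x * f x)" and l2_outer: "l2 f \<Longrightarrow> l2 (\<lambda>x. cut_out t x * f x)"
  by (intro l2_bounded_mult1 cutoff_le_1; simp)+

text \<open>The squared decay contributes the exponent 2 - n and the volume \<alpha> n. The radius
  exceeds t^\<alpha> by 2 to leave room for the shifted cutoffs of the difference quotients.\<close>

lemma local_volume_tendsto:
  "((\<lambda>t. (decay t * M)\<^sup>2 * measure lborel (ball 0 (t powr \<alpha> + 2) :: 'a set)) \<longlongrightarrow> 0) at_top"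
proof (rule tendsto_sandwich[where f="\<lambda>_. 0"])
  define n where "n = real DIM('a)"
  have n: "n \<ge> 3" using dim by (simp add: n_def)
  define c where "c = sqrt pi ^ DIM('a) / (2 * pi) ^ DIM('a) / (n / 2 - 1)"
  have dec: "decay t = c * t powr (1 - n / 2)" for t by (simp add: decay_def c_def n_def)
  define E where "E = 2 * (1 - n / 2) + \<alpha> * n"
  have "\<alpha> * n < (1 - 2 / n) * n" using alpha(2) n unfolding n_def[symmetric] by (intro mult_strict_right_mono) auto
  then have E: "E < 0" using n by (simp add: E_def left_diff_distrib)
  let ?b = "\<lambda>t. (c * M)\<^sup>2 * unit_ball_vol n * 3 ^ DIM('a) * t powr E"
  show "(?b \<longlongrightarrow> 0) at_top"
    by (intro tendsto_mult_right_zero tendsto_neg_powr E filterlim_ident)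
  show "\<forall>\<^sub>F t in at_top. (decay t * M)\<^sup>2 * measure lborel (ball 0 (t powr \<alpha> + 2) :: 'a set) \<le> ?b t"
    using eventually_ge_at_top[of 1]
  proof eventually_elim
    case (elim t)
    have t1: "1 \<le> t powr \<alpha>" using elim alpha by (intro ge_one_powr_ge_zero) auto
    have "measure lborel (ball 0 (t powr \<alpha> + 2) :: 'a set) = unit_ball_vol n * (t powr \<alpha> + 2) ^ DIM('a)"
      using content_ball[of "t powr \<alpha> + 2" "0::'a"] t1 by (simp add: n_def)
    \<comment> \<open>For t \<ge> 1 the margin 2 is at most 2 t^\<alpha>, hence the factor
      3.\<close>
    also have "\<dots> \<le> unit_ball_vol n * (3 * t powr \<alpha>) ^ DIM('a)"
      using t1 n by (intro mult_left_mono power_mono) auto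
    also have "(3 * t powr \<alpha>) ^ DIM('a) = 3 ^ DIM('a) * t powr (\<alpha> * n)"
      using elim by (simp add: power_mult_distrib n_def powr_powr flip: powr_realpow)
    finally have "(decay t * M)\<^sup>2 * measure lborel (ball 0 (t powr \<alpha> + 2) :: 'a set)
      \<le> (decay t * M)\<^sup>2 * (unit_ball_vol n * (3 ^ DIM('a) * t powr (\<alpha> * n)))" by (intro mult_left_mono) auto
    also have "\<dots> = (c * M)\<^sup>2 * unit_ball_vol n * 3 ^ DIM('a) * ((t powr (1 - n / 2))\<^sup>2 * t powr (\<alpha> * n))"
      by (simp add: dec power_mult_distrib mult_ac)
    also have "(t powr (1 - n / 2))\<^sup>2 * t powr (\<alpha> * n) = t powr E"
      by (simp add: E_def power2_eq_square flip: powr_add) 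
    finally show ?case .
  qed
qed auto

text \<open>Inside the ball the local bound controls the function and all its quotients together.
  What remains is the cutoff's own difference, bounded by (L / t^\<alpha>)^2 times a uniform L^2
  bound on \<Omega> - \<phi>(t).\<close>

lemma inner_difference_tendsto:
  fixes \<Omega> :: "'a \<Rightarrow> complex"
  assumes Om: "l2 \<Omega>"
    and loc: "\<And>t R K. 0 < t \<Longrightarrow> (\<Sum>i\<in>fam_index a K. sqn (trunc R (fam a i (\<lambda>x. \<Omega> x - \<phi> t x)))) \<le> (decay t * M)\<^sup>2 * measure lborel (ball 0 R :: 'a set)"
  shows "((\<lambda>t. hn a (\<lambda>x. cut_in t x * (\<Omega> x - \<phi> t x))) \<longlongrightarrow> 0) at_top"
    and "eventually (\<lambda>t. ha a (\<lambda>x. cut_in t x * (\<Omega> x - \<phi> t x))) at_top"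
proof -
  obtain C S where CS: "0 < C" "\<And>(f::'a \<Rightarrow> complex) B. l2 f \<Longrightarrow> (\<And>K. ws a K f \<le> B) \<Longrightarrow> ha a f \<and> hn a f \<le> C * B"
    "0 < S" "\<And>K. (\<Sum>k\<in>ks a K. (cf a k)\<^sup>2 * ((1/2) ^ k)\<^sup>2) \<le> S" by (rule ws_constants) blast
  obtain D where D: "D > 0" "\<And>u K. ws a K (\<phi> u) \<le> D" by (rule ws_bound) blast
  have sqphi: "sqn (\<phi> t) \<le> D" for t
  proof -
    have "0 \<le> (\<Sum>b\<in>(Basis::'a set). \<Sum>k\<in>ks a 0. sqn (dq a k b (\<phi> t)))" by (intro sum_nonneg) simp
    then show ?thesis using D(2)[of 0 t] by (simp add: ws_def)
  qed
  define E where "E = 2 * sqn \<Omega> + 2 * D"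
  define \<beta> where "\<beta> t = 2 * ((decay t * M)\<^sup>2 * measure lborel (ball 0 (t powr \<alpha> + 2) :: 'a set))
     + 2 * ((L / t powr \<alpha>)\<^sup>2 * (DIM('a) * S) * E)" for t
  have key: "ws a K (\<lambda>x. cut_in t x * (\<Omega> x - \<phi> t x)) \<le> \<beta> t" if t: "0 < t" for t K
  proof -
    define w where "w x = \<Omega> x - \<phi> t x" for x
    have w: "l2 w" unfolding w_def by (intro l2_diff Om l2phi)
    have sqw: "sqn w \<le> E" unfolding w_def E_def using l2_diff(2)[OF Om l2phi, of t] sqphi[of t] by linarith
    let ?R = "t powr \<alpha> + 2"
    \<comment> \<open>The steps 2^(-k) have length at most 1, so a shifted inner cutoff vanishes
      beyond radius t^\<alpha> + 1, inside the ball \<open>?R\<close>.\<close>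
    have tr: "sqn (\<lambda>x. cut_in t (x + h) * f x) \<le> sqn (trunc ?R f)" if f: "l2 f" and h: "norm h \<le> 1" for h f
    proof (rule sqn_mono(2)[OF _ l2_trunc[OF f]])
      note [measurable] = l2_measurable[OF f]
      show "(\<lambda>x. cut_in t (x + h) * f x) \<in> borel_measurable borel" by measurable
      fix x
      show "cmod (cut_in t (x + h) * f x) \<le> cmod (trunc ?R f x)"
      proof (cases "norm x < ?R")
        case True
        then have "trunc ?R f x = f x" by (simp add: trunc_def)
        then show ?thesis using cutoff_le_1(2)[of t "x + h"] by (simp add: norm_mult mult_left_le_one_le)
      next
        case False
        then have "norm (x + h) \<ge> t powr \<alpha>" using h norm_triangle_ineq4[of "x + h" h] by simp
        then show ?thesis using inner_eq_0[OF t] by simp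
      qed
    qed
    have sq1: "sqn (\<lambda>x. cut_in t x * w x) \<le> sqn (trunc ?R w)" using tr[OF w, of 0] by simp
    have sq2: "(\<Sum>b\<in>Basis. \<Sum>k\<in>ks a K. sqn (\<lambda>x. cut_in t (x + (1/2) ^ k *\<^sub>R b) * dq a k b w x))
       \<le> (\<Sum>b\<in>Basis. \<Sum>k\<in>ks a K. sqn (trunc ?R (dq a k b w)))"
      by (intro sum_mono tr l2_dq w) (auto simp: power_le_one)
    have "sqn (trunc ?R w) + (\<Sum>b\<in>Basis. \<Sum>k\<in>ks a K. sqn (trunc ?R (dq a k b w))) \<le> (decay t * M)\<^sup>2 * measure lborel (ball 0 ?R :: 'a set)"
      using loc[OF t, where R="?R" and K=K] unfolding sum_fam_index w_def[symmetric] by simp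
    moreover have "ws a K (\<lambda>x. cut_in t x * w x) \<le> sqn (\<lambda>x. cut_in t x * w x)
     + 2 * (\<Sum>b\<in>Basis. \<Sum>k\<in>ks a K. sqn (\<lambda>x. cut_in t (x + (1/2) ^ k *\<^sub>R b) * dq a k b w x))
     + 2 * ((L / t powr \<alpha>)\<^sup>2 * (DIM('a) * S) * sqn w)"
      by (intro ws_mult w cutoff_le_1 cutoff_lipschitz t CS) simp
    moreover have "2 * ((L / t powr \<alpha>)\<^sup>2 * (DIM('a) * S) * sqn w) \<le> 2 * ((L / t powr \<alpha>)\<^sup>2 * (DIM('a) * S) * E)"
      using sqw CS(3) by (intro mult_left_mono) auto
    ultimately show ?thesis using sq1 sq2 sqn_nonneg[of "trunc ?R w"] unfolding \<beta>_def w_def by linarith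
  qed
  have \<beta>0: "(\<beta> \<longlongrightarrow> 0) at_top"
  proof -
    have "((\<lambda>t. 2 * ((decay t * M)\<^sup>2 * measure lborel (ball 0 (t powr \<alpha> + 2) :: 'a set))
     + 2 * ((L / t powr \<alpha>)\<^sup>2 * (DIM('a) * S) * E)) \<longlongrightarrow> 2 * 0 + 2 * (0 * (DIM('a) * S) * E)) at_top"
      by (intro tendsto_intros local_volume_tendsto lipschitz_const_tendsto)
    then show ?thesis by (simp add: \<beta>_def[abs_def])
  qed
  have res: "ha a (\<lambda>x. cut_in t x * (\<Omega> x - \<phi> t x)) \<and> hn a (\<lambda>x. cut_in t x * (\<Omega> x - \<phi> t x)) \<le> C * \<beta> t" if "0 < t" for t
    by (rule CS(2)[OF l2_inner[OF l2_diff(1)[OF Om l2phi]] key[OF that]])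
  show "eventually (\<lambda>t. ha a (\<lambda>x. cut_in t x * (\<Omega> x - \<phi> t x))) at_top"
    using eventually_gt_at_top[of 0] by eventually_elim (use res in blast)
  show "((\<lambda>t. hn a (\<lambda>x. cut_in t x * (\<Omega> x - \<phi> t x))) \<longlongrightarrow> 0) at_top"
  proof (rule tendsto_sandwich[where f="\<lambda>_. 0" and h="\<lambda>t. C * \<beta> t"])
    show "\<forall>\<^sub>F t in at_top. hn a (\<lambda>x. cut_in t x * (\<Omega> x - \<phi> t x)) \<le> C * \<beta> t"
      using eventually_gt_at_top[of 0] by eventually_elim (use res in blast)
    show "((\<lambda>t. C * \<beta> t) \<longlongrightarrow> 0) at_top" by (rule tendsto_mult_right_zero[OF \<beta>0])
  qed auto
qed

text \<open>The outer cutoff vanishes up to half of t^\<alpha>; subtracting 1 accounts for a shift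
  by at most 1.\<close>

lemma outer_shift_le:
  assumes f: "l2 f" and t: "0 < t" and h: "norm h \<le> 1"
  shows "sqn (\<lambda>x. cut_out t (x + h) * f x) \<le> sqn (\<lambda>x. f x - trunc (t powr \<alpha> / 2 - 1) f x)"
proof (rule sqn_mono(2)[OF _ l2_diff(1)[OF f l2_trunc[OF f]]])
  note [measurable] = l2_measurable[OF f]
  show "(\<lambda>x. cut_out t (x + h) * f x) \<in> borel_measurable borel" by measurable
  fix x
  show "cmod (cut_out t (x + h) * f x) \<le> cmod (f x - trunc (t powr \<alpha> / 2 - 1) f x)"
  proof (cases "norm x < t powr \<alpha> / 2 - 1")
    case True
    then have "norm (x + h) \<le> t powr \<alpha> / 2" using h norm_triangle_ineq[of x h] by simp
    then show ?thesis using outer_eq_0[OF t] by simp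
  next
    case False
    then show ?thesis using cutoff_le_1(1)[of t "x + h"] by (simp add: trunc_def norm_mult mult_left_le_one_le)
  qed
qed

lemma radius_at_top: "filterlim (\<lambda>t. t powr \<alpha> / 2 - 1) at_top at_top"
proof -
  have "filterlim (\<lambda>t. (1/2) * t powr \<alpha>) at_top at_top"
    by (rule filterlim_tendsto_pos_mult_at_top[OF tendsto_const _ powr_alpha_at_top]) simp
  from filterlim_tendsto_add_at_top[OF tendsto_const[of "-1"] this] show ?thesis by simp
qed

text \<open>For a fixed f in H^a the tails of f and of all its quotients vanish uniformly in the
  scale parameter by \<open>dq_tail\<close>, and the cutoff's own difference vanishes with its
  Lipschitz constant.\<close>

lemma outer_tendsto:
  fixes f :: "'a \<Rightarrow> complex"
  assumes f: "ha a f"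
  shows "((\<lambda>t. hn a (\<lambda>x. cut_out t x * f x)) \<longlongrightarrow> 0) at_top"
    and "eventually (\<lambda>t. ha a (\<lambda>x. cut_out t x * f x)) at_top"
proof -
  obtain C S where CS: "0 < C" "\<And>(f::'a \<Rightarrow> complex) B. l2 f \<Longrightarrow> (\<And>K. ws a K f \<le> B) \<Longrightarrow> ha a f \<and> hn a f \<le> C * B"
    "0 < S" "\<And>K. (\<Sum>k\<in>ks a K. (cf a k)\<^sup>2 * ((1/2) ^ k)\<^sup>2) \<le> S" by (rule ws_constants) blast
  note fl = ha_l2[OF f]
  have main: "eventually (\<lambda>t. ha a (\<lambda>x. cut_out t x * f x) \<and> hn a (\<lambda>x. cut_out t x * f x) \<le> C * (4 * e)) at_top" if e: "0 < e" for e
  proof -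
    let ?r = "\<lambda>t. t powr \<alpha> / 2 - 1"
    have "eventually (\<lambda>r. sqn (\<lambda>x. f x - trunc r f x) < e) at_top"
      by (rule order_tendstoD(2)[OF sqn_trunc_tendsto[OF fl] e])
    then have 1: "eventually (\<lambda>t. sqn (\<lambda>x. f x - trunc (?r t) f x) < e) at_top"
      by (rule eventually_compose_filterlim[OF _ radius_at_top])
    have 2: "eventually (\<lambda>t. \<forall>K. (\<Sum>b\<in>Basis. \<Sum>k\<in>ks a K. sqn (\<lambda>x. dq a k b f x - trunc (?r t) (dq a k b f) x)) \<le> e) at_top"
      by (rule eventually_compose_filterlim[OF dq_tail[OF a f e] radius_at_top])
    have "((\<lambda>t. 2 * ((L / t powr \<alpha>)\<^sup>2 * (DIM('a) * S) * sqn f)) \<longlongrightarrow> 2 * (0 * (DIM('a) * S) * sqn f)) at_top"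
      by (intro tendsto_intros lipschitz_const_tendsto)
    then have 3: "eventually (\<lambda>t. 2 * ((L / t powr \<alpha>)\<^sup>2 * (DIM('a) * S) * sqn f) < e) at_top"
      by (rule order_tendstoD) (use e in simp)
    show ?thesis using 1 2 3 eventually_gt_at_top[of 0]
    proof eventually_elim
      case (elim t)
      \<comment> \<open>4 = 1 + 2 + 1: the function, twice the quotients, and the Lipschitz
        term.\<close>
      have "ws a K (\<lambda>x. cut_out t x * f x) \<le> 4 * e" for K
      proof -
        have "ws a K (\<lambda>x. cut_out t x * f x) \<le> sqn (\<lambda>x. cut_out t x * f x)
          + 2 * (\<Sum>b\<in>Basis. \<Sum>k\<in>ks a K. sqn (\<lambda>x. cut_out t (x + (1/2) ^ k *\<^sub>R b) * dq a k b f x))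
          + 2 * ((L / t powr \<alpha>)\<^sup>2 * (DIM('a) * S) * sqn f)"
          by (intro ws_mult fl cutoff_le_1 cutoff_lipschitz elim CS) simp
        moreover have "sqn (\<lambda>x. cut_out t x * f x) \<le> sqn (\<lambda>x. f x - trunc (?r t) f x)"
          using outer_shift_le[OF fl elim(4), of 0] by simp
        moreover have "(\<Sum>b\<in>Basis. \<Sum>k\<in>ks a K. sqn (\<lambda>x. cut_out t (x + (1/2) ^ k *\<^sub>R b) * dq a k b f x))
            \<le> (\<Sum>b\<in>Basis. \<Sum>k\<in>ks a K. sqn (\<lambda>x. dq a k b f x - trunc (?r t) (dq a k b f) x))"
          by (intro sum_mono outer_shift_le l2_dq fl elim) (auto simp: power_le_one)
        moreover have "(\<Sum>b\<in>Basis. \<Sum>k\<in>ks a K. sqn (\<lambda>x. dq a k b f x - trunc (?r t) (dq a k b f) x)) \<le> e"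
          using elim(2) by blast
        ultimately show ?thesis using elim(1,3) by linarith
      qed
      from CS(2)[OF l2_outer[OF fl] this] show ?case .
    qed
  qed
  show "eventually (\<lambda>t. ha a (\<lambda>x. cut_out t x * f x)) at_top"
    using main[of 1] by (auto elim: eventually_mono)
  show "((\<lambda>t. hn a (\<lambda>x. cut_out t x * f x)) \<longlongrightarrow> 0) at_top"
  proof (rule tendstoI)
    fix e :: real assume e: "0 < e"
    \<comment> \<open>The bound of \<open>main\<close> then becomes e/2, strictly below e.\<close>
    then have "0 < e / (8 * C)" using CS(1) by simp
    from main[OF this] show "\<forall>\<^sub>F t in at_top. dist (hn a (\<lambda>x. cut_out t x * f x)) 0 < e"
      by eventually_elim (use e CS(1) in \<open>auto simp: field_simps\<close>)
  qed
qed

text \<open>From t = 1 on the cutoffs share the Lipschitz constant L, so multiplication by them is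
  bounded on H^a uniformly in t. Boundedness is all that a weak limit asks of the moving
  factor.\<close>

lemma outer_phi_bounded:
  obtains H where "0 < H" "\<And>t. 1 \<le> t \<Longrightarrow> ha a (\<lambda>x. cut_out t x * \<phi> t x) \<and> hn a (\<lambda>x. cut_out t x * \<phi> t x) \<le> H"
proof -
  obtain C S where CS: "0 < C" "\<And>(f::'a \<Rightarrow> complex) B. l2 f \<Longrightarrow> (\<And>K. ws a K f \<le> B) \<Longrightarrow> ha a f \<and> hn a f \<le> C * B"
    "0 < S" "\<And>K. (\<Sum>k\<in>ks a K. (cf a k)\<^sup>2 * ((1/2) ^ k)\<^sup>2) \<le> S" by (rule ws_constants) blast
  obtain D where D: "D > 0" "\<And>u K. ws a K (\<phi> u) \<le> D" by (rule ws_bound) blast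
  define H where "H = 2 * D + 2 * (L\<^sup>2 * (DIM('a) * S) * D)"
  have H: "H > 0" unfolding H_def using D(1) CS(3) by (intro add_pos_nonneg) auto
  have L0: "0 \<le> L" using chi_lipschitz[of 1 0] by simp
  have "ws a K (\<lambda>x. cut_out t x * \<phi> t x) \<le> H" if t: "1 \<le> t" for t K
  proof -
    have t1: "1 \<le> t powr \<alpha>" using t alpha by (intro ge_one_powr_ge_zero) auto
    have l: "cmod (cut_out t x - cut_out t y) \<le> L * norm (x - y)" for x y
    proof -
      have "L / t powr \<alpha> \<le> L" using t1 L0 by (simp add: divide_le_eq mult_le_cancel_left1)
      then have "(L / t powr \<alpha>) * norm (x - y) \<le> L * norm (x - y)" by (intro mult_right_mono) auto
      with cutoff_lipschitz(1)[of t x y] t show ?thesis by linarith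
    qed
    have "ws a K (\<lambda>x. cut_out t x * \<phi> t x) \<le> sqn (\<lambda>x. cut_out t x * \<phi> t x)
          + 2 * (\<Sum>b\<in>Basis. \<Sum>k\<in>ks a K. sqn (\<lambda>x. cut_out t (x + (1/2) ^ k *\<^sub>R b) * dq a k b (\<phi> t) x))
          + 2 * (L\<^sup>2 * (DIM('a) * S) * sqn (\<phi> t))"
      by (intro ws_mult l2phi cutoff_le_1 l CS) simp
    moreover have "sqn (\<lambda>x. cut_out t x * \<phi> t x) \<le> sqn (\<phi> t)"
      by (intro l2_bounded_mult1 l2phi cutoff_le_1) simp
    moreover have "(\<Sum>b\<in>Basis. \<Sum>k\<in>ks a K. sqn (\<lambda>x. cut_out t (x + (1/2) ^ k *\<^sub>R b) * dq a k b (\<phi> t) x))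
       \<le> (\<Sum>b\<in>Basis. \<Sum>k\<in>ks a K. sqn (dq a k b (\<phi> t)))"
      by (intro sum_mono l2_bounded_mult1 l2_dq l2phi cutoff_le_1) measurable
    moreover have wsD: "sqn (\<phi> t) + (\<Sum>b\<in>Basis. \<Sum>k\<in>ks a K. sqn (dq a k b (\<phi> t))) \<le> D"
      using D(2)[of K t] by (simp add: ws_def)
    moreover have "0 \<le> (\<Sum>b\<in>(Basis::'a set). \<Sum>k\<in>ks a K. sqn (dq a k b (\<phi> t)))" by (intro sum_nonneg) simp
    moreover have "2 * (L\<^sup>2 * (DIM('a) * S) * sqn (\<phi> t)) \<le> 2 * (L\<^sup>2 * (DIM('a) * S) * D)"
      using CS(3) calculation(4,5) by (intro mult_left_mono) auto
    ultimately show ?thesis using sqn_nonneg[of "\<phi> t"] unfolding H_def by linarith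
  qed
  then have "ha a (\<lambda>x. cut_out t x * \<phi> t x) \<and> hn a (\<lambda>x. cut_out t x * \<phi> t x) \<le> C * H" if "1 \<le> t" for t
    using CS(2)[OF l2_outer[OF l2phi]] that by blast
  then show ?thesis using H CS(1) by (intro that[of "C * H"]) auto
qed

text \<open>The test function is split in frequency at R. Its high part is small in H^a and meets a
  bounded factor. On the low part the weight \<open>jw a\<close> is bounded, so the weighted
  function is the transform of some h in L^2; Parseval turns the pairing into one in L^2, where the
  cutoff can be moved onto h, whose tail vanishes.\<close>

lemma weak_limit:
  fixes g :: "'a \<Rightarrow> complex"
  assumes g: "ha a g"
  shows "((\<lambda>t. LINT \<xi>|lborel. complex_of_real (jw a \<xi>) * cnj (ft g \<xi>) * ft (\<lambda>x. cut_out t x * \<phi> t x) \<xi>) \<longlongrightarrow> 0) at_top"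
proof -
  define \<kappa> where "\<kappa> = (2 * pi :: real) ^ DIM('a)"
  have \<kappa>: "\<kappa> > 0" by (simp add: \<kappa>_def)
  obtain H where H: "0 < H" "\<And>t. 1 \<le> t \<Longrightarrow> ha a (\<lambda>x. cut_out t x * \<phi> t x) \<and> hn a (\<lambda>x. cut_out t x * \<phi> t x) \<le> H"
    by (rule outer_phi_bounded) blast
  obtain D where D: "D > 0" "\<And>u K. ws a K (\<phi> u) \<le> D" by (rule ws_bound) blast
  have sqphi: "sqn (\<phi> t) \<le> D" for t
  proof -
    have "0 \<le> (\<Sum>b\<in>(Basis::'a set). \<Sum>k\<in>ks a 0. sqn (dq a k b (\<phi> t)))" by (intro sum_nonneg) simp
    then show ?thesis using D(2)[of 0 t] by (simp add: ws_def)
  qed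
  \<comment> \<open>Multiplying transforms by the square root of the weight turns the H^a pairing
    into an L^2 pairing, so \<open>ip_bound\<close> applies.\<close>
  define sj where "sj \<xi> = complex_of_real (sqrt (jw a \<xi>))" for \<xi> :: 'a
  have [measurable]: "sj \<in> borel_measurable borel" unfolding sj_def[abs_def] by measurable
  have sj2: "sj \<xi> * sj \<xi> = complex_of_real (jw a \<xi>)" for \<xi>
    unfolding sj_def of_real_mult[symmetric] by (simp add: less_imp_le[OF jw_pos])
  have wl: "l2 (\<lambda>\<xi>. sj \<xi> * ft f \<xi>)" "sqn (\<lambda>\<xi>. sj \<xi> * ft f \<xi>) = hn a f" if f: "ha a f" for f :: "'a \<Rightarrow> complex"
  proof -
    note [measurable] = l2_measurable[OF l2_ft[OF ha_l2[OF f]]]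
    have e: "(cmod (sj \<xi> * ft f \<xi>))\<^sup>2 = jw a \<xi> * (cmod (ft f \<xi>))\<^sup>2" for \<xi>
      by (simp add: sj_def norm_mult power_mult_distrib less_imp_le[OF jw_pos])
    show "l2 (\<lambda>\<xi>. sj \<xi> * ft f \<xi>)" unfolding l2_def e using f by (simp add: ha_def)
    show "sqn (\<lambda>\<xi>. sj \<xi> * ft f \<xi>) = hn a f" unfolding sqn_def e hn_def ..
  qed
  note [measurable] = l2_measurable[OF l2_ft[OF ha_l2[OF g]]]
  let ?g = "\<lambda>\<xi>. sj \<xi> * ft g \<xi>"
  let ?f = "\<lambda>t x. cut_out t x * \<phi> t x"
  let ?I = "\<lambda>t. LINT \<xi>|lborel. complex_of_real (jw a \<xi>) * cnj (ft g \<xi>) * ft (?f t) \<xi>"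
  have fl: "l2 (?f t)" for t by (rule l2_outer[OF l2phi])
  have split: "(cmod (?I t))\<^sup>2 \<le> 2 * (H * sqn (\<lambda>x. ?g x - trunc R ?g x)) + 2 * (\<kappa>\<^sup>2 * (D * sqn (\<lambda>x. h x - trunc (t powr \<alpha> / 2 - 1) h x)))"
    if t: "1 \<le> t" and h: "l2 h" "AE \<xi> in lborel. ft h \<xi> = complex_of_real (jw a \<xi>) * trunc R (ft g) \<xi>" for t R h
  proof -
    have fh: "ha a (?f t)" "hn a (?f t) \<le> H" using H(2)[OF t] by auto
    have tg: "l2 (trunc R ?g)" by (rule l2_trunc[OF wl(1)[OF g]])
    have "?I t = ip (\<lambda>\<xi>. sj \<xi> * ft (?f t) \<xi>) ?g"
    proof -
      have "cnj (sj \<xi>) = sj \<xi>" for \<xi> by (simp add: sj_def)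
      then show ?thesis unfolding ip_def sj2[symmetric]
        by (intro Bochner_Integration.integral_cong refl) (simp add: mult_ac)
    qed
    also have "\<dots> = ip (\<lambda>\<xi>. sj \<xi> * ft (?f t) \<xi>) (\<lambda>x. ?g x - trunc R ?g x) + ip (\<lambda>\<xi>. sj \<xi> * ft (?f t) \<xi>) (trunc R ?g)"
      by (rule ip_split_right) (intro wl fh g tg)+
    also have "ip (\<lambda>\<xi>. sj \<xi> * ft (?f t) \<xi>) (trunc R ?g) = ip (ft (?f t)) (ft h)"
      unfolding ip_def
    proof (rule integral_cong_AE)
      have [measurable]: "ft (?f t) \<in> borel_measurable borel" "ft h \<in> borel_measurable borel"
        using fl h(1) by (auto intro: l2_measurable)
      show "(\<lambda>x. ft (?f t) x * cnj (ft h x)) \<in> borel_measurable lborel"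
        "(\<lambda>\<xi>. sj \<xi> * ft (?f t) \<xi> * cnj (trunc R ?g \<xi>)) \<in> borel_measurable lborel" by measurable
      show "AE \<xi> in lborel. sj \<xi> * ft (?f t) \<xi> * cnj (trunc R ?g \<xi>) = ft (?f t) \<xi> * cnj (ft h \<xi>)"
        using h(2)
      proof eventually_elim
        case (elim \<xi>)
        have "cnj (sj \<xi>) = sj \<xi>" by (simp add: sj_def)
        then show ?case unfolding elim sj2[symmetric] by (simp add: trunc_def)
      qed
    qed
    also have "\<dots> = \<kappa> * ip (?f t) h" using parseval[OF fl h(1)] by (simp add: \<kappa>_def)
    finally have I: "?I t = ip (\<lambda>\<xi>. sj \<xi> * ft (?f t) \<xi>) (\<lambda>x. ?g x - trunc R ?g x) + \<kappa> * ip (?f t) h" .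
    have 1: "(cmod (ip (\<lambda>\<xi>. sj \<xi> * ft (?f t) \<xi>) (\<lambda>x. ?g x - trunc R ?g x)))\<^sup>2 \<le> H * sqn (\<lambda>x. ?g x - trunc R ?g x)"
    proof -
      have "(cmod (ip (\<lambda>\<xi>. sj \<xi> * ft (?f t) \<xi>) (\<lambda>x. ?g x - trunc R ?g x)))\<^sup>2 \<le> hn a (?f t) * sqn (\<lambda>x. ?g x - trunc R ?g x)"
        unfolding wl(2)[OF fh(1), symmetric] by (intro ip_bound wl fh g l2_diff tg)
      also have "\<dots> \<le> H * sqn (\<lambda>x. ?g x - trunc R ?g x)" by (intro mult_right_mono fh) simp
      finally show ?thesis .
    qed
    have "ip (?f t) h = ip (\<phi> t) (\<lambda>x. cut_out t (x + 0) * h x)"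
      unfolding ip_def by (simp add: cut_out_def mult_ac)
    then have "(cmod (ip (?f t) h))\<^sup>2 \<le> sqn (\<phi> t) * sqn (\<lambda>x. cut_out t (x + 0) * h x)"
      using ip_bound[OF l2phi l2_outer[OF h(1)], of t t] by simp
    also have "\<dots> \<le> D * sqn (\<lambda>x. h x - trunc (t powr \<alpha> / 2 - 1) h x)"
      using t D by (intro mult_mono sqphi outer_shift_le h) auto
    finally have 2: "(cmod (\<kappa> * ip (?f t) h))\<^sup>2 \<le> \<kappa>\<^sup>2 * (D * sqn (\<lambda>x. h x - trunc (t powr \<alpha> / 2 - 1) h x))"
      by (simp add: norm_mult power_mult_distrib mult_left_mono)
    show ?thesis
      using norm_add_sq_le[of "ip (\<lambda>\<xi>. sj \<xi> * ft (?f t) \<xi>) (\<lambda>x. ?g x - trunc R ?g x)" "\<kappa> * ip (?f t) h"] 1 2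
      unfolding I by linarith
  qed
  show ?thesis
  proof (rule tendstoI)
    fix e :: real assume e: "0 < e"
    have "((\<lambda>R. 2 * (H * sqn (\<lambda>x. ?g x - trunc R ?g x))) \<longlongrightarrow> 2 * (H * 0)) at_top"
      by (intro tendsto_intros sqn_trunc_tendsto wl(1)[OF g])
    then have "eventually (\<lambda>R. 2 * (H * sqn (\<lambda>x. ?g x - trunc R ?g x)) < e\<^sup>2 / 2) at_top"
      by (rule order_tendstoD) (use e in simp)
    with eventually_gt_at_top[of 0]
    have "eventually (\<lambda>R. 0 < R \<and> 2 * (H * sqn (\<lambda>x. ?g x - trunc R ?g x)) < e\<^sup>2 / 2) at_top"
      by eventually_elim simp
    then obtain R where R: "0 < R" "2 * (H * sqn (\<lambda>x. ?g x - trunc R ?g x)) < e\<^sup>2 / 2"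
      by (auto simp: eventually_at_top_linorder)
    \<comment> \<open>On |\<xi>| < R the weight is at most (1 + R^2)^a; this is what the frequency
      truncation buys.\<close>
    have q: "l2 (\<lambda>\<xi>. complex_of_real (jw a \<xi>) * trunc R (ft g) \<xi>)"
    proof (rule sqn_mono(1))
      show "l2 (\<lambda>\<xi>. complex_of_real ((1 + R\<^sup>2) powr a) * ft g \<xi>)" by (intro l2_cmult l2_ft ha_l2[OF g])
      fix \<xi> :: 'a
      show "cmod (complex_of_real (jw a \<xi>) * trunc R (ft g) \<xi>) \<le> cmod (complex_of_real ((1 + R\<^sup>2) powr a) * ft g \<xi>)"
      proof (cases "norm \<xi> < R")
        case True
        then have "jw a \<xi> \<le> (1 + R\<^sup>2) powr a" unfolding jw_def using a by (intro powr_mono2) (auto intro!: power_mono)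
        then show ?thesis using jw_pos[of a \<xi>] True by (simp add: trunc_def norm_mult mult_right_mono)
      qed (simp add: trunc_def)
    qed measurable
    obtain h where h: "l2 h" "AE \<xi> in lborel. ft h \<xi> = complex_of_real (jw a \<xi>) * trunc R (ft g) \<xi>"
      by (rule ft_surj[OF q])
    have "((\<lambda>r. 2 * (\<kappa>\<^sup>2 * (D * sqn (\<lambda>x. h x - trunc r h x)))) \<longlongrightarrow> 2 * (\<kappa>\<^sup>2 * (D * 0))) at_top"
      by (intro tendsto_intros sqn_trunc_tendsto h)
    then have "eventually (\<lambda>r. 2 * (\<kappa>\<^sup>2 * (D * sqn (\<lambda>x. h x - trunc r h x))) < e\<^sup>2 / 2) at_top"
      by (rule order_tendstoD) (use e in simp)
    then have "eventually (\<lambda>t. 2 * (\<kappa>\<^sup>2 * (D * sqn (\<lambda>x. h x - trunc (t powr \<alpha> / 2 - 1) h x))) < e\<^sup>2 / 2) at_top"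
      by (rule eventually_compose_filterlim[OF _ radius_at_top])
    then show "\<forall>\<^sub>F t in at_top. dist (?I t) 0 < e"
      using eventually_ge_at_top[of 1]
    proof eventually_elim
      case (elim t)
      have "(cmod (?I t))\<^sup>2 < e\<^sup>2" using split[OF elim(2) h] elim(1) R(2) by linarith
      then show ?case using e by (simp add: power2_less_imp_less)
    qed
  qed
qed

text \<open>The cutoff applied to \<phi>(t) is compared with \<Omega> through the inner part of
  \<Omega> - \<phi>(t), where the local estimate holds, and the outer part of \<Omega>, which is a
  fixed function. No decay of \<phi>(t) outside the ball is involved.\<close>

theorem free_channel_limit:
  obtains \<Omega> where "ha a \<Omega>" "((\<lambda>t. hn a (\<lambda>x. cut_in t x * \<phi> t x - \<Omega> x)) \<longlongrightarrow> 0) at_top"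
proof -
  obtain \<Omega> M D where Om: "ha a \<Omega>" and loc:
    "\<And>t R K. 0 < t \<Longrightarrow> (\<Sum>i\<in>fam_index a K. sqn (trunc R (fam a i (\<lambda>x. \<Omega> x - \<phi> t x)))) \<le> (decay t * M)\<^sup>2 * measure lborel (ball 0 R :: 'a set)"
    by (rule exists_limit) blast
  note Ol = ha_l2[OF Om]
  have A: "((\<lambda>t. hn a (\<lambda>x. cut_in t x * (\<Omega> x - \<phi> t x))) \<longlongrightarrow> 0) at_top"
    "eventually (\<lambda>t. ha a (\<lambda>x. cut_in t x * (\<Omega> x - \<phi> t x))) at_top"
    by (rule inner_difference_tendsto[OF Ol], rule loc, assumption)+
  note B = outer_tendsto[OF Om]
  have "((\<lambda>t. hn a (\<lambda>x. cut_in t x * \<phi> t x - \<Omega> x)) \<longlongrightarrow> 0) at_top"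
  proof (rule tendsto_sandwich[where f="\<lambda>_. 0"])
    show "((\<lambda>t. 2 * hn a (\<lambda>x. cut_in t x * (\<Omega> x - \<phi> t x)) + 2 * hn a (\<lambda>x. cut_out t x * \<Omega> x)) \<longlongrightarrow> 0) at_top"
      using tendsto_add[OF tendsto_mult_right_zero[OF A(1), of 2] tendsto_mult_right_zero[OF B(1), of 2]] by simp
    show "\<forall>\<^sub>F t in at_top. hn a (\<lambda>x. cut_in t x * \<phi> t x - \<Omega> x) \<le> 2 * hn a (\<lambda>x. cut_in t x * (\<Omega> x - \<phi> t x)) + 2 * hn a (\<lambda>x. cut_out t x * \<Omega> x)"
      using A(2) B(2)
    proof eventually_elim
      case (elim t)
      have eq: "(\<lambda>x. cut_in t x * \<phi> t x - \<Omega> x) = (\<lambda>x. - (cut_in t x * (\<Omega> x - \<phi> t x) + cut_out t x * \<Omega> x))"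
        using inner_plus_outer[of t _ "\<Omega> _"] by (auto simp: algebra_simps fun_eq_iff)
      show ?case unfolding eq
        using hn_add_le[OF elim] hn_minus(1)[OF l2_add(1)[OF ha_l2[OF elim(1)] ha_l2[OF elim(2)]]] by simp
    qed
  qed auto
  with Om show ?thesis by (rule that)
qed

end

section \<open>Transfer to the completed measure\<close>

text \<open>The cutoff is constant on both sides of [1/2, 1], so it is unchanged by first clamping
  its argument to this interval. Clamping does not increase distances, and on the compact interval
  the continuous derivative is bounded.\<close>

lemma smooth_cutoff_lipschitz:
  assumes sm: "smooth_real X" and one: "\<And>s. 1 \<le> s \<Longrightarrow> X s = 1" and zero: "\<And>s. s \<le> 1/2 \<Longrightarrow> X s = 0"
  shows "\<exists>L. \<forall>s r. \<bar>X s - X r\<bar> \<le> L * \<bar>s - r\<bar>"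
proof -
  have d0: "X differentiable (at x)" for x
    using sm[unfolded smooth_real_def, rule_format, of 0 x] by simp
  have d1: "deriv X differentiable (at x)" for x
    using sm[unfolded smooth_real_def, rule_format, of 1 x] by simp
  have D: "(X has_real_derivative deriv X x) (at x)" for x
    using d0[of x] by (metis DERIV_imp_deriv real_differentiable_def)
  have "continuous_on {1/2..1} (deriv X)"
    using d1 by (intro continuous_at_imp_continuous_on) (auto intro: differentiable_imp_continuous_within)
  then have "bounded (deriv X ` {1/2..1})"
    by (intro compact_imp_bounded compact_continuous_image) auto
  then obtain L where "\<forall>y\<in>deriv X ` {1/2..1}. norm y \<le> L"
    unfolding bounded_iff by blast
  then have L: "\<And>x. x \<in> {1/2..1} \<Longrightarrow> norm (deriv X x) \<le> L" by blast
  define c where "c s = max (1/2) (min 1 s)" for s :: real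
  have Xc: "X (c s) = X s" for s
    using one[of s] one[of 1] zero[of s] zero[of "1/2"] by (auto simp: c_def max_def min_def)
  have "\<bar>X s - X r\<bar> \<le> L * \<bar>s - r\<bar>" for s r
  proof -
    have "norm (X (c s) - X (c r)) \<le> L * norm (c s - c r)"
    proof (rule field_differentiable_bound[of "{1/2..1}" X "deriv X"])
      show "(X has_field_derivative deriv X z) (at z within {1/2..1})" for z
        by (rule has_field_derivative_at_within[OF D])
      show "norm (deriv X z) \<le> L" if "z \<in> {1/2..1}" for z by (rule L[OF that])
    qed (auto simp: c_def)
    also have "\<dots> \<le> L * \<bar>s - r\<bar>"
      using order_trans[OF norm_ge_zero L[of 1]] by (intro mult_left_mono) (auto simp: c_def)
    finally show ?thesis by (simp add: Xc)
  qed
  then show ?thesis by blast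
qed

section \<open>Joint measurability of the Duhamel integrand\<close>

lemma ft1_seq_continuous:
  assumes f: "integrable lborel f" and X: "X \<longlonglongrightarrow> \<xi>"
  shows "(\<lambda>n. ft1 f (X n)) \<longlonglongrightarrow> ft1 f \<xi>"
  unfolding ft1_def
proof (rule integral_dominated_convergence[where w="\<lambda>x. cmod (f x)"])
  have [measurable]: "f \<in> borel_measurable borel" using f by auto
  show "(\<lambda>x. cis (- (x \<bullet> \<xi>)) * f x) \<in> borel_measurable lborel"
    "(\<lambda>x. cis (- (x \<bullet> X n)) * f x) \<in> borel_measurable lborel" for n by measurable
  show "AE x in lborel. (\<lambda>n. cis (- (x \<bullet> X n)) * f x) \<longlonglongrightarrow> cis (- (x \<bullet> \<xi>)) * f x"
    unfolding cis_conv_exp by (intro AE_I2 tendsto_intros X)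
qed (use f in \<open>auto simp: norm_mult\<close>)

lemma null_set_complement_dense:
  fixes x :: "'a::euclidean_space"
  assumes "AE x in lborel. P x"
  obtains X where "\<And>n::nat. P (X n)" "X \<longlonglongrightarrow> x"
proof -
  have "\<exists>y. P y \<and> dist y x < inverse (real (Suc n))" for n
  proof (rule ccontr)
    let ?B = "ball x (inverse (real (Suc n)))"
    assume "\<not> ?thesis"
    then have "AE y in lborel. y \<notin> ?B" using assms by (auto simp: dist_commute elim: eventually_mono)
    then have "?B \<in> null_sets lborel" by (subst AE_iff_null_sets) auto
    then have "negligible ?B" by (simp add: negligible_iff_null_sets null_sets_completionI)
    then show False using open_not_negligible[of ?B] by simp
  qed
  then obtain X where X: "\<And>n. P (X n) \<and> dist (X n) x < inverse (real (Suc n))" by metis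
  have "(\<lambda>n. dist (X n) x) \<longlonglongrightarrow> 0"
  proof (rule tendsto_sandwich[OF _ _ tendsto_const LIMSEQ_inverse_real_of_nat])
    show "\<forall>\<^sub>F n in sequentially. dist (X n) x \<le> inverse (real (Suc n))"
      using X by (intro always_eventually allI less_imp_le) blast
  qed simp
  then have "X \<longlonglongrightarrow> x" by (rule tendsto_dist_iff[THEN iffD2])
  then show ?thesis by (rule that[rotated]) (use X in blast)
qed

text \<open>Duhamel's formula provides measurability in time only for almost every frequency. The
  complement of a null set is dense, so continuity in frequency extends it to every frequency, and
  approximating the frequency by simple functions makes it joint.\<close>

lemma caratheodory_measurable:
  fixes f :: "real \<Rightarrow> 'a::euclidean_space \<Rightarrow> complex"
  assumes m: "AE \<xi> in lborel. (\<lambda>u. f u \<xi>) \<in> borel_measurable borel"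
    and c: "\<And>u \<xi> X. X \<longlonglongrightarrow> \<xi> \<Longrightarrow> (\<lambda>n. f u (X n)) \<longlonglongrightarrow> f u \<xi>"
  shows "(\<lambda>(u, \<xi>). f u \<xi>) \<in> borel_measurable (borel \<Otimes>\<^sub>M borel)"
proof -
  have m': "(\<lambda>u. f u \<xi>) \<in> borel_measurable borel" for \<xi>
  proof -
    obtain X where X: "\<And>n::nat. (\<lambda>u. f u (X n)) \<in> borel_measurable borel" "X \<longlonglongrightarrow> \<xi>"
      by (rule null_set_complement_dense[OF m]) blast
    show ?thesis by (rule borel_measurable_LIMSEQ_metric[OF X(1)]) (rule c[OF X(2)])
  qed
  obtain s :: "nat \<Rightarrow> 'a \<Rightarrow> 'a" where s: "\<And>i. simple_function borel (s i)" "\<And>x. (\<lambda>i. s i x) \<longlonglongrightarrow> x"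
    using borel_measurable_implies_sequence_metric[of "\<lambda>x::'a. x" borel 0] by auto
  have si: "(\<lambda>(u, \<xi>). f u (s i \<xi>)) \<in> borel_measurable (borel \<Otimes>\<^sub>M borel)" for i
  proof -
    have fin: "finite (range (s i))" using simple_functionD(1)[OF s(1)[of i]] by simp
    have [measurable]: "s i -` {y} \<in> sets borel" for y using simple_functionD(2)[OF s(1)[of i]] by simp
    have [measurable]: "(\<lambda>u. f u y) \<in> borel_measurable borel" for y by (rule m')
    have "(\<lambda>(u, \<xi>). f u (s i \<xi>)) = (\<lambda>x. \<Sum>y\<in>range (s i). indicator (s i -` {y}) (snd x) * f (fst x) y)"
    proof
      fix x :: "real \<times> 'a"
      have "(\<Sum>y\<in>range (s i). indicator (s i -` {y}) (snd x) * f (fst x) y) = (\<Sum>y\<in>range (s i). if y = s i (snd x) then f (fst x) y else 0)"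
        by (intro sum.cong) (auto simp: indicator_def)
      also have "\<dots> = f (fst x) (s i (snd x))" using fin by simp
      finally show "(case x of (u, \<xi>) \<Rightarrow> f u (s i \<xi>)) = (\<Sum>y\<in>range (s i). indicator (s i -` {y}) (snd x) * f (fst x) y)"
        by (simp add: case_prod_beta')
    qed
    also have "\<dots> \<in> borel_measurable (borel \<Otimes>\<^sub>M borel)" by measurable
    finally show ?thesis .
  qed
  show ?thesis
    by (rule borel_measurable_LIMSEQ_metric[OF si]) (auto intro: c s(2))
qed

text \<open>L2, FT1 and fourier use the completed Lebesgue measure, whereas l2, ft1 and ft live on Borel functions.
  All of them only depend on the class modulo null sets, so the two sides are linked by Borel representatives.\<close>

definition rp :: "(real^'n::finite \<Rightarrow> complex) \<Rightarrow> (real^'n \<Rightarrow> complex) \<Rightarrow> bool" where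
  "rp f g \<longleftrightarrow> f \<in> borel_measurable lebesgue \<and> l2 g \<and> (AE x in lborel. f x = g x)"

section \<open>Borel representatives for objects over the completed measure\<close>

lemma borel_representative:
  fixes f :: "'a::euclidean_space \<Rightarrow> complex"
  assumes f: "f \<in> borel_measurable lebesgue"
  obtains g where "g \<in> borel_measurable borel" "AE x in lborel. f x = g x"
proof -
  have "(\<lambda>x. Re (f x)) \<in> borel_measurable lebesgue" "(\<lambda>x. Im (f x)) \<in> borel_measurable lebesgue"
    using f by measurable
  from this[THEN completion_ex_borel_measurable_real] obtain u v where
    u: "u \<in> borel_measurable lborel" "AE x in lborel. Re (f x) = u x" and
    v: "v \<in> borel_measurable lborel" "AE x in lborel. Im (f x) = v x" by blast
  show ?thesis
  proof
    have [measurable]: "u \<in> borel_measurable borel" "v \<in> borel_measurable borel" using u v by auto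
    show "(\<lambda>x. complex_of_real (u x) + \<i> * complex_of_real (v x)) \<in> borel_measurable borel" by measurable
    show "AE x in lborel. f x = complex_of_real (u x) + \<i> * complex_of_real (v x)"
      using u(2) v(2) by eventually_elim (simp add: complex_eq_iff)
  qed
qed

lemma lebesgue_integral_eq_lborel:
  fixes F G :: "'a::euclidean_space \<Rightarrow> 'b::{banach, second_countable_topology}"
  assumes F: "F \<in> borel_measurable lebesgue" and G: "G \<in> borel_measurable borel" and e: "AE x in lborel. F x = G x"
  shows "(LINT x|lebesgue. F x) = (LINT x|lborel. G x)" "integrable lebesgue F \<longleftrightarrow> integrable lborel G"
proof -
  have Gl: "G \<in> borel_measurable lebesgue" using G by (intro measurable_completion) simp
  have e': "AE x in lebesgue. F x = G x" using e by (rule AE_completion)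
  have "(LINT x|lebesgue. F x) = (LINT x|lebesgue. G x)" by (rule integral_cong_AE[OF F Gl e'])
  then show "(LINT x|lebesgue. F x) = (LINT x|lborel. G x)" using G by (simp add: integral_completion)
  have "integrable lebesgue F \<longleftrightarrow> integrable lebesgue G" by (rule integrable_cong_AE[OF F Gl e'])
  then show "integrable lebesgue F \<longleftrightarrow> integrable lborel G" using G by (simp add: integrable_completion)
qed

lemma L2_iff_l2:
  fixes f :: "real^'n::finite \<Rightarrow> complex"
  assumes f: "f \<in> borel_measurable lebesgue" and g: "g \<in> borel_measurable borel" and e: "AE x in lborel. f x = g x"
  shows "L2 f \<longleftrightarrow> l2 g"
proof -
  have "integrable lebesgue (\<lambda>x. (cmod (f x))\<^sup>2) \<longleftrightarrow> integrable lborel (\<lambda>x. (cmod (g x))\<^sup>2)"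
    by (rule lebesgue_integral_eq_lborel) (use f g e in auto)
  then show ?thesis using f g by (simp add: l2_def)
qed

lemma rp_exists:
  assumes "L2 f" obtains g where "rp f g"
proof -
  obtain g where g: "g \<in> borel_measurable borel" "AE x in lborel. f x = g x"
    using assms by (auto intro: borel_representative)
  then have "l2 g" using L2_iff_l2[of f g] assms by blast
  with g assms show ?thesis by (intro that[of g]) (simp add: rp_def)
qed

lemma rp_L2: "rp f g \<Longrightarrow> L2 f"
  using L2_iff_l2[of f g] by (auto simp: rp_def dest: l2_measurable)

lemma rp_self: "l2 g \<Longrightarrow> rp g g"
  unfolding rp_def by (auto intro: measurable_completion dest: l2_measurable)

lemma rp_diff: "rp f g \<Longrightarrow> rp f' g' \<Longrightarrow> rp (\<lambda>x. f x - f' x) (\<lambda>x. g x - g' x)"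
  unfolding rp_def by (auto intro: l2_diff elim: eventually_elim2)

lemma FT1_eq_ft1:
  fixes f :: "real^'n::finite \<Rightarrow> complex"
  assumes f: "f \<in> borel_measurable lebesgue" and g: "g \<in> borel_measurable borel" and e: "AE x in lborel. f x = g x"
  shows "FT1 f \<xi> = ft1 g \<xi>"
  unfolding FT1_def ft1_def
proof (rule lebesgue_integral_eq_lborel)
  have "(\<lambda>x. cis (- (x \<bullet> \<xi>))) \<in> borel_measurable lebesgue" by (intro measurable_completion) measurable
  then show "(\<lambda>x. cis (- (x \<bullet> \<xi>)) * f x) \<in> borel_measurable lebesgue" using f by measurable
qed (use g e in auto)

lemma L2FT_iff_is_ft:
  fixes f :: "real^'n::finite \<Rightarrow> complex"
  assumes fg: "rp f g" and h: "h \<in> borel_measurable lebesgue" "k \<in> borel_measurable borel" "AE \<xi> in lborel. h \<xi> = k \<xi>"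
  shows "L2FT f h \<longleftrightarrow> is_ft g k"
proof -
  note [measurable] = l2_measurable[of g]
  have g: "l2 g" using fg by (simp add: rp_def)
  have "FT1 (\<lambda>x. if x \<in> ball 0 R then f x else 0) \<xi> = ft1 (trunc R g) \<xi>" for R \<xi>
  proof (rule FT1_eq_ft1)
    have "(\<lambda>x. indicator (ball 0 R) x * f x) \<in> borel_measurable lebesgue"
      using fg by (intro borel_measurable_times borel_measurable_indicator) (auto simp: rp_def)
    also have "(\<lambda>x. indicator (ball 0 R) x * f x) = (\<lambda>x. if x \<in> ball 0 R then f x else 0)" by (auto simp: indicator_def)
    finally show "(\<lambda>x. if x \<in> ball 0 R then f x else 0) \<in> borel_measurable lebesgue" .
    show "trunc R g \<in> borel_measurable borel" by (intro trunc_measurable l2_measurable g)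
    show "AE x in lborel. (if x \<in> ball 0 R then f x else 0) = trunc R g x"
      using fg by (auto simp: rp_def trunc_def)
  qed
  then have e: "FT1 (\<lambda>x. if x \<in> ball 0 R then f x else 0) = ft1 (trunc R g)" for R by (simp add: fun_eq_iff)
  have "(LINT \<xi>|lebesgue. (cmod (ft1 (trunc R g) \<xi> - h \<xi>))\<^sup>2) = sqn (\<lambda>\<xi>. ft1 (trunc R g) \<xi> - k \<xi>)" for R
    unfolding sqn_def
  proof (rule lebesgue_integral_eq_lborel)
    have [measurable]: "ft1 (trunc R g) \<in> borel_measurable borel" by (intro ft1_measurable trunc_measurable l2_measurable g)
    have "ft1 (trunc R g) \<in> borel_measurable lebesgue" by (intro measurable_completion) simp
    then show "(\<lambda>\<xi>. (cmod (ft1 (trunc R g) \<xi> - h \<xi>))\<^sup>2) \<in> borel_measurable lebesgue" using h by measurable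
    show "(\<lambda>\<xi>. (cmod (ft1 (trunc R g) \<xi> - k \<xi>))\<^sup>2) \<in> borel_measurable borel" using h by measurable
  qed (use h in auto)
  then show ?thesis unfolding L2FT_def is_ft_def e using L2_iff_l2[OF h] by simp
qed

text \<open>\<open>fourier\<close> and \<open>ft\<close> are independent choices, but both satisfy
  the same limit characterisation, which determines the transform up to a null set.\<close>

lemma fourier_rp:
  fixes f :: "real^'n::finite \<Rightarrow> complex"
  assumes fg: "rp f g"
  shows "L2 (fourier f)" "AE \<xi> in lborel. fourier f \<xi> = ft g \<xi>" "rp (fourier f) (ft g)"
proof -
  have g: "l2 g" using fg by (simp add: rp_def)
  have m: "ft g \<in> borel_measurable borel" by (intro l2_measurable l2_ft g)
  have "L2FT f (ft g)"
    by (subst L2FT_iff_is_ft[OF fg _ m]) (auto intro!: measurable_completion is_ft_ft g m)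
  then have L: "L2FT f (fourier f)" unfolding fourier_def by (rule someI[where P="L2FT f"])
  then show L2: "L2 (fourier f)" by (simp add: L2FT_def)
  then obtain k where k: "rp (fourier f) k" by (rule rp_exists)
  then have "is_ft g k" using L L2FT_iff_is_ft[OF fg, of "fourier f" k] by (auto simp: rp_def dest: l2_measurable)
  then have "AE \<xi> in lborel. k \<xi> = ft g \<xi>" by (rule is_ft_unique_AE[OF g _ is_ft_ft[OF g]])
  moreover have "AE \<xi> in lborel. fourier f \<xi> = k \<xi>" using k by (simp add: rp_def)
  ultimately show *: "AE \<xi> in lborel. fourier f \<xi> = ft g \<xi>" by eventually_elim simp
  with L2 g show "rp (fourier f) (ft g)" by (auto simp: rp_def)
qed

lemma Ha_rp:
  fixes f :: "real^'n::finite \<Rightarrow> complex"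
  assumes fg: "rp f g"
  shows "in_Ha a f \<longleftrightarrow> ha a g" "Ha_norm a f = sqrt (hn a g / (2 * pi) ^ CARD('n))"
proof -
  have g: "l2 g" using fg by (simp add: rp_def)
  note [measurable] = l2_measurable[OF l2_ft[OF g]]
  let ?F = "\<lambda>\<xi>::real^'n. (1 + (norm \<xi>)\<^sup>2) powr a * (cmod (fourier f \<xi>))\<^sup>2"
  let ?G = "\<lambda>\<xi>::real^'n. jw a \<xi> * (cmod (ft g \<xi>))\<^sup>2"
  have "jw a \<in> borel_measurable (lebesgue :: (real^'n) measure)" by (intro measurable_completion) simp
  moreover have "fourier f \<in> borel_measurable lebesgue" using fourier_rp(1)[OF fg] by simp
  ultimately have F: "?F \<in> borel_measurable lebesgue" unfolding jw_def[symmetric] by measurable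
  have G: "?G \<in> borel_measurable borel" by measurable
  have e: "AE \<xi> in lborel. ?F \<xi> = ?G \<xi>" using fourier_rp(2)[OF fg] by eventually_elim (simp add: jw_def)
  note * = lebesgue_integral_eq_lborel[OF F G e]
  show "in_Ha a f \<longleftrightarrow> ha a g" unfolding in_Ha_def ha_def *(2) using rp_L2[OF fg] g by simp
  have "(2 * pi) powr (- real CARD('n)) = 1 / (2 * pi) ^ CARD('n)"
    by (simp add: powr_minus_divide powr_realpow)
  then show "Ha_norm a f = sqrt (hn a g / (2 * pi) ^ CARD('n))"
    unfolding Ha_norm_def hn_def *(1) by simp
qed

lemma Ha_inner_rp:
  fixes f f' :: "real^'n::finite \<Rightarrow> complex"
  assumes fg: "rp f g" and fg': "rp f' g'"
  shows "Ha_inner a f f' = complex_of_real ((2 * pi) powr (- real CARD('n))) *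
    (LINT \<xi>|lborel. complex_of_real (jw a \<xi>) * cnj (ft g' \<xi>) * ft g \<xi>)"
proof -
  have g: "l2 g" "l2 g'" using fg fg' by (auto simp: rp_def)
  note [measurable] = l2_measurable[OF l2_ft[OF g(1)]] l2_measurable[OF l2_ft[OF g(2)]]
  have "(LINT \<xi>|lebesgue. complex_of_real (jw a \<xi>) * cnj (fourier f' \<xi>) * fourier f \<xi>)
    = (LINT \<xi>|lborel. complex_of_real (jw a \<xi>) * cnj (ft g' \<xi>) * ft g \<xi>)"
  proof (rule lebesgue_integral_eq_lborel)
    have "jw a \<in> borel_measurable (lebesgue :: (real^'n) measure)" by (intro measurable_completion) simp
    moreover have "fourier f \<in> borel_measurable lebesgue" "fourier f' \<in> borel_measurable lebesgue"
      using fourier_rp(1)[OF fg] fourier_rp(1)[OF fg'] by auto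
    ultimately show "(\<lambda>\<xi>. complex_of_real (jw a \<xi>) * cnj (fourier f' \<xi>) * fourier f \<xi>) \<in> borel_measurable lebesgue"
      by measurable
    show "AE \<xi> in lborel. complex_of_real (jw a \<xi>) * cnj (fourier f' \<xi>) * fourier f \<xi> = complex_of_real (jw a \<xi>) * cnj (ft g' \<xi>) * ft g \<xi>"
      using fourier_rp(2)[OF fg] fourier_rp(2)[OF fg'] by eventually_elim simp
  qed measurable
  then show ?thesis by (simp add: Ha_inner_def jw_def)
qed

text \<open>Surjectivity of the transform shows that the choice in \<open>free_evol\<close> has a
  candidate; uniqueness of L^2 limits then identifies the transform of whichever candidate was
  chosen.\<close>

lemma free_evol_rp:
  fixes f :: "real^'n::finite \<Rightarrow> complex"
  assumes fg: "rp f g"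
  obtains h where "rp (free_evol s f) h" "AE \<xi> in lborel. ft h \<xi> = cis (- s * (norm \<xi>)\<^sup>2) * ft g \<xi>"
proof -
  have g: "l2 g" using fg by (simp add: rp_def)
  let ?m = "\<lambda>\<xi>::real^'n. cis (- s * (norm \<xi>)\<^sup>2)"
  note [measurable] = l2_measurable[OF l2_ft[OF g]]
  have ml: "?m \<in> borel_measurable lebesgue" by (intro measurable_completion) measurable
  have F: "(\<lambda>\<xi>. ?m \<xi> * fourier f \<xi>) \<in> borel_measurable lebesgue"
    using fourier_rp(1)[OF fg] ml by (intro borel_measurable_times) auto
  have mg: "l2 (\<lambda>\<xi>. ?m \<xi> * ft g \<xi>)" by (intro l2_bounded_mult1 l2_ft g) auto
  have e: "AE \<xi> in lborel. ?m \<xi> * fourier f \<xi> = ?m \<xi> * ft g \<xi>" using fourier_rp(2)[OF fg] by eventually_elim simp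
  have iff: "L2FT f' (\<lambda>\<xi>. ?m \<xi> * fourier f \<xi>) \<longleftrightarrow> (AE \<xi> in lborel. ft g' \<xi> = ?m \<xi> * ft g \<xi>)" if "rp f' g'" for f' g'
  proof -
    have g': "l2 g'" using that by (simp add: rp_def)
    have "is_ft g' (\<lambda>\<xi>. ?m \<xi> * ft g \<xi>) \<longleftrightarrow> (AE \<xi> in lborel. ft g' \<xi> = ?m \<xi> * ft g \<xi>)"
    proof
      assume "is_ft g' (\<lambda>\<xi>. ?m \<xi> * ft g \<xi>)"
      then show "AE \<xi> in lborel. ft g' \<xi> = ?m \<xi> * ft g \<xi>" by (rule is_ft_unique_AE[OF g' is_ft_ft[OF g']])
    next
      assume *: "AE \<xi> in lborel. ft g' \<xi> = ?m \<xi> * ft g \<xi>"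
      have "sqn (\<lambda>\<xi>. ft1 (trunc R g') \<xi> - ?m \<xi> * ft g \<xi>) = sqn (\<lambda>\<xi>. ft1 (trunc R g') \<xi> - ft g' \<xi>)" for R
      proof (rule sqn_cong_AE)
        show "(\<lambda>\<xi>. ft1 (trunc R g') \<xi> - ?m \<xi> * ft g \<xi>) \<in> borel_measurable borel" "(\<lambda>\<xi>. ft1 (trunc R g') \<xi> - ft g' \<xi>) \<in> borel_measurable borel"
          by (intro l2_measurable l2_diff l2_ft1_trunc l2_ft g' mg)+
        show "AE \<xi> in lborel. ft1 (trunc R g') \<xi> - ?m \<xi> * ft g \<xi> = ft1 (trunc R g') \<xi> - ft g' \<xi>"
          using * by eventually_elim simp
      qed
      then show "is_ft g' (\<lambda>\<xi>. ?m \<xi> * ft g \<xi>)" using mg ft_limit[OF g'] by (simp add: is_ft_def)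
    qed
    then show ?thesis using L2FT_iff_is_ft[OF that F l2_measurable[OF mg] e] by simp
  qed
  obtain h0 where h0: "l2 h0" "AE \<xi> in lborel. ft h0 \<xi> = ?m \<xi> * ft g \<xi>" by (rule ft_surj[OF mg])
  have "L2 h0 \<and> L2FT h0 (\<lambda>\<xi>. ?m \<xi> * fourier f \<xi>)"
    using iff[OF rp_self[OF h0(1)]] h0 rp_L2[OF rp_self[OF h0(1)]] by simp
  then have "L2 (free_evol s f) \<and> L2FT (free_evol s f) (\<lambda>\<xi>. ?m \<xi> * fourier f \<xi>)"
    unfolding free_evol_def by (rule someI[where P="\<lambda>h. L2 h \<and> L2FT h (\<lambda>\<xi>. ?m \<xi> * fourier f \<xi>)"])
  then obtain h where h: "rp (free_evol s f) h" "L2FT (free_evol s f) (\<lambda>\<xi>. ?m \<xi> * fourier f \<xi>)"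
    using rp_exists by metis
  from iff[OF h(1)] h show ?thesis by (intro that[of h]) auto
qed

lemma phase_op_rp:
  fixes f :: "real^'n::finite \<Rightarrow> complex"
  assumes h: "rp (free_evol (- t) f) h" and F: "F \<in> borel_measurable borel" "\<And>s. \<bar>F s\<bar> \<le> 1"
  obtains p where "rp (phase_op F \<alpha> t f) p"
    "AE \<xi> in lborel. ft p \<xi> = cis (- t * (norm \<xi>)\<^sup>2) * ft (\<lambda>x. complex_of_real (F (norm x / t powr \<alpha>)) * h x) \<xi>"
proof -
  let ?m = "\<lambda>x::real^'n. complex_of_real (F (norm x / t powr \<alpha>))"
  have [measurable]: "?m \<in> borel_measurable borel" using F(1) by measurable
  have ml: "?m \<in> borel_measurable lebesgue" by (intro measurable_completion) measurable
  have "rp (\<lambda>x. ?m x * free_evol (- t) f x) (\<lambda>x. ?m x * h x)"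
    using h ml F(2) unfolding rp_def by (auto intro!: l2_bounded_mult1 borel_measurable_times)
  then obtain p where p: "rp (free_evol t (\<lambda>x. ?m x * free_evol (- t) f x)) p"
    "AE \<xi> in lborel. ft p \<xi> = cis (- t * (norm \<xi>)\<^sup>2) * ft (\<lambda>x. ?m x * h x) \<xi>"
    by (rule free_evol_rp)
  show ?thesis by (rule that[unfolded phase_op_def, OF p])
qed

text \<open>The norm sees only the modulus of the transform, so free evolution, being unimodular in
  frequency, drops out of it.\<close>

lemma hn_cong:
  assumes f: "l2 f" and g: "l2 g" and e: "AE \<xi> in lborel. cmod (ft f \<xi>) = cmod (ft g \<xi>)"
  shows "hn a f = hn a g" "ha a f \<longleftrightarrow> ha a g"
proof -
  note [measurable] = l2_measurable[OF l2_ft[OF f]] l2_measurable[OF l2_ft[OF g]]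
  have e': "AE \<xi> in lborel. jw a \<xi> * (cmod (ft f \<xi>))\<^sup>2 = jw a \<xi> * (cmod (ft g \<xi>))\<^sup>2" using e by eventually_elim simp
  show "hn a f = hn a g" unfolding hn_def by (rule integral_cong_AE[OF _ _ e']) measurable
  have "integrable lborel (\<lambda>\<xi>. jw a \<xi> * (cmod (ft f \<xi>))\<^sup>2) = integrable lborel (\<lambda>\<xi>. jw a \<xi> * (cmod (ft g \<xi>))\<^sup>2)"
    by (rule integrable_cong_AE[OF _ _ e']) measurable
  then show "ha a f \<longleftrightarrow> ha a g" using f g by (simp add: ha_def)
qed

lemma Ha_norm_bound:
  fixes f :: "real^'n::finite \<Rightarrow> complex"
  assumes fg: "rp f g" and le: "Ha_norm a f \<le> C"
  shows "hn a g \<le> (2 * pi) ^ CARD('n) * C\<^sup>2"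
proof -
  have p: "0 \<le> hn a g / (2 * pi) ^ CARD('n)" by (intro divide_nonneg_nonneg) auto
  have "sqrt (hn a g / (2 * pi) ^ CARD('n)) \<le> C" using le unfolding Ha_rp(2)[OF fg] .
  then have "(sqrt (hn a g / (2 * pi) ^ CARD('n)))\<^sup>2 \<le> C\<^sup>2" using p by (intro power_mono) auto
  then have "hn a g / (2 * pi) ^ CARD('n) \<le> C\<^sup>2" using p by simp
  then show ?thesis by (simp add: divide_le_eq mult.commute)
qed

text \<open>Multiplying by cis(t |\<xi>|^2) removes t from the integrand, so the formulas at two
  times can be subtracted and leave an integral between them.\<close>

lemma duhamel_interaction:
  fixes V :: "real^'n::finite \<Rightarrow> real \<Rightarrow> complex"
  assumes sol: "duhamel_solution V \<psi>" and t: "0 \<le> t"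
  shows "AE \<xi> in lborel. integrable lborel (\<lambda>s. indicator {0<..<t} s * (cis (s * (norm \<xi>)\<^sup>2) * FT1 (\<lambda>x. V x s * \<psi> s x) \<xi>)) \<and>
     cis (t * (norm \<xi>)\<^sup>2) * fourier (\<psi> t) \<xi> = fourier (\<psi> 0) \<xi>
       - \<i> * (LINT s|lborel. indicator {0<..<t} s * (cis (s * (norm \<xi>)\<^sup>2) * FT1 (\<lambda>x. V x s * \<psi> s x) \<xi>))"
proof -
  have "AE \<xi> in lborel.
      interval_lebesgue_integrable lborel (ereal 0) (ereal t)
        (\<lambda>s. cis (- (t - s) * (norm \<xi>)\<^sup>2) * FT1 (\<lambda>x. V x s * \<psi> s x) \<xi>) \<and>
      fourier (\<psi> t) \<xi> = cis (- t * (norm \<xi>)\<^sup>2) * fourier (\<psi> 0) \<xi>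
        - \<i> * interval_lebesgue_integral lborel (ereal 0) (ereal t)
              (\<lambda>s. cis (- (t - s) * (norm \<xi>)\<^sup>2) * FT1 (\<lambda>x. V x s * \<psi> s x) \<xi>)"
    using sol unfolding duhamel_solution_def AE_completion_iff by blast
  then show ?thesis
  proof eventually_elim
    case (elim \<xi>)
    let ?g = "\<lambda>s. FT1 (\<lambda>x. V x s * \<psi> s x) \<xi>"
    let ?c = "cis (t * (norm \<xi>)\<^sup>2)"
    \<comment> \<open>The interval integral runs over the open interval; the resulting missing
      endpoints are dealt with when a closed interval is formed.\<close>
    have ei: "einterval (ereal 0) (ereal t) = {0<..<t}" by (auto simp: einterval_def)
    have k: "?c * cis (- (t - s) * (norm \<xi>)\<^sup>2) = cis (s * (norm \<xi>)\<^sup>2)" for s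
      unfolding cis_mult by (simp add: algebra_simps)
    have c1: "?c * cis (- t * (norm \<xi>)\<^sup>2) = 1" by (simp add: cis_mult)
    have f: "?c * (indicator {0<..<t} s *\<^sub>R (cis (- (t - s) * (norm \<xi>)\<^sup>2) * ?g s))
       = indicator {0<..<t} s * (cis (s * (norm \<xi>)\<^sup>2) * ?g s)" for s
    proof -
      have "?c * (indicator {0<..<t} s *\<^sub>R (cis (- (t - s) * (norm \<xi>)\<^sup>2) * ?g s))
        = indicator {0<..<t} s * ((?c * cis (- (t - s) * (norm \<xi>)\<^sup>2)) * ?g s)"
        by (cases "s \<in> {0<..<t}") simp_all
      then show ?thesis unfolding k .
    qed
    have i: "integrable lborel (\<lambda>s. indicator {0<..<t} s *\<^sub>R (cis (- (t - s) * (norm \<xi>)\<^sup>2) * ?g s))"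
      using elim t unfolding interval_lebesgue_integrable_def set_integrable_def ei by simp
    from integrable_mult_right[OF this, of ?c]
    have 1: "integrable lborel (\<lambda>s. indicator {0<..<t} s * (cis (s * (norm \<xi>)\<^sup>2) * ?g s))" unfolding f .
    have "interval_lebesgue_integral lborel (ereal 0) (ereal t) (\<lambda>s. cis (- (t - s) * (norm \<xi>)\<^sup>2) * ?g s)
      = (LINT s|lborel. indicator {0<..<t} s *\<^sub>R (cis (- (t - s) * (norm \<xi>)\<^sup>2) * ?g s))"
      using t unfolding interval_lebesgue_integral_def set_lebesgue_integral_def ei by simp
    then have "?c * interval_lebesgue_integral lborel (ereal 0) (ereal t) (\<lambda>s. cis (- (t - s) * (norm \<xi>)\<^sup>2) * ?g s)
      = (LINT s|lborel. indicator {0<..<t} s * (cis (s * (norm \<xi>)\<^sup>2) * ?g s))"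
      by (simp only: f[symmetric] integral_mult_right_zero)
    moreover have "?c * fourier (\<psi> t) \<xi> = (?c * cis (- t * (norm \<xi>)\<^sup>2)) * fourier (\<psi> 0) \<xi>
        - \<i> * (?c * interval_lebesgue_integral lborel (ereal 0) (ereal t) (\<lambda>s. cis (- (t - s) * (norm \<xi>)\<^sup>2) * ?g s))"
      using elim by (simp only: right_diff_distrib mult_ac)
    ultimately show ?case using 1 unfolding c1 by simp
  qed
qed

theorem theorem2p1:
  fixes N :: "real^'n::finite \<Rightarrow> real \<Rightarrow> real \<Rightarrow> complex"
    and \<psi> :: "real \<Rightarrow> real^'n \<Rightarrow> complex"
    and \<chi>c :: "real \<Rightarrow> real"
    and a \<alpha> :: real
  assumes dim: "CARD('n) \<ge> 3"
    and a: "0 \<le> a" "a \<le> 1"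
    and chi_smooth: "smooth_real \<chi>c"
    and chi_range: "\<And>s. 0 \<le> \<chi>c s \<and> \<chi>c s \<le> 1"
    and chi_one: "\<And>s. s \<ge> 1 \<Longrightarrow> \<chi>c s = 1"
    and chi_zero: "\<And>s. s \<le> 1/2 \<Longrightarrow> \<chi>c s = 0"
    and psi_Ha: "\<And>t. in_Ha a (\<psi> t)"
    and psi_cont: "\<And>t0. ((\<lambda>t. Ha_norm a (\<lambda>x. \<psi> t x - \<psi> t0 x)) \<longlongrightarrow> 0) (at t0)"
    and psi_bdd: "\<exists>C. \<forall>t. Ha_norm a (\<psi> t) \<le> C"
    and sol: "duhamel_solution (\<lambda>x t. N x t (cmod (\<psi> t x))) \<psi>"
    and V_Linf: "\<exists>C. AE t in lborel. in_Ha a (\<lambda>x. N x t (cmod (\<psi> t x)))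
                      \<and> Ha_norm a (\<lambda>x. N x t (cmod (\<psi> t x))) \<le> C"
    and alpha: "0 < \<alpha>" "\<alpha> < 1 - 2 / real CARD('n)"
  shows "\<exists>\<Omega>. in_Ha a \<Omega> \<and>
     ((\<lambda>t. Ha_norm a (\<lambda>x. free_evol (- t) (phase_op (\<lambda>s. 1 - \<chi>c s) \<alpha> t (\<psi> t)) x - \<Omega> x))
        \<longlongrightarrow> 0) at_top \<and>
     (\<forall>g. in_Ha a g \<longrightarrow>
        ((\<lambda>t. Ha_inner a (free_evol (- t) (phase_op \<chi>c \<alpha> t (\<psi> t))) g) \<longlongrightarrow> 0) at_top) \<and>
     ((\<lambda>t. Ha_norm a (\<lambda>x. \<psi> t x - free_evol t \<Omega> x - phase_op \<chi>c \<alpha> t (\<psi> t) x))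
        \<longlongrightarrow> 0) at_top"
proof -
  let ?V = "\<lambda>x t. N x t (cmod (\<psi> t x))"
  define \<kappa> where "\<kappa> = (2 * pi :: real) ^ CARD('n)"
  have \<kappa>: "\<kappa> > 0" by (simp add: \<kappa>_def)
  obtain L where lip: "\<And>s r. \<bar>\<chi>c s - \<chi>c r\<bar> \<le> L * \<bar>s - r\<bar>"
    using smooth_cutoff_lipschitz[OF chi_smooth chi_one chi_zero] by blast
  have "\<exists>g. rp (\<psi> t) g" for t
    using psi_Ha[of t] rp_exists[of "\<psi> t"] unfolding in_Ha_def by blast
  then obtain \<Psi> where Psi: "\<And>t. rp (\<psi> t) (\<Psi> t)" by metis
  have "\<exists>h. rp (free_evol (- t) (\<psi> t)) h \<and> (AE \<xi> in lborel. ft h \<xi> = cis (t * (norm \<xi>)\<^sup>2) * ft (\<Psi> t) \<xi>)" for t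
  proof -
    obtain h where "rp (free_evol (- t) (\<psi> t)) h" "AE \<xi> in lborel. ft h \<xi> = cis (- (- t) * (norm \<xi>)\<^sup>2) * ft (\<Psi> t) \<xi>"
      by (rule free_evol_rp[OF Psi])
    then show ?thesis unfolding minus_minus by blast
  qed
  from choice[OF allI[OF this]] obtain \<phi> where phi': "\<forall>t. rp (free_evol (- t) (\<psi> t)) (\<phi> t) \<and>
      (AE \<xi> in lborel. ft (\<phi> t) \<xi> = cis (t * (norm \<xi>)\<^sup>2) * ft (\<Psi> t) \<xi>)" ..
  have phi: "rp (free_evol (- t) (\<psi> t)) (\<phi> t)"
    "AE \<xi> in lborel. ft (\<phi> t) \<xi> = cis (t * (norm \<xi>)\<^sup>2) * ft (\<Psi> t) \<xi>" for t
    using phi'[rule_format, of t] by simp_all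
  have l2Psi: "l2 (\<Psi> t)" and l2phi: "l2 (\<phi> t)" for t using Psi[of t] phi(1)[of t] by (auto simp: rp_def)
  obtain C1 where C1: "\<And>t. Ha_norm a (\<psi> t) \<le> C1" using psi_bdd by blast
  obtain C2 where "AE t in lborel. in_Ha a (\<lambda>x. ?V x t) \<and> Ha_norm a (\<lambda>x. ?V x t) \<le> C2" using V_Linf by blast
  then obtain N0 where N0: "N0 \<in> null_sets lborel"
    and Vgood: "\<And>t. t \<notin> N0 \<Longrightarrow> in_Ha a (\<lambda>x. ?V x t) \<and> Ha_norm a (\<lambda>x. ?V x t) \<le> C2"
    unfolding eventually_ae_filter by auto
  \<comment> \<open>Positive times outside the exceptional set of V. Putting \<open>W u\<close> = 0
    elsewhere gives bounds at every time and alters the Duhamel integrands only on a null set of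
    positive times.\<close>
  define good where "good u \<longleftrightarrow> 0 < u \<and> u \<notin> N0" for u
  have "\<exists>g. (good u \<longrightarrow> rp (\<lambda>x. ?V x u) g) \<and> (\<not> good u \<longrightarrow> g = (\<lambda>_. 0))" for u
    using Vgood[of u] rp_exists[of "\<lambda>x. ?V x u"] unfolding in_Ha_def good_def by blast
  from choice[OF allI[OF this]] obtain W where W': "\<forall>u. (good u \<longrightarrow> rp (\<lambda>x. ?V x u) (W u)) \<and> (\<not> good u \<longrightarrow> W u = (\<lambda>_. 0))" ..
  have W: "good u \<Longrightarrow> rp (\<lambda>x. ?V x u) (W u)" "\<not> good u \<Longrightarrow> W u = (\<lambda>_. 0)" for u
    using W'[rule_format, of u] by simp_all
  \<comment> \<open>One bound for V, \<psi> and \<phi>; \<kappa> undoes the normalisation (2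
    pi)^(-n) in \<open>Ha_norm\<close>.\<close>
  define B where "B = \<kappa> * (C1\<^sup>2 + C2\<^sup>2)"
  have B: "\<kappa> * C1\<^sup>2 \<le> B" "\<kappa> * C2\<^sup>2 \<le> B" "0 \<le> B" using \<kappa> by (auto simp: B_def)
  have zero: "ha a (\<lambda>_::real^'n. 0)" "hn a (\<lambda>_::real^'n. 0) = 0"
  proof -
    have e: "AE \<xi> in lborel. ft (\<lambda>_::real^'n. 0) \<xi> = 0" using ft_cmult[of "\<lambda>_::real^'n. 0" 0] by simp
    note [measurable] = l2_measurable[OF l2_ft[OF l2_zero], where 'a="real^'n"]
    have e': "AE \<xi> in lborel. jw a \<xi> * (cmod (ft (\<lambda>_::real^'n. 0) \<xi>))\<^sup>2 = 0" using e by eventually_elim simp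
    have "integrable lborel (\<lambda>\<xi>. jw a \<xi> * (cmod (ft (\<lambda>_::real^'n. 0) \<xi>))\<^sup>2) = integrable lborel (\<lambda>\<xi>::real^'n. 0 :: real)"
      by (rule integrable_cong_AE[OF _ _ e']) measurable
    then show "ha a (\<lambda>_::real^'n. 0)" by (simp add: ha_def)
    show "hn a (\<lambda>_::real^'n. 0) = 0" unfolding hn_def by (rule integral_eq_zero_AE[OF e'])
  qed
  have haV: "ha a (W u)" and hnV: "hn a (W u) \<le> B" for u
  proof -
    have "ha a (W u) \<and> hn a (W u) \<le> B"
    proof (cases "good u")
      case True
      then have g: "in_Ha a (\<lambda>x. ?V x u)" "Ha_norm a (\<lambda>x. ?V x u) \<le> C2" using Vgood[of u] by (auto simp: good_def)
      from Ha_norm_bound[OF W(1)[OF True] g(2)] g(1) B(2) show ?thesis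
        unfolding Ha_rp(1)[OF W(1)[OF True]] \<kappa>_def by simp
    next
      case False
      then show ?thesis using W(2) zero B(3) by simp
    qed
    then show "ha a (W u)" "hn a (W u) \<le> B" by auto
  qed
  have haPsi: "ha a (\<Psi> t)" for t using psi_Ha[of t] unfolding Ha_rp(1)[OF Psi] .
  have hnPsi: "hn a (\<Psi> t) \<le> B" for t
    using Ha_norm_bound[OF Psi C1, of t] B(1) unfolding \<kappa>_def by linarith
  have modphi: "AE \<xi> in lborel. cmod (ft (\<phi> t) \<xi>) = cmod (ft (\<Psi> t) \<xi>)" for t
    using phi(2)[of t] by eventually_elim (simp add: norm_mult)
  have haphi: "ha a (\<phi> t)" and hnphi: "hn a (\<phi> t) \<le> B" for t
    using hn_cong[OF l2phi l2Psi modphi, of a t] haPsi[of t] hnPsi[of t] by auto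
  have l2W: "l2 (W u)" for u by (rule ha_l2[OF haV])
  let ?g = "\<lambda>u \<xi>. ft1 (\<lambda>x. W u x * \<Psi> u x) \<xi>"
  let ?G = "\<lambda>s \<xi>. FT1 (\<lambda>x. ?V x s * \<psi> s x) \<xi>"
  have Gg: "?G u \<xi> = ?g u \<xi>" if u: "good u" for u \<xi>
  proof (rule FT1_eq_ft1)
    show "(\<lambda>x. ?V x u * \<psi> u x) \<in> borel_measurable lebesgue"
      using W(1)[OF u] Psi[of u] by (intro borel_measurable_times) (auto simp: rp_def)
    show "(\<lambda>x. W u x * \<Psi> u x) \<in> borel_measurable borel"
      by (intro borel_measurable_times l2_measurable l2W l2Psi)
    have "AE x in lborel. ?V x u = W u x" "AE x in lborel. \<psi> u x = \<Psi> u x"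
      using W(1)[OF u] Psi[of u] by (auto simp: rp_def)
    then show "AE x in lborel. ?V x u * \<psi> u x = W u x * \<Psi> u x" by eventually_elim simp
  qed
  have g0: "?g u \<xi> = 0" if "\<not> good u" for u \<xi> using W(2)[OF that] by (simp add: ft1_def)
  have duh: "AE \<xi> in lborel. integrable lborel (\<lambda>s. indicator {0<..<t} s * (cis (s * (norm \<xi>)\<^sup>2) * ?G s \<xi>)) \<and>
     cis (t * (norm \<xi>)\<^sup>2) * fourier (\<psi> t) \<xi> = fourier (\<psi> 0) \<xi>
       - \<i> * (LINT s|lborel. indicator {0<..<t} s * (cis (s * (norm \<xi>)\<^sup>2) * ?G s \<xi>))" if "0 \<le> t" for t
    by (rule duhamel_interaction[OF sol that])
  have meas: "(\<lambda>(u, \<xi>). ?g u \<xi>) \<in> borel_measurable (borel \<Otimes>\<^sub>M borel)"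
  proof (rule caratheodory_measurable)
    show "(\<lambda>n. ?g u (X n)) \<longlonglongrightarrow> ?g u \<xi>" if "X \<longlonglongrightarrow> \<xi>" for u \<xi> X
      by (intro ft1_seq_continuous l2_mult_integrable l2W l2Psi that)
    have "AE \<xi> in lborel. \<forall>T::nat. integrable lborel (\<lambda>s. indicator {0<..<real T} s * (cis (s * (norm \<xi>)\<^sup>2) * ?G s \<xi>))"
      unfolding AE_all_countable
    proof
      fix T :: nat
      show "AE \<xi> in lborel. integrable lborel (\<lambda>s. indicator {0<..<real T} s * (cis (s * (norm \<xi>)\<^sup>2) * ?G s \<xi>))"
        using duh[of "real T"] by (auto elim: eventually_mono)
    qed
    then show "AE \<xi> in lborel. (\<lambda>u. ?g u \<xi>) \<in> borel_measurable borel"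
    proof eventually_elim
      case (elim \<xi>)
      \<comment> \<open>Integrability in Duhamel's formula carries measurability of the raw
        integrand on (0, T). Undoing the phase, discarding N0 and letting T grow exhibits
        \<open>?g u \<xi>\<close> as a pointwise limit of Borel functions of u.\<close>
      let ?h = "\<lambda>T u. indicator (- N0) u * (cis (- (u * (norm \<xi>)\<^sup>2)) * (indicator {0<..<real T} u * (cis (u * (norm \<xi>)\<^sup>2) * ?G u \<xi>)))"
      have N0b: "- N0 \<in> sets borel" using N0 by auto
      have Gm: "(\<lambda>u. indicator {0<..<real T} u * (cis (u * (norm \<xi>)\<^sup>2) * ?G u \<xi>)) \<in> borel_measurable borel" for T :: nat
        using borel_measurable_integrable[OF elim[rule_format, of T]] by (simp only: measurable_lborel2)
      have c: "(\<lambda>u. cis (- (u * (norm \<xi>)\<^sup>2))) \<in> borel_measurable borel" by measurable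
      have hm: "?h T \<in> borel_measurable borel" for T :: nat
        by (rule borel_measurable_times[OF borel_measurable_indicator[OF N0b] borel_measurable_times[OF c Gm]])
      show ?case
      proof (rule borel_measurable_LIMSEQ_metric[OF hm])
        fix u :: real
        show "(\<lambda>T. ?h T u) \<longlonglongrightarrow> ?g u \<xi>"
        proof (cases "good u")
          case True
          then have u: "0 < u" "u \<notin> N0" by (auto simp: good_def)
          obtain T0 :: nat where T0: "u < real T0" using reals_Archimedean2 by blast
          have "eventually (\<lambda>T. ?h T u = ?g u \<xi>) sequentially"
            using eventually_ge_at_top[of T0]
          proof eventually_elim
            case (elim T)
            then have "u < real T" using T0 by linarith
            then show ?case using u Gg[OF True, of \<xi>] by (simp add: cis_mult flip: mult.assoc)
          qed
          then show ?thesis by (rule tendsto_eventually)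
        next
          case False
          then have "?h T u = 0" for T by (auto simp: good_def indicator_def)
          then show ?thesis unfolding g0[OF False] by (intro tendsto_eventually always_eventually allI)
        qed
      qed
    qed
  qed
  have gm: "(\<lambda>u. ?g u \<xi>) \<in> borel_measurable borel" for \<xi>
    using measurable_compose[OF measurable_Pair2'[of \<xi> borel borel] meas] by simp
  interpret I: cutoff_interaction a W \<Psi> \<phi> B \<chi>c \<alpha> L
  proof
    show "3 \<le> DIM(real^'n)" using dim by simp
    show "AE \<xi> in lborel. ft (\<phi> s) \<xi> - ft (\<phi> t) \<xi> = - \<i> * (LINT u|lborel. indicator {t..s} u * (cis (u * (norm \<xi>)\<^sup>2) * ?g u \<xi>))"
      if t: "0 < t" "t \<le> s" for t s
    proof -
      have 0: "0 \<le> t" "0 \<le> s" using t by auto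
      show ?thesis
        using duh[OF 0(1)] duh[OF 0(2)] phi(2)[of t] phi(2)[of s] fourier_rp(2)[OF Psi, of t] fourier_rp(2)[OF Psi, of s]
      proof eventually_elim
        case (elim \<xi>)
        let ?F = "\<lambda>u. cis (u * (norm \<xi>)\<^sup>2) * ?G u \<xi>"
        have it: "integrable lborel (\<lambda>u. indicator {0<..<t} u * ?F u)" and isI: "integrable lborel (\<lambda>u. indicator {0<..<s} u * ?F u)"
          using elim by auto
        have "ft (\<phi> s) \<xi> - ft (\<phi> t) \<xi> = - \<i> * ((LINT u|lborel. indicator {0<..<s} u * ?F u) - (LINT u|lborel. indicator {0<..<t} u * ?F u))"
          using elim by (simp add: right_diff_distrib)
        also have "(LINT u|lborel. indicator {0<..<s} u * ?F u) - (LINT u|lborel. indicator {0<..<t} u * ?F u)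
           = (LINT u|lborel. indicator {0<..<s} u * ?F u - indicator {0<..<t} u * ?F u)"
          by (rule Bochner_Integration.integral_diff[OF isI it, symmetric])
        also have "\<dots> = (LINT u|lborel. indicator {t..s} u * (cis (u * (norm \<xi>)\<^sup>2) * ?g u \<xi>))"
        proof (rule integral_cong_AE)
          show "(\<lambda>u. indicator {0<..<s} u * ?F u - indicator {0<..<t} u * ?F u) \<in> borel_measurable lborel"
            by (intro borel_measurable_diff borel_measurable_integrable isI it)
          show "(\<lambda>u. indicator {t..s} u * (cis (u * (norm \<xi>)\<^sup>2) * ?g u \<xi>)) \<in> borel_measurable lborel"
            using gm[of \<xi>] by measurable
          \<comment> \<open>The two open intervals leave the half-open interval from t to s, which
            differs from the closed one only at an endpoint; times in N0 form another null
            set.\<close>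
          have "AE u in lborel. u \<notin> N0" using N0 by (rule AE_not_in)
          moreover have "AE u in lborel. u \<noteq> t" "AE u in lborel. u \<noteq> s" by (rule AE_lborel_singleton)+
          ultimately show "AE u in lborel. indicator {0<..<s} u * ?F u - indicator {0<..<t} u * ?F u
             = indicator {t..s} u * (cis (u * (norm \<xi>)\<^sup>2) * ?g u \<xi>)"
          proof eventually_elim
            case (elim u)
            show ?case
            proof (cases "0 < u")
              case True
              then have "good u" using elim by (simp add: good_def)
              then show ?thesis using Gg[of u \<xi>] t elim True by (auto simp: indicator_def)
            qed (use t in \<open>auto simp: indicator_def\<close>)
          qed
        qed
        finally show ?case .
      qed
    qed
  qed (use a haV hnV haPsi hnPsi haphi hnphi meas chi_range chi_one chi_zero lip alpha in auto)
  have in_out: "I.cut_in t = (\<lambda>x. complex_of_real ((\<lambda>s. 1 - \<chi>c s) (norm x / t powr \<alpha>)))"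
    "I.cut_out t = (\<lambda>x. complex_of_real (\<chi>c (norm x / t powr \<alpha>)))" for t
    by (simp_all add: I.cut_in_def[abs_def] I.cut_out_def[abs_def])
  have F1: "(\<lambda>s. 1 - \<chi>c s) \<in> borel_measurable borel" "\<bar>1 - \<chi>c s\<bar> \<le> 1" for s
    using I.chi_measurable chi_range[of s] by auto
  have F2: "\<chi>c \<in> borel_measurable borel" "\<bar>\<chi>c s\<bar> \<le> 1" for s
    using I.chi_measurable chi_range[of s] by auto
  have unit: "cis (t * r) * cis (- t * r) = 1" "cis (- (- t) * r) * cis (- t * r) = 1" for t r by (simp_all add: cis_mult)
  \<comment> \<open>Evolving by -t cancels the phase left by \<open>phase_op_rp\<close>, so only the
    cutoff profile of the interaction picture remains.\<close>
  have evol_back: "\<exists>q. rp (free_evol (- t) f) q \<and> (AE \<xi> in lborel. ft q \<xi> = ft h \<xi>)"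
    if fp: "rp f p" "AE \<xi> in lborel. ft p \<xi> = cis (- t * (norm \<xi>)\<^sup>2) * ft h \<xi>" for t f p and h :: "real^'n \<Rightarrow> complex"
  proof -
    obtain q where q: "rp (free_evol (- t) f) q" "AE \<xi> in lborel. ft q \<xi> = cis (- (- t) * (norm \<xi>)\<^sup>2) * ft p \<xi>"
      by (rule free_evol_rp[OF fp(1), of "- t"])
    from q(2) fp(2) have "AE \<xi> in lborel. ft q \<xi> = ft h \<xi>"
      by eventually_elim (simp only: mult.assoc[symmetric] unit mult_1_left)
    with q(1) show ?thesis by blast
  qed
  obtain \<Omega> where Om: "ha a \<Omega>" and lim: "((\<lambda>t. hn a (\<lambda>x. I.cut_in t x * \<phi> t x - \<Omega> x)) \<longlongrightarrow> 0) at_top"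
    by (rule I.free_channel_limit)
  have rOm: "rp \<Omega> \<Omega>" by (rule rp_self[OF ha_l2[OF Om]])
  have lim': "((\<lambda>t. sqrt (hn a (\<lambda>x. I.cut_in t x * \<phi> t x - \<Omega> x) / \<kappa>)) \<longlongrightarrow> 0) at_top"
    using tendsto_real_sqrt[OF tendsto_divide[OF lim tendsto_const[of \<kappa>]]] \<kappa> by simp
  have l2in: "l2 (\<lambda>x. I.cut_in t x * \<phi> t x)" and l2out: "l2 (\<lambda>x. I.cut_out t x * \<phi> t x)" for t
    by (intro I.l2_inner I.l2_outer l2phi)+
  have l2d: "l2 (\<lambda>x. I.cut_in t x * \<phi> t x - \<Omega> x)" for t by (intro l2_diff l2in ha_l2[OF Om])
  have first: "Ha_norm a (\<lambda>x. free_evol (- t) (phase_op (\<lambda>s. 1 - \<chi>c s) \<alpha> t (\<psi> t)) x - \<Omega> x)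
     = sqrt (hn a (\<lambda>x. I.cut_in t x * \<phi> t x - \<Omega> x) / \<kappa>)" for t
  proof -
    obtain p where p: "rp (phase_op (\<lambda>s. 1 - \<chi>c s) \<alpha> t (\<psi> t)) p"
      "AE \<xi> in lborel. ft p \<xi> = cis (- t * (norm \<xi>)\<^sup>2) * ft (\<lambda>x. I.cut_in t x * \<phi> t x) \<xi>"
      unfolding in_out by (rule phase_op_rp[OF phi(1) F1])
    from evol_back[OF p] obtain q where q: "rp (free_evol (- t) (phase_op (\<lambda>s. 1 - \<chi>c s) \<alpha> t (\<psi> t))) q"
      "AE \<xi> in lborel. ft q \<xi> = ft (\<lambda>x. I.cut_in t x * \<phi> t x) \<xi>" by blast
    have ql: "l2 q" using q(1) by (simp add: rp_def)
    have "AE \<xi> in lborel. cmod (ft (\<lambda>x. q x - \<Omega> x) \<xi>) = cmod (ft (\<lambda>x. I.cut_in t x * \<phi> t x - \<Omega> x) \<xi>)"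
      using q(2) ft_diff[OF ql ha_l2[OF Om]] ft_diff[OF l2in ha_l2[OF Om], of t] by eventually_elim simp
    from hn_cong(1)[OF l2_diff(1)[OF ql ha_l2[OF Om]] l2d this, of a] show ?thesis
      unfolding Ha_rp(2)[OF rp_diff[OF q(1) rOm]] \<kappa>_def by simp
  qed
  have weak: "((\<lambda>t. Ha_inner a (free_evol (- t) (phase_op \<chi>c \<alpha> t (\<psi> t))) g) \<longlongrightarrow> 0) at_top" if g: "in_Ha a g" for g
  proof -
    obtain g' where g': "rp g g'" using g rp_exists[of g] unfolding in_Ha_def by blast
    have hag: "ha a g'" using g unfolding Ha_rp(1)[OF g'] .
    have gl: "l2 g'" by (rule ha_l2[OF hag])
    let ?J = "\<lambda>t. LINT \<xi>|lborel. complex_of_real (jw a \<xi>) * cnj (ft g' \<xi>) * ft (\<lambda>x. I.cut_out t x * \<phi> t x) \<xi>"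
    have "Ha_inner a (free_evol (- t) (phase_op \<chi>c \<alpha> t (\<psi> t))) g = complex_of_real ((2 * pi) powr (- real CARD('n))) * ?J t" for t
    proof -
      obtain p where p: "rp (phase_op \<chi>c \<alpha> t (\<psi> t)) p"
        "AE \<xi> in lborel. ft p \<xi> = cis (- t * (norm \<xi>)\<^sup>2) * ft (\<lambda>x. I.cut_out t x * \<phi> t x) \<xi>"
        unfolding in_out by (rule phase_op_rp[OF phi(1) F2])
      from evol_back[OF p] obtain q where q: "rp (free_evol (- t) (phase_op \<chi>c \<alpha> t (\<psi> t))) q"
        "AE \<xi> in lborel. ft q \<xi> = ft (\<lambda>x. I.cut_out t x * \<phi> t x) \<xi>" by blast
      have ql: "l2 q" using q(1) by (simp add: rp_def)
      have "(LINT \<xi>|lborel. complex_of_real (jw a \<xi>) * cnj (ft g' \<xi>) * ft q \<xi>) = ?J t"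
      proof (rule integral_cong_AE)
        have [measurable]: "ft g' \<in> borel_measurable borel" "ft q \<in> borel_measurable borel"
          "ft (\<lambda>x. I.cut_out t x * \<phi> t x) \<in> borel_measurable borel"
          by (intro l2_measurable l2_ft gl ql l2out)+
        show "(\<lambda>\<xi>. complex_of_real (jw a \<xi>) * cnj (ft g' \<xi>) * ft q \<xi>) \<in> borel_measurable lborel"
          "(\<lambda>\<xi>. complex_of_real (jw a \<xi>) * cnj (ft g' \<xi>) * ft (\<lambda>x. I.cut_out t x * \<phi> t x) \<xi>) \<in> borel_measurable lborel"
          by measurable
        show "AE \<xi> in lborel. complex_of_real (jw a \<xi>) * cnj (ft g' \<xi>) * ft q \<xi>
           = complex_of_real (jw a \<xi>) * cnj (ft g' \<xi>) * ft (\<lambda>x. I.cut_out t x * \<phi> t x) \<xi>"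
          using q(2) by eventually_elim simp
      qed
      then show ?thesis unfolding Ha_inner_rp[OF q(1) g'] by simp
    qed
    then show ?thesis using tendsto_mult_right_zero[OF I.weak_limit[OF hag]] by simp
  qed
  \<comment> \<open>The remainder is the free evolution of
    \<open>I.cut_in t x * \<phi> t x - \<Omega> x\<close>, since the outer part is subtracted from
    the whole. Its norm is therefore exactly the quantity in \<open>first\<close>.\<close>
  have third: "Ha_norm a (\<lambda>x. \<psi> t x - free_evol t \<Omega> x - phase_op \<chi>c \<alpha> t (\<psi> t) x)
     = sqrt (hn a (\<lambda>x. I.cut_in t x * \<phi> t x - \<Omega> x) / \<kappa>)" for t
  proof -
    obtain p where p: "rp (phase_op \<chi>c \<alpha> t (\<psi> t)) p"
      "AE \<xi> in lborel. ft p \<xi> = cis (- t * (norm \<xi>)\<^sup>2) * ft (\<lambda>x. I.cut_out t x * \<phi> t x) \<xi>"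
      unfolding in_out by (rule phase_op_rp[OF phi(1) F2])
    obtain e where e: "rp (free_evol t \<Omega>) e" "AE \<xi> in lborel. ft e \<xi> = cis (- t * (norm \<xi>)\<^sup>2) * ft \<Omega> \<xi>"
      by (rule free_evol_rp[OF rOm])
    have pl: "l2 p" and el: "l2 e" using p(1) e(1) by (auto simp: rp_def)
    have split: "(\<lambda>x. I.cut_in t x * \<phi> t x - \<Omega> x) = (\<lambda>x. \<phi> t x - I.cut_out t x * \<phi> t x - \<Omega> x)"
      using I.inner_plus_outer[of t _ "\<phi> t _"] by (auto simp: fun_eq_iff eq_diff_eq)
    have "AE \<xi> in lborel. cmod (ft (\<lambda>x. \<Psi> t x - e x - p x) \<xi>) = cmod (ft (\<lambda>x. I.cut_in t x * \<phi> t x - \<Omega> x) \<xi>)"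
      unfolding split
      using ft_diff[OF l2_diff(1)[OF l2Psi el] pl, of t] ft_diff[OF l2Psi el, of t]
        ft_diff[OF l2_diff(1)[OF l2phi l2out] ha_l2[OF Om], of t t] ft_diff[OF l2phi l2out, of t t]
        p(2) e(2) phi(2)[of t]
    proof eventually_elim
      case (elim \<xi>)
      let ?c = "cis (- t * (norm \<xi>)\<^sup>2)"
      have "ft (\<Psi> t) \<xi> = ?c * ft (\<phi> t) \<xi>"
        unfolding elim(7) by (simp add: cis_mult flip: mult.assoc)
      then have "ft (\<lambda>x. \<Psi> t x - e x - p x) \<xi> = ?c * ft (\<lambda>x. \<phi> t x - I.cut_out t x * \<phi> t x - \<Omega> x) \<xi>"
        unfolding elim(1-6) by (simp add: algebra_simps)
      then show ?case by (simp add: norm_mult)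
    qed
    from hn_cong(1)[OF l2_diff(1)[OF l2_diff(1)[OF l2Psi el] pl] l2d this, of a] show ?thesis
      unfolding Ha_rp(2)[OF rp_diff[OF rp_diff[OF Psi e(1)] p(1)]] \<kappa>_def by simp
  qed
  show ?thesis
  proof (intro exI[of _ \<Omega>] conjI allI impI)
    show "in_Ha a \<Omega>" using Om unfolding Ha_rp(1)[OF rOm] .
  qed (use lim' weak in \<open>simp_all add: first third\<close>)
qed

end
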